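(* Let $p\colon E\to B$ be a continuous definable map between definable sets. If there is a finite definable open covering $\mathcal{U}$ of $B$ such that for each $U\in\mathcal{U}$ the restriction $p|_{p^{-1}(U)}\colon p^{-1}(U)\to U$ is a definable fibration, then $p$ is a definable fibration.
   Context: Work in an o-minimal expansion $\mathcal{M}$ of a real closed field; definable means definable in $\mathcal{M}$ with parameters; $I=[0,1]\subset M$. A continuous definable map $q\colon E'\to B'$ is a definable fibration if for every definable set $X$, every definable continuous $f\colon X\times I\to B'$ and every definable continuous $g\colon X\to E'$ with $q\circ g=f(-,0)$ there is a definable continuous $h\colon X\times I\to E'$ with $q\circ h=f$ and $h(-,0)=g$. *)

theory Defs
  imports "HOL-Analysis.Analysis"
begin

(* The second axiom says that every polynomial of odd degree has a root; it is written with
   coefficient sequences because the type of polynomials is not usable inside a class context. *)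
class real_closed_field = linordered_field +
  assumes real_closed_sqrt: "0 \<le> a \<Longrightarrow> \<exists>b. b * b = a"
    and real_closed_odd_root: "odd n \<Longrightarrow> c n \<noteq> 0 \<Longrightarrow> \<exists>x. (\<Sum>k\<le>n. c k * x ^ k) = 0"

(* First-order language extending the language (0, 1, +, -, *, <) of ordered rings by function
   symbols 'f and relation symbols 'r.  Arities are not tracked: a symbol applied to argument
   lists of different lengths amounts to a family of symbols, one for each arity. *)

datatype 'f fo_term =
    Var nat
  | Zero
  | One
  | Plus "'f fo_term" "'f fo_term"
  | Minus "'f fo_term"
  | Times "'f fo_term" "'f fo_term"
  | App 'f "'f fo_term list"

datatype ('f, 'r) fo_formula =
    Equal "'f fo_term" "'f fo_term"
  | Less "'f fo_term" "'f fo_term"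
  | Rel 'r "'f fo_term list"
  | Neg "('f, 'r) fo_formula"
  | Conj "('f, 'r) fo_formula" "('f, 'r) fo_formula"
  | Exists nat "('f, 'r) fo_formula"

(* An expansion of the ordered field 'a interprets only the additional symbols; the symbols of
   ordered rings always have their standard meaning. *)
record ('a, 'f, 'r) expansion =
  fun_interp :: "'f \<Rightarrow> 'a list \<Rightarrow> 'a"
  rel_interp :: "'r \<Rightarrow> 'a list \<Rightarrow> bool"

primrec term_val ::
    "('a::linordered_field, 'f, 'r) expansion \<Rightarrow> (nat \<Rightarrow> 'a) \<Rightarrow> 'f fo_term \<Rightarrow> 'a" where
  "term_val M v (Var i) = v i"
| "term_val M v Zero = 0"
| "term_val M v One = 1"
| "term_val M v (Plus s t) = term_val M v s + term_val M v t"
| "term_val M v (Minus s) = - term_val M v s"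
| "term_val M v (Times s t) = term_val M v s * term_val M v t"
| "term_val M v (App f ts) = fun_interp M f (map (term_val M v) ts)"

primrec sat ::
    "('a::linordered_field, 'f, 'r) expansion \<Rightarrow> (nat \<Rightarrow> 'a) \<Rightarrow> ('f, 'r) fo_formula \<Rightarrow> bool" where
  "sat M v (Equal s t) \<longleftrightarrow> term_val M v s = term_val M v t"
| "sat M v (Less s t) \<longleftrightarrow> term_val M v s < term_val M v t"
| "sat M v (Rel r ts) \<longleftrightarrow> rel_interp M r (map (term_val M v) ts)"
| "sat M v (Neg \<phi>) \<longleftrightarrow> \<not> sat M v \<phi>"
| "sat M v (Conj \<phi> \<psi>) \<longleftrightarrow> sat M v \<phi> \<and> sat M v \<psi>"
| "sat M v (Exists i \<phi>) \<longleftrightarrow> (\<exists>a. sat M (v(i := a)) \<phi>)"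

(* Points of the n-th Cartesian power of 'a are lists of length n.  The variables below n range
   over the coordinates of the point; those from n on are assigned the parameters w. *)
definition definable ::
    "('a::linordered_field, 'f, 'r) expansion \<Rightarrow> nat \<Rightarrow> 'a list set \<Rightarrow> bool" where
  "definable M n S \<longleftrightarrow>
     (\<exists>\<phi> w. S = {x. length x = n \<and> sat M (\<lambda>i. if i < n then x ! i else w i) \<phi>})"

definition point_or_open_interval :: "'a::linorder set \<Rightarrow> bool" where
  "point_or_open_interval J \<longleftrightarrow>
     (\<exists>a. J = {a}) \<or> (\<exists>a b. J = {a<..<b}) \<or> (\<exists>a. J = {a<..}) \<or> (\<exists>b. J = {..<b}) \<or> J = UNIV"

definition o_minimal :: "('a::linordered_field, 'f, 'r) expansion \<Rightarrow> bool" where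
  "o_minimal M \<longleftrightarrow>
     (\<forall>S. definable M 1 S \<longrightarrow>
       (\<exists>\<J>. finite \<J> \<and> (\<forall>J\<in>\<J>. point_or_open_interval J) \<and> {x. [x] \<in> S} = \<Union>\<J>))"

definition open_box :: "nat \<Rightarrow> (nat \<Rightarrow> 'a) \<Rightarrow> (nat \<Rightarrow> 'a) \<Rightarrow> 'a::linordered_field list set" where
  "open_box n a b = {x. length x = n \<and> (\<forall>i<n. a i < x ! i \<and> x ! i < b i)}"

(* Product of the order topology: the boxes cover all lists of length n since a field has
   neither a least nor a greatest element. *)
definition power_topology :: "nat \<Rightarrow> 'a::linordered_field list topology" where
  "power_topology n = topology_generated_by {open_box n a b | a b. True}"

(* Only the values of f on X matter; the sets X and Y lie in the powers m and n. *)
definition definable_map ::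
    "('a::linordered_field, 'f, 'r) expansion \<Rightarrow> nat \<Rightarrow> nat \<Rightarrow> 'a list set \<Rightarrow> 'a list set \<Rightarrow>
       ('a list \<Rightarrow> 'a list) \<Rightarrow> bool" where
  "definable_map M m n X Y f \<longleftrightarrow>
     definable M m X \<and> definable M n Y \<and> f \<in> X \<rightarrow> Y \<and> definable M (m + n) {x @ f x | x. x \<in> X}"

definition definable_continuous_map ::
    "('a::linordered_field, 'f, 'r) expansion \<Rightarrow> nat \<Rightarrow> nat \<Rightarrow> 'a list set \<Rightarrow> 'a list set \<Rightarrow>
       ('a list \<Rightarrow> 'a list) \<Rightarrow> bool" where
  "definable_continuous_map M m n X Y f \<longleftrightarrow>
     definable_map M m n X Y f \<and>
     continuous_map (subtopology (power_topology m) X) (subtopology (power_topology n) Y) f"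

definition cylinder :: "'a::linordered_field list set \<Rightarrow> 'a list set" where
  "cylinder X = {x @ [t] | x t. x \<in> X \<and> t \<in> {0..1}}"

definition definable_fibration ::
    "('a::linordered_field, 'f, 'r) expansion \<Rightarrow> nat \<Rightarrow> nat \<Rightarrow> 'a list set \<Rightarrow> 'a list set \<Rightarrow>
       ('a list \<Rightarrow> 'a list) \<Rightarrow> bool" where
  "definable_fibration M e b E B q \<longleftrightarrow>
     definable_continuous_map M e b E B q \<and>
     (\<forall>m X f g.
        definable M m X \<longrightarrow>
        definable_continuous_map M (m + 1) b (cylinder X) B f \<longrightarrow>
        definable_continuous_map M m e X E g \<longrightarrow>
        (\<forall>x\<in>X. q (g x) = f (x @ [0])) \<longrightarrow>
        (\<exists>h. definable_continuous_map M (m + 1) e (cylinder X) E h \<and>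
             (\<forall>z\<in>cylinder X. q (h z) = f z) \<and>
             (\<forall>x\<in>X. h (x @ [0]) = g x)))"

end

theory Submission
  imports Defs
begin

text \<open>
  It suffices to glue two open sets \<open>U\<close> and \<open>V\<close>. Given a homotopy on \<open>X \<times> I\<close>, the definable distance
  functions yield a continuous definable \<open>\<gamma>\<close> with values in \<open>[-1, 1]\<close> such that a point is mapped to
  \<open>U\<close> where \<open>\<gamma> > -1\<close> and to \<open>V\<close> where \<open>\<gamma> < 1\<close>. A lift defined up to a continuous time \<open>s(x)\<close> is
  extended alternately by means of \<open>U\<close> and of \<open>V\<close>: when \<open>U\<close> is used, up to the time at which the
  maximum of \<open>-\<gamma>\<close> since \<open>s(x)\<close>, plus the elapsed time, reaches \<open>1/2\<close>. This quantity is strictly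
  increasing in time, so the new time is again continuous in \<open>x\<close>, on all of \<open>X\<close> at once; no
  triangulation or cell decomposition is needed. Two consecutive extensions either take at least
  time \<open>1/4\<close> or pass a sign change of \<open>\<gamma>\<close> along the fibre over \<open>x\<close>, and by uniform finiteness the
  number of sign changes is bounded independently of \<open>x\<close>. Hence finitely many extensions reach
  time \<open>1\<close> everywhere.

  Uniform finiteness is proved by induction on the number of parameters: over a line of parameters
  the number of points in the fibres is locally constant outside a finite set that is itself
  uniformly definable, so it is controlled by finitely many definable sample points, which lie in a
  family with one parameter less.
\<close>

section \<open>Definable predicates on valuations\<close>

text \<open>The obstacle is that the field may be non-archimedean. Over a fixed \<open>x\<close>
  definable compactness still gives a positive length such that shorter time intervals are mapped
  into one of the two sets, but it may be infinitesimal, so that finitely many equal steps need not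
  reach time 1, and it need not be bounded below as \<open>x\<close> varies. Steps are therefore
  adapted to the path and counted by sign changes of \<gamma>, which o-minimality does bound.
  Stopping when -\<gamma> first reaches a level would be counted as easily, but such a hitting time
  may jump with \<open>x\<close>; hence the running maximum, and the elapsed time that makes it
  strictly increasing. The level 1/2 stays strictly below 1, the value of -\<gamma> at which
  \<open>U\<close> may be left, and above 1/4, the elapsed time that already counts as progress: a
  step shorter than 1/4 that ends before time 1 has met a point with -\<gamma> > 0, and a short step
  for \<open>V\<close> likewise meets \<gamma> > 0.\<close>

primrec term_vars :: "'f fo_term \<Rightarrow> nat set" where
  "term_vars (Var i) = {i}"
| "term_vars Zero = {}"
| "term_vars One = {}"
| "term_vars (Plus s t) = term_vars s \<union> term_vars t"
| "term_vars (Minus s) = term_vars s"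
| "term_vars (Times s t) = term_vars s \<union> term_vars t"
| "term_vars (App f ts) = \<Union> (set (map term_vars ts))"

primrec term_rename :: "(nat \<Rightarrow> nat) \<Rightarrow> 'f fo_term \<Rightarrow> 'f fo_term" where
  "term_rename \<rho> (Var i) = Var (\<rho> i)"
| "term_rename \<rho> Zero = Zero"
| "term_rename \<rho> One = One"
| "term_rename \<rho> (Plus s t) = Plus (term_rename \<rho> s) (term_rename \<rho> t)"
| "term_rename \<rho> (Minus s) = Minus (term_rename \<rho> s)"
| "term_rename \<rho> (Times s t) = Times (term_rename \<rho> s) (term_rename \<rho> t)"
| "term_rename \<rho> (App f ts) = App f (map (term_rename \<rho>) ts)"

text \<open>Bound variables are included, so that an index above all of them is fresh.\<close>

primrec formula_vars :: "('f, 'r) fo_formula \<Rightarrow> nat set" where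
  "formula_vars (Equal s t) = term_vars s \<union> term_vars t"
| "formula_vars (Less s t) = term_vars s \<union> term_vars t"
| "formula_vars (Rel r ts) = \<Union> (set (map term_vars ts))"
| "formula_vars (Neg \<phi>) = formula_vars \<phi>"
| "formula_vars (Conj \<phi> \<psi>) = formula_vars \<phi> \<union> formula_vars \<psi>"
| "formula_vars (Exists i \<phi>) = formula_vars \<phi>"

text \<open>Capture is avoided by moving each bound variable above the images of all variables of
  the body, so that \<open>sat_rename\<close> holds for every renaming, injective or not.\<close>

primrec formula_rename :: "('f, 'r) fo_formula \<Rightarrow> (nat \<Rightarrow> nat) \<Rightarrow> ('f, 'r) fo_formula" where
  "formula_rename (Equal s t) \<rho> = Equal (term_rename \<rho> s) (term_rename \<rho> t)"
| "formula_rename (Less s t) \<rho> = Less (term_rename \<rho> s) (term_rename \<rho> t)"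
| "formula_rename (Rel r ts) \<rho> = Rel r (map (term_rename \<rho>) ts)"
| "formula_rename (Neg \<phi>) \<rho> = Neg (formula_rename \<phi> \<rho>)"
| "formula_rename (Conj \<phi> \<psi>) \<rho> = Conj (formula_rename \<phi> \<rho>) (formula_rename \<psi> \<rho>)"
| "formula_rename (Exists i \<phi>) \<rho> =
     (let j = Suc (Max (insert 0 (\<rho> ` formula_vars \<phi>)))
      in Exists j (formula_rename \<phi> (\<rho>(i := j))))"

section \<open>Coincidence and renaming for the satisfaction relation\<close>

lemma finite_term_vars: "finite (term_vars t)"
  by (induction t) auto

lemma finite_formula_vars: "finite (formula_vars \<phi>)"
  by (induction \<phi>) (auto simp: finite_term_vars)

lemma term_val_cong: "(\<And>i. i \<in> term_vars t \<Longrightarrow> v i = w i) \<Longrightarrow> term_val M v t = term_val M w t"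
proof (induction t)
  case (App f ts)
  have "map (term_val M v) ts = map (term_val M w) ts"
    using App by auto
  then show ?case by (simp del: map_eq_conv)
qed auto

lemma sat_cong: "(\<And>i. i \<in> formula_vars \<phi> \<Longrightarrow> v i = w i) \<Longrightarrow> sat M v \<phi> = sat M w \<phi>"
proof (induction \<phi> arbitrary: v w)
  case (Equal s t)
  then show ?case using term_val_cong[of s v w M] term_val_cong[of t v w M] by auto
next
  case (Less s t)
  then show ?case using term_val_cong[of s v w M] term_val_cong[of t v w M] by auto
next
  case (Rel r ts)
  have "map (term_val M v) ts = map (term_val M w) ts"
    using Rel by (auto intro!: term_val_cong)
  then show ?case by (simp del: map_eq_conv)
next
  case (Neg \<phi>)
  have "sat M v \<phi> = sat M w \<phi>" using Neg.prems by (intro Neg.IH) auto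
  then show ?case by simp
next
  case (Conj \<phi> \<psi>)
  have "sat M v \<phi> = sat M w \<phi>" "sat M v \<psi> = sat M w \<psi>"
    using Conj.prems by (intro Conj.IH; auto)+
  then show ?case by simp
next
  case (Exists i \<phi>)
  have "sat M (v(i := a)) \<phi> = sat M (w(i := a)) \<phi>" for a
    using Exists.prems by (intro Exists.IH) auto
  then show ?case by simp
qed

lemma term_val_rename: "term_val M v (term_rename \<rho> t) = term_val M (\<lambda>i. v (\<rho> i)) t"
proof (induction t)
  case (App f ts)
  have "map (term_val M v) (map (term_rename \<rho>) ts) = map (term_val M (\<lambda>i. v (\<rho> i))) ts"
    using App by auto
  then show ?case by (simp del: map_eq_conv map_map)
qed auto

lemma sat_rename: "sat M v (formula_rename \<phi> \<rho>) = sat M (\<lambda>i. v (\<rho> i)) \<phi>"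
proof (induction \<phi> arbitrary: v \<rho>)
  case (Rel r ts)
  have "map (term_val M v) (map (term_rename \<rho>) ts) = map (term_val M (\<lambda>i. v (\<rho> i))) ts"
    by (auto simp: term_val_rename)
  then show ?case by (simp del: map_eq_conv map_map)
next
  case (Exists i \<phi>)
  define j where "j = Suc (Max (insert 0 (\<rho> ` formula_vars \<phi>)))"
  have fresh: "\<rho> k \<noteq> j" if "k \<in> formula_vars \<phi>" for k
  proof -
    have "\<rho> k \<le> Max (insert 0 (\<rho> ` formula_vars \<phi>))"
      using that by (intro Max_ge) (auto simp: finite_formula_vars)
    then show ?thesis unfolding j_def by simp
  qed
  have "sat M (v(j := a)) (formula_rename \<phi> (\<rho>(i := j))) = sat M ((\<lambda>i. v (\<rho> i))(i := a)) \<phi>" for a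
    unfolding Exists.IH by (rule sat_cong) (auto simp: fresh)
  then show ?case by (simp add: j_def[symmetric] Let_def)
qed (auto simp: term_val_rename)

text \<open>Even indices carry the free variables and odd indices the parameters, which leaves room
  for infinitely many of both. Free variables are treated as de Bruijn indices: a quantifier binds
  index \<open>0\<close> and shifts the others, so that a formula with parameters is decomposed by resolution
  with the rules \<open>dfn_intros\<close>. Definable scalars and tuples depending on a valuation are called
  \<open>dsc\<close> and \<open>dl\<close>, definable scalar functions of \<open>n\<close>-tuples \<open>dsf\<close>.\<close>

definition interleave :: "(nat \<Rightarrow> 'a) \<Rightarrow> (nat \<Rightarrow> 'a) \<Rightarrow> nat \<Rightarrow> 'a" where
  "interleave v w = (\<lambda>i. if even i then v (i div 2) else w (i div 2))"

definition dfn :: "('a::linordered_field, 'f, 'r) expansion \<Rightarrow> ((nat \<Rightarrow> 'a) \<Rightarrow> bool) \<Rightarrow> bool" where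
  "dfn M P \<longleftrightarrow> (\<exists>\<phi> w. \<forall>v. P v \<longleftrightarrow> sat M (interleave v w) \<phi>)"

lemma dfn_rename:
  assumes "dfn M P" shows "dfn M (\<lambda>v. P (\<lambda>i. v (\<rho> i)))"
proof -
  obtain \<phi> w where 1: "\<And>v. P v \<longleftrightarrow> sat M (interleave v w) \<phi>"
    using assms unfolding dfn_def by blast
  define r where "r = (\<lambda>i::nat. if even i then 2 * \<rho> (i div 2) else i)"
  have "(\<lambda>i. interleave v w (r i)) = interleave (\<lambda>i. v (\<rho> i)) w" for v
    by (auto simp: interleave_def r_def fun_eq_iff)
  then have "P (\<lambda>i. v (\<rho> i)) \<longleftrightarrow> sat M (interleave v w) (formula_rename \<phi> r)" for v
    by (simp add: 1 sat_rename)
  then show ?thesis unfolding dfn_def by blast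
qed

lemma dfn_not:
  assumes "dfn M P" shows "dfn M (\<lambda>v. \<not> P v)"
proof -
  obtain \<phi> w where "\<And>v. P v \<longleftrightarrow> sat M (interleave v w) \<phi>"
    using assms unfolding dfn_def by blast
  then have "\<not> P v \<longleftrightarrow> sat M (interleave v w) (Neg \<phi>)" for v by simp
  then show ?thesis unfolding dfn_def by blast
qed

lemma dfn_conj:
  assumes "dfn M P" "dfn M Q" shows "dfn M (\<lambda>v. P v \<and> Q v)"
proof -
  obtain \<phi> w where 1: "\<And>v. P v \<longleftrightarrow> sat M (interleave v w) \<phi>"
    using assms unfolding dfn_def by blast
  obtain \<psi> u where 2: "\<And>v. Q v \<longleftrightarrow> sat M (interleave v u) \<psi>"
    using assms unfolding dfn_def by blast
  \<comment> \<open>Two parameter sequences share the odd indices: \<open>w\<close> is read at the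
    indices 1 modulo 4 and \<open>u\<close> at those 3 modulo 4.\<close>
  define r where "r = (\<lambda>i::nat. if even i then i else 4 * (i div 2) + 1)"
  define s where "s = (\<lambda>i::nat. if even i then i else 4 * (i div 2) + 3)"
  have e1: "(\<lambda>i. interleave v (interleave w u) (r i)) = interleave v w" for v
    by (auto simp: interleave_def r_def fun_eq_iff elim!: oddE)
  have e2: "(\<lambda>i. interleave v (interleave w u) (s i)) = interleave v u" for v
  proof
    fix i
    show "interleave v (interleave w u) (s i) = interleave v u i"
    proof (cases "even i")
      case False
      have "(4 * (i div 2) + 3) div 2 = 2 * (i div 2) + 1" by presburger
      with False show ?thesis by (simp add: interleave_def s_def)
    qed (simp add: interleave_def s_def)
  qed
  have "P v \<and> Q v \<longleftrightarrow> sat M (interleave v (interleave w u)) (Conj (formula_rename \<phi> r) (formula_rename \<psi> s))" for v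
    by (simp add: sat_rename e1 e2 1 2)
  then show ?thesis unfolding dfn_def by blast
qed

lemma dfn_ex:
  assumes "dfn M (\<lambda>v. P (v 0) (\<lambda>i. v (Suc i)))" shows "dfn M (\<lambda>v. \<exists>a. P a v)"
proof -
  obtain \<phi> w where 1: "\<And>v. P (v 0) (\<lambda>i. v (Suc i)) \<longleftrightarrow> sat M (interleave v w) \<phi>"
    using assms unfolding dfn_def by blast
  \<comment> \<open>Free variables move down by one place, that is, by two indices. Index 0, where
    truncated subtraction gives 0 again, belongs to the bound variable and is overwritten.\<close>
  define r where "r = (\<lambda>i::nat. if even i then i - 2 else i)"
  have e: "(\<lambda>i. interleave v w (r i))(0 := a) = interleave (case_nat a v) w" for v a
    by (auto simp: interleave_def r_def fun_eq_iff elim!: evenE oddE split: nat.split)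
  have "P a v \<longleftrightarrow> sat M (interleave (case_nat a v) w) \<phi>" for a v
    using 1[of "case_nat a v"] by simp
  then have "(\<exists>a. P a v) \<longleftrightarrow> sat M (interleave v w) (formula_rename (Exists 0 \<phi>) r)" for v
    by (simp add: sat_rename e del: formula_rename.simps)
  then show ?thesis unfolding dfn_def by blast
qed

lemma dfn_const: "dfn M (\<lambda>v. c)"
proof (cases c)
  case True
  then have "c \<longleftrightarrow> sat M (interleave v v) (Equal Zero Zero)" for v by simp
  with True show ?thesis unfolding dfn_def by (intro exI[of _ "Equal Zero Zero"]) simp
next
  case False
  then show ?thesis unfolding dfn_def by (intro exI[of _ "Neg (Equal Zero Zero)"]) simp
qed

lemma dfn_disj:
  assumes "dfn M P" "dfn M Q" shows "dfn M (\<lambda>v. P v \<or> Q v)"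
  using dfn_not[OF dfn_conj[OF dfn_not[OF assms(1)] dfn_not[OF assms(2)]]] by simp

lemma dfn_imp:
  assumes "dfn M P" "dfn M Q" shows "dfn M (\<lambda>v. P v \<longrightarrow> Q v)"
  using dfn_not[OF dfn_conj[OF assms(1) dfn_not[OF assms(2)]]] by simp

lemma dfn_iff:
  assumes "dfn M P" "dfn M Q" shows "dfn M (\<lambda>v. P v \<longleftrightarrow> Q v)"
proof -
  have "dfn M (\<lambda>v. (P v \<longrightarrow> Q v) \<and> (Q v \<longrightarrow> P v))"
    using assms by (intro dfn_conj dfn_imp)
  moreover have "(\<lambda>v. (P v \<longrightarrow> Q v) \<and> (Q v \<longrightarrow> P v)) = (\<lambda>v. P v \<longleftrightarrow> Q v)" by auto
  ultimately show ?thesis by simp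
qed

lemma dfn_all:
  assumes "dfn M (\<lambda>v. P (v 0) (\<lambda>i. v (Suc i)))" shows "dfn M (\<lambda>v. \<forall>a. P a v)"
proof -
  have "dfn M (\<lambda>v. \<exists>a. \<not> P a v)"
    by (rule dfn_ex) (rule dfn_not[OF assms])
  from dfn_not[OF this] show ?thesis by simp
qed

lemma dfn_less_var: "dfn M (\<lambda>v. v i < v j)"
  unfolding dfn_def by (intro exI[of _ "Less (Var (2 * i)) (Var (2 * j))"]) (simp add: interleave_def)

lemma dfn_eq_var: "dfn M (\<lambda>v. v i = v j)"
  unfolding dfn_def by (intro exI[of _ "Equal (Var (2 * i)) (Var (2 * j))"]) (simp add: interleave_def)

lemma dfn_eq_plus_var: "dfn M (\<lambda>v. v i = v j + v k)"
  unfolding dfn_def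
  by (intro exI[of _ "Equal (Var (2 * i)) (Plus (Var (2 * j)) (Var (2 * k)))"]) (simp add: interleave_def)

lemma dfn_eq_times_var: "dfn M (\<lambda>v. v i = v j * v k)"
  unfolding dfn_def
  by (intro exI[of _ "Equal (Var (2 * i)) (Times (Var (2 * j)) (Var (2 * k)))"]) (simp add: interleave_def)

lemma dfn_eq_const_var: "dfn M (\<lambda>v. v i = c)"
  unfolding dfn_def
  \<comment> \<open>\<open>Var 1\<close> is the first parameter, so any element of the field may be
    named.\<close>
  by (intro exI[of _ "Equal (Var (2 * i)) (Var 1)"] exI[of _ "\<lambda>_. c"]) (simp add: interleave_def)

section \<open>Definable scalar functions and substitution\<close>

definition dsc :: "('a::linordered_field, 'f, 'r) expansion \<Rightarrow> ((nat \<Rightarrow> 'a) \<Rightarrow> 'a) \<Rightarrow> bool" where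
  "dsc M T \<longleftrightarrow> dfn M (\<lambda>v. v 0 = T (\<lambda>i. v (Suc i)))"

lemma dsc_rename:
  assumes "dsc M T" shows "dsc M (\<lambda>v. T (\<lambda>i. v (\<rho> i)))"
  using dfn_rename[OF assms[unfolded dsc_def], of "\<lambda>i. if i = 0 then 0 else Suc (\<rho> (i - 1))"]
  unfolding dsc_def by simp

lemma dfn_eq_dsc:
  assumes "dsc M T" shows "dfn M (\<lambda>v. v i = T (\<lambda>k. v (\<rho> k)))"
  using dfn_rename[OF assms[unfolded dsc_def], of "\<lambda>k. if k = 0 then i else \<rho> (k - 1)"] by simp

text \<open>A definable function is in general not given by a term, so its value is substituted by
  quantifying over it: some \<open>a\<close> lies on the graph and satisfies
  \<open>P\<close>.\<close>

lemma dfn_subst: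
  assumes T: "dsc M T" and P: "dfn M (\<lambda>v. P (v 0) (\<lambda>i. v (Suc i)))"
  shows "dfn M (\<lambda>v. P (T v) v)"
proof -
  have "dfn M (\<lambda>v. \<exists>a. a = T v \<and> P a v)"
    by (rule dfn_ex, rule dfn_conj, rule dfn_eq_dsc[OF T], rule P)
  then show ?thesis by simp
qed

lemma dfn_subst2:
  assumes T: "dsc M T" and U: "dsc M U"
    and P: "dfn M (\<lambda>v. P (v 0) (v 1) (\<lambda>i. v (Suc (Suc i))))"
  shows "dfn M (\<lambda>v. P (T v) (U v) v)"
proof -
  have "dfn M (\<lambda>v. \<exists>b. \<exists>a. a = T v \<and> b = U v \<and> P a b v)"
    by (intro dfn_ex dfn_conj dfn_eq_dsc[OF T] dfn_eq_dsc[OF U])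
      (use P in simp)
  then show ?thesis by simp
qed

lemma dfn_less: "dsc M T \<Longrightarrow> dsc M U \<Longrightarrow> dfn M (\<lambda>v. T v < U v)"
  by (rule dfn_subst2[where P = "\<lambda>a b v. a < b"]) (auto intro: dfn_less_var)

lemma dfn_eq: "dsc M T \<Longrightarrow> dsc M U \<Longrightarrow> dfn M (\<lambda>v. T v = U v)"
  by (rule dfn_subst2[where P = "\<lambda>a b v. a = b"]) (auto intro: dfn_eq_var)

lemma dfn_le: "dsc M T \<Longrightarrow> dsc M U \<Longrightarrow> dfn M (\<lambda>v. T v \<le> U v)"
  using dfn_not[OF dfn_less, of M U T] by (simp add: not_less)

lemma dsc_var: "dsc M (\<lambda>v. v i)"
  unfolding dsc_def by (rule dfn_eq_var)

lemma dsc_const: "dsc M (\<lambda>v. c)"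
  unfolding dsc_def by (rule dfn_eq_const_var)

lemma dsc_subst2:
  assumes "dsc M T" "dsc M U" and F: "dfn M (\<lambda>v. v 2 = F (v 0) (v 1))"
  shows "dsc M (\<lambda>v. F (T v) (U v))"
  unfolding dsc_def
proof (rule dfn_subst2[where P = "\<lambda>a b v. v 0 = F a b"])
  show "dsc M (\<lambda>v. T (\<lambda>i. v (Suc i)))" "dsc M (\<lambda>v. U (\<lambda>i. v (Suc i)))"
    by (rule dsc_rename, rule assms)+
  show "dfn M (\<lambda>v. v (Suc (Suc 0)) = F (v 0) (v 1))"
    using F by (simp add: numeral_2_eq_2)
qed

lemma dsc_plus: "dsc M T \<Longrightarrow> dsc M U \<Longrightarrow> dsc M (\<lambda>v. T v + U v)"
  by (rule dsc_subst2[where F = "(+)"]) (auto intro: dfn_eq_plus_var)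

lemma dsc_times: "dsc M T \<Longrightarrow> dsc M U \<Longrightarrow> dsc M (\<lambda>v. T v * U v)"
  by (rule dsc_subst2[where F = "(*)"]) (auto intro: dfn_eq_times_var)

lemma dsc_minus: "dsc M T \<Longrightarrow> dsc M (\<lambda>v. - T v)"
  using dsc_times[OF dsc_const[of M "-1"], of T] by simp

lemma dsc_diff: "dsc M T \<Longrightarrow> dsc M U \<Longrightarrow> dsc M (\<lambda>v. T v - U v)"
  using dsc_plus[OF _ dsc_minus, of M T U] by simp

lemma dsc_divide: "dsc M T \<Longrightarrow> dsc M U \<Longrightarrow> dsc M (\<lambda>v. T v / U v)"
proof (rule dsc_subst2[where F = "(/)"])
  \<comment> \<open>Division by zero yields 0 and is a separate case; otherwise the quotient solves
    a multiplication.\<close>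
  have "dfn M (\<lambda>v. (v 1 = 0 \<and> v 2 = 0) \<or> (\<not> v 1 = 0 \<and> v 0 = v 2 * v 1))"
    by (intro dfn_disj dfn_conj dfn_not dfn_eq dsc_times dsc_var dsc_const)
  then show "dfn M (\<lambda>v. v 2 = v 0 / v 1)"
    by (rule back_subst[of "dfn M"]) (auto simp: fun_eq_iff field_simps split: if_splits)
qed

lemma dsc_if: 
  assumes "dfn M P" "dsc M T" "dsc M U" shows "dsc M (\<lambda>v. if P v then T v else U v)"
proof -
  have "dfn M (\<lambda>v. (P (\<lambda>i. v (Suc i)) \<and> v 0 = T (\<lambda>i. v (Suc i))) \<or>
     (\<not> P (\<lambda>i. v (Suc i)) \<and> v 0 = U (\<lambda>i. v (Suc i))))"
    by (intro dfn_disj dfn_conj dfn_not dfn_eq_dsc assms(2,3) dfn_rename[OF assms(1)])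
  then show ?thesis unfolding dsc_def
    by (rule back_subst[of "dfn M"]) (auto simp: fun_eq_iff)
qed

lemma dsc_max: "dsc M T \<Longrightarrow> dsc M U \<Longrightarrow> dsc M (\<lambda>v. max (T v) (U v))"
  unfolding max_def by (intro dsc_if dfn_le)

lemma dsc_min: "dsc M T \<Longrightarrow> dsc M U \<Longrightarrow> dsc M (\<lambda>v. min (T v) (U v))"
  unfolding min_def by (intro dsc_if dfn_le)

lemma dsc_abs: "dsc M T \<Longrightarrow> dsc M (\<lambda>v. \<bar>T v\<bar>)"
  unfolding abs_if by (intro dsc_if dfn_less dsc_minus dsc_const)

section \<open>Definable tuples, quantifiers over tuples, and definable sets\<close>

definition dls :: "('a::linordered_field, 'f, 'r) expansion \<Rightarrow> nat \<Rightarrow> ((nat \<Rightarrow> 'a) \<Rightarrow> 'a list) \<Rightarrow> bool" where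
  "dls M n L \<longleftrightarrow> (\<forall>v. length (L v) = n) \<and> (\<forall>i<n. dsc M (\<lambda>v. L v ! i))"

lemma dls_length: "dls M n L \<Longrightarrow> length (L v) = n"
  unfolding dls_def by blast

lemma dls_block: "dls M n (\<lambda>v. map (\<lambda>i. v (\<rho> i)) [0..<n])"
  unfolding dls_def by (auto intro: dsc_var)

lemma dls_const: "length c = n \<Longrightarrow> dls M n (\<lambda>v. c)"
  unfolding dls_def by (auto intro: dsc_const)

lemma dls_Cons: "dsc M T \<Longrightarrow> dls M a L \<Longrightarrow> n = Suc a \<Longrightarrow> dls M n (\<lambda>v. T v # L v)"
  unfolding dls_def by (auto simp: less_Suc_eq_0_disj)

lemma dls_append:
  assumes "dls M a L" "dls M b K" "n = a + b" shows "dls M n (\<lambda>v. L v @ K v)"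
  unfolding dls_def
proof (intro conjI allI impI)
  have len: "length (L v) = a" "length (K v) = b" for v
    using assms unfolding dls_def by auto
  show "length (L v @ K v) = n" for v using assms(3) len by simp
  fix i assume "i < n"
  then show "dsc M (\<lambda>v. (L v @ K v) ! i)"
    using assms len unfolding dls_def nth_append by (cases "i < a") auto
qed

lemma dfn_ex_block:
  assumes "dfn M (\<lambda>v. P (map v [0..<n]) (\<lambda>i. v (i + n)))"
  shows "dfn M (\<lambda>v. \<exists>x. length x = n \<and> P x v)"
  using assms
proof (induction n arbitrary: P)
  case 0
  then show ?case by simp
next
  case (Suc n)
  have "dfn M (\<lambda>v. \<exists>x. length x = n \<and> (\<exists>a. P (a # x) v))"
  proof (rule Suc.IH, rule dfn_ex)
    have "map v [0..<Suc n] = v 0 # map (\<lambda>i. v (Suc i)) [0..<n]" for v :: "nat \<Rightarrow> 'a"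
      by (subst upt_conv_Cons) (auto simp: map_Suc_upt[symmetric] simp del: upt_Suc)
    then show "dfn M (\<lambda>v. P (v 0 # map (\<lambda>i. v (Suc i)) [0..<n]) (\<lambda>i. v (Suc (i + n))))"
      using Suc.prems by (simp del: upt_Suc)
  qed
  moreover have "(\<exists>x. length x = n \<and> (\<exists>a. P (a # x) v)) \<longleftrightarrow> (\<exists>x. length x = Suc n \<and> P x v)" for v
    by (auto simp: length_Suc_conv) 
  ultimately show ?case by simp
qed

lemma dfn_all_lt: "(\<And>i. i < n \<Longrightarrow> dfn M (P i)) \<Longrightarrow> dfn M (\<lambda>v. \<forall>i<n::nat. P i v)"
proof (induction n)
  case 0
  then show ?case by (simp add: dfn_const)
next
  case (Suc n)
  then have "dfn M (\<lambda>v. (\<forall>i<n. P i v) \<and> P n v)" by (intro dfn_conj) auto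
  then show ?case
    by (rule back_subst[of "dfn M"]) (auto simp: fun_eq_iff less_Suc_eq)
qed

text \<open>Bridge to the given notion of definability: afterwards definability is established by
  the closure rules for \<open>dfn\<close> instead of by writing formulas.\<close>

lemma definable_iff_dfn:
  "definable M n S \<longleftrightarrow> S \<subseteq> {x. length x = n} \<and> dfn M (\<lambda>v. map v [0..<n] \<in> S)"
proof
  assume "definable M n S"
  then obtain \<phi> w where S: "S = {x. length x = n \<and> sat M (\<lambda>i. if i < n then x ! i else w i) \<phi>}"
    unfolding definable_def by blast
  define r where "r = (\<lambda>i::nat. if i < n then 2 * i else 2 * i + 1)"
  have "(\<lambda>i. interleave v w (r i)) = (\<lambda>i. if i < n then map v [0..<n] ! i else w i)" for v
    by (auto simp: interleave_def r_def fun_eq_iff)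
  then have "map v [0..<n] \<in> S \<longleftrightarrow> sat M (interleave v w) (formula_rename \<phi> r)" for v
    unfolding S sat_rename by simp
  then show "S \<subseteq> {x. length x = n} \<and> dfn M (\<lambda>v. map v [0..<n] \<in> S)"
    using S unfolding dfn_def by blast
next
  assume *: "S \<subseteq> {x. length x = n} \<and> dfn M (\<lambda>v. map v [0..<n] \<in> S)"
  then obtain \<phi> w where 1: "\<And>v. map v [0..<n] \<in> S \<longleftrightarrow> sat M (interleave v w) \<phi>"
    unfolding dfn_def by blast
  \<comment> \<open>Free variables from \<open>n\<close> on do not affect membership and are frozen
    at 0; together with the old parameters they form the new sequence \<open>u\<close>, shifted by
    \<open>n\<close>.\<close>
  define r where "r = (\<lambda>i::nat. if even i \<and> i div 2 < n then i div 2 else n + i)"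
  define u where "u = (\<lambda>i. interleave (\<lambda>_. 0) w (i - n))"
  have e: "(\<lambda>i. (\<lambda>i. if i < n then x ! i else u i) (r i))
      = interleave (\<lambda>i. if i < n then x ! i else 0) w" for x
    by (auto simp: interleave_def r_def u_def fun_eq_iff)
  have "x \<in> S \<longleftrightarrow> length x = n \<and> sat M (\<lambda>i. if i < n then x ! i else u i) (formula_rename \<phi> r)" for x
  proof (cases "length x = n")
    case True
    then have "map (\<lambda>i. if i < n then x ! i else 0) [0..<n] = x"
      by (auto intro: nth_equalityI)
    with True 1[of "\<lambda>i. if i < n then x ! i else 0"] show ?thesis
      unfolding sat_rename e by simp
  qed (use * in auto)
  then show "definable M n S" unfolding definable_def by blast
qed

lemma definable_length: "definable M n S \<Longrightarrow> x \<in> S \<Longrightarrow> length x = n"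
  unfolding definable_def by auto

lemma dfn_subst_list:
  assumes L: "dls M n L" and P: "dfn M (\<lambda>v. P (map v [0..<n]) (\<lambda>i. v (i + n)))"
  shows "dfn M (\<lambda>v. P (L v) v)"
proof -
  have "dfn M (\<lambda>v. \<exists>x. length x = n \<and> (\<forall>i<n. x ! i = L v ! i) \<and> P x v)"
  proof (rule dfn_ex_block, rule dfn_conj, rule dfn_all_lt)
    fix i assume "i < n"
    then show "dfn M (\<lambda>v. map v [0..<n] ! i = L (\<lambda>i. v (i + n)) ! i)"
      using L dfn_eq_dsc[of M "\<lambda>v. L v ! i" i "\<lambda>i. i + n"] unfolding dls_def by simp
  qed (rule P)
  moreover have "(\<exists>x. length x = n \<and> (\<forall>i<n. x ! i = L v ! i) \<and> P x v) \<longleftrightarrow> P (L v) v" for v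
    using dls_length[OF L, of v] by (metis nth_equalityI)
  ultimately show ?thesis by simp
qed

text \<open>Forgetting the length frees the introduction rules from arithmetic side conditions.
  Lists of a wrong length are harmless in \<open>dfn_mem\<close>, where membership is then
  constantly false.\<close>

definition dl :: "('a::linordered_field, 'f, 'r) expansion \<Rightarrow> ((nat \<Rightarrow> 'a) \<Rightarrow> 'a list) \<Rightarrow> bool" where
  "dl M L \<longleftrightarrow> (\<exists>n. dls M n L)"

lemma dl_block: "dl M (\<lambda>v. map (\<lambda>i. v (\<rho> i)) [0..<n])"
  unfolding dl_def using dls_block by blast

lemma dl_const: "dl M (\<lambda>v. c)"
  unfolding dl_def using dls_const by blast

lemma dl_Cons: "dsc M T \<Longrightarrow> dl M L \<Longrightarrow> dl M (\<lambda>v. T v # L v)"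
  unfolding dl_def using dls_Cons by blast

lemma dl_append: "dl M L \<Longrightarrow> dl M K \<Longrightarrow> dl M (\<lambda>v. L v @ K v)"
  unfolding dl_def using dls_append by blast

lemma dfn_mem:
  assumes S: "definable M n S" and "dl M L" shows "dfn M (\<lambda>v. L v \<in> S)"
proof -
  obtain k where k: "dls M k L" using assms(2) unfolding dl_def by blast
  show ?thesis
  proof (cases "k = n")
    case True
    from k show ?thesis
      by (rule dfn_subst_list) (use S True definable_iff_dfn in blast)
  next
    case False
    then have "L v \<notin> S" for v
      using definable_length[OF S, of "L v"] dls_length[OF k, of v] by auto
    then show ?thesis by (simp add: dfn_const)
  qed
qed

lemma dfn_bex_list:
  assumes "definable M n S" and "dfn M (\<lambda>v. P (map v [0..<n]) (\<lambda>i. v (i + n)))"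
  shows "dfn M (\<lambda>v. \<exists>x\<in>S. P x v)"
proof -
  have "dfn M (\<lambda>v. \<exists>x. length x = n \<and> x \<in> S \<and> P x v)"
    by (rule dfn_ex_block, rule dfn_conj) (use assms definable_iff_dfn in blast)+
  moreover have "(\<exists>x. length x = n \<and> x \<in> S \<and> P x v) \<longleftrightarrow> (\<exists>x\<in>S. P x v)" for v
    using definable_length[OF assms(1)] by auto
  ultimately show ?thesis by simp
qed

lemma dfn_ball_list:
  assumes "definable M n S" and "dfn M (\<lambda>v. P (map v [0..<n]) (\<lambda>i. v (i + n)))"
  shows "dfn M (\<lambda>v. \<forall>x\<in>S. P x v)"
  using dfn_not[OF dfn_bex_list[OF assms(1) dfn_not[OF assms(2)]]] by simp

lemma dfn_atLeastAtMost:
  "dsc M T \<Longrightarrow> dsc M A \<Longrightarrow> dsc M B \<Longrightarrow> dfn M (\<lambda>v. T v \<in> {A v..B v})"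
  unfolding atLeastAtMost_iff by (intro dfn_conj dfn_le)

lemma dfn_Ball:
  fixes S :: "(nat \<Rightarrow> 'a::linordered_field) \<Rightarrow> 'a set"
  shows "dfn M (\<lambda>v. \<forall>a. a \<in> S v \<longrightarrow> P a v) \<Longrightarrow> dfn M (\<lambda>v. \<forall>a\<in>S v. P a v)"
  unfolding Ball_def .

lemma dfn_Bex:
  fixes S :: "(nat \<Rightarrow> 'a::linordered_field) \<Rightarrow> 'a set"
  shows "dfn M (\<lambda>v. \<exists>a. a \<in> S v \<and> P a v) \<Longrightarrow> dfn M (\<lambda>v. \<exists>a\<in>S v. P a v)"
  unfolding Bex_def .

lemma definableI:
  assumes "\<And>x. x \<in> S \<Longrightarrow> length x = n" "dfn M (\<lambda>v. map v [0..<n] \<in> S)"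
  shows "definable M n S"
  using assms unfolding definable_iff_dfn by auto

definition dsf :: "('a::linordered_field, 'f, 'r) expansion \<Rightarrow> nat \<Rightarrow> ('a list \<Rightarrow> 'a) \<Rightarrow> bool" where
  "dsf M n g \<longleftrightarrow> dsc M (\<lambda>v. g (map v [0..<n]))"

lemma dsc_app:
  assumes "dsf M n g" "dl M L" "\<And>v. length (L v) = n" shows "dsc M (\<lambda>v. g (L v))"
proof -
  have "dls M n (\<lambda>v. L (\<lambda>i. v (Suc i)))"
    using assms(2,3) unfolding dls_def dl_def by (auto intro: dsc_rename)
  then have "dfn M (\<lambda>v. v 0 = g (L (\<lambda>i. v (Suc i))))"
    by (rule dfn_subst_list)
      (rule dfn_eq_dsc[OF assms(1)[unfolded dsf_def], where \<rho> = "\<lambda>i. i"])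
  then show ?thesis unfolding dsc_def .
qed

lemma dfn_app2:
  "dfn M (\<lambda>v. R (v 0) (v 1)) \<Longrightarrow> dsc M T \<Longrightarrow> dsc M U \<Longrightarrow> dfn M (\<lambda>v. R (T v) (U v))"
  by (rule dfn_subst2[where P = "\<lambda>a b v. R a b"])

lemma dfn_app1: "dfn M (\<lambda>v. R (v 0)) \<Longrightarrow> dsc M T \<Longrightarrow> dfn M (\<lambda>v. R (T v))"
  by (rule dfn_subst[where P = "\<lambda>a v. R a"])

lemma dsc_app1:
  assumes "dsc M (\<lambda>v. h (v 0))" "dsc M T" shows "dsc M (\<lambda>v. h (T v))"
proof -
  have "dfn M (\<lambda>v. v 0 = h (T (\<lambda>i. v (Suc i))))"
    by (rule dfn_subst[where P = "\<lambda>a v. v 0 = h a"])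
      (use dsc_rename[OF assms(2)] dfn_eq_dsc[OF assms(1), of 1 "\<lambda>i. i"] in auto)
  then show ?thesis unfolding dsc_def .
qed

text \<open>The open ball of the maximum norm, phrased without a maximum. On the empty list the
  radius is irrelevant, which is why distances are later taken in a power
  \<open>Suc n\<close>.\<close>

definition near :: "'a::linordered_field \<Rightarrow> 'a list \<Rightarrow> 'a list \<Rightarrow> bool" where
  "near \<epsilon> x y \<longleftrightarrow> list_all2 (\<lambda>a b. \<bar>a - b\<bar> < \<epsilon>) x y"

lemma dfn_near:
  assumes "dsc M T" "dl M L" "dl M K" shows "dfn M (\<lambda>v. near (T v) (L v) (K v))"
proof -
  obtain n k where nk: "dls M n L" "dls M k K" using assms(2,3) unfolding dl_def by blast
  show ?thesis
  proof (cases "n = k")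
    case True
    have "dfn M (\<lambda>v. \<forall>i<n. \<bar>L v ! i - K v ! i\<bar> < T v)"
      using assms(1) nk True unfolding dls_def by (intro dfn_all_lt dfn_less dsc_abs dsc_diff) auto
    then show ?thesis
      unfolding near_def list_all2_conv_all_nth using dls_length[OF nk(1)] dls_length[OF nk(2)] True
      by simp
  next
    case False
    then show ?thesis
      unfolding near_def list_all2_conv_all_nth using dls_length[OF nk(1)] dls_length[OF nk(2)]
      by (simp add: dfn_const)
  qed
qed

definition is_lub :: "'a::linorder set \<Rightarrow> 'a \<Rightarrow> bool" where
  "is_lub S s \<longleftrightarrow> (\<forall>x\<in>S. x \<le> s) \<and> (\<forall>u. (\<forall>x\<in>S. x \<le> u) \<longrightarrow> s \<le> u)"

text \<open>The field need not be Dedekind complete; existence of suprema is proved separately for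
  nonempty bounded definable sets.\<close>

definition lub :: "'a::linorder set \<Rightarrow> 'a" where
  "lub S = (THE s. is_lub S s)"

lemma is_lub_unique: "is_lub S s \<Longrightarrow> is_lub S t \<Longrightarrow> s = t"
  unfolding is_lub_def by (intro antisym) auto

lemma is_lub_lub: "is_lub S s \<Longrightarrow> is_lub S (lub S)"
  unfolding lub_def by (rule theI, assumption) (rule is_lub_unique)

text \<open>Being a least upper bound is a first-order property, so the supremum of a definable
  family depends definably on the parameters.\<close>

lemma dsc_lub:
  assumes ex: "\<And>v. \<exists>s. is_lub {a. P a v} s" and P: "dfn M (\<lambda>v. P (v 0) (\<lambda>i. v (Suc i)))"
  shows "dsc M (\<lambda>v. lub {a. P a v})"
proof -
  have eq: "s = lub {a. P a v} \<longleftrightarrow> is_lub {a. P a v} s" for s v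
    using is_lub_lub is_lub_unique ex by metis
  have "dfn M (\<lambda>v. P (v 0) (\<lambda>i. v (Suc (Suc i))))"
    using dfn_rename[OF P, of "\<lambda>i. if i = 0 then 0 else Suc i"] by simp
  moreover have "dfn M (\<lambda>v. P (v 0) (\<lambda>i. v (Suc (Suc (Suc i)))))"
    using dfn_rename[OF P, of "\<lambda>i. if i = 0 then 0 else Suc (Suc i)"] by simp
  ultimately show ?thesis
    unfolding dsc_def eq is_lub_def Ball_def mem_Collect_eq
    by (intro dfn_conj dfn_all dfn_imp dfn_le dsc_var)
qed

lemmas dfn_intros =
  dfn_const dfn_not dfn_conj dfn_disj dfn_imp dfn_iff dfn_ex dfn_all dfn_less dfn_le dfn_eq
  dfn_atLeastAtMost dfn_Ball dfn_Bex dfn_near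
  dsc_var dsc_const dsc_plus dsc_times dsc_minus dsc_diff dsc_divide dsc_max dsc_min dsc_abs
  dl_block dl_const dl_Cons dl_append

section \<open>Definable subsets of the line\<close>

definition tame :: "'a::linorder set \<Rightarrow> bool" where
  "tame S \<longleftrightarrow> (\<exists>\<J>. finite \<J> \<and> (\<forall>J\<in>\<J>. point_or_open_interval J) \<and> S = \<Union>\<J>)"

lemma tame_definable:
  assumes "o_minimal M" "dfn M (\<lambda>v. R (v 0))" shows "tame {x. R x}"
proof -
  have eq: "map v [0..<1] \<in> {[x] | x. R x} \<longleftrightarrow> R (v 0)" for v
    by (auto simp: upt_rec)
  have "dfn M (\<lambda>v. map v [0..<1] \<in> {[x] | x. R x})"
    unfolding eq by (rule assms(2))
  moreover have "{[x] | x. R x} \<subseteq> {x. length x = 1}" by auto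
  ultimately have "definable M 1 {[x] | x. R x}"
    unfolding definable_iff_dfn by (intro conjI)
  with assms(1) have "tame {x. [x] \<in> {[x] | x. R x}}"
    unfolding o_minimal_def tame_def by blast
  moreover have "{x. [x] \<in> {[x] | x. R x}} = {x. R x}" by auto
  ultimately show ?thesis by argo
qed

lemma point_or_open_interval_right:
  fixes a :: "'a::linordered_field"
  assumes "point_or_open_interval J"
  shows "\<exists>b>a. (\<forall>x. a < x \<and> x < b \<longrightarrow> x \<in> J) \<or> (\<forall>x. a < x \<and> x < b \<longrightarrow> x \<notin> J)"
proof -
  have one: "a < a + 1" by simp
  from assms consider c where "J = {c}" | c d where "J = {c<..<d}" | c where "J = {c<..}"
    | d where "J = {..<d}" | "J = UNIV"
    unfolding point_or_open_interval_def by blast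
  then show ?thesis
  proof cases
    case 1
    then show ?thesis by (intro exI[of _ "if a < c then c else a + 1"]) auto
  next
    case 2
    then show ?thesis
      by (intro exI[of _ "if a < c then c else if a < d then d else a + 1"]) auto
  next
    case 3
    then show ?thesis by (intro exI[of _ "if a < c then c else a + 1"]) auto
  next
    case 4
    then show ?thesis by (intro exI[of _ "if a < d then d else a + 1"]) auto
  next
    case 5
    with one show ?thesis by blast
  qed
qed

text \<open>Just to the right of \<open>a\<close> each of the finitely many pieces is full or empty;
  the shortest of the intervals serves them all. Much of the use of o-minimality below goes through
  this dichotomy.\<close>

lemma tame_right:
  fixes S :: "'a::linordered_field set"
  assumes "tame S"
  shows "\<exists>b>a. (\<forall>x. a < x \<and> x < b \<longrightarrow> x \<in> S) \<or> (\<forall>x. a < x \<and> x < b \<longrightarrow> x \<notin> S)"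
proof -
  obtain \<J> where J: "finite \<J>" "\<forall>J\<in>\<J>. point_or_open_interval J" "S = \<Union>\<J>"
    using assms unfolding tame_def by blast
  from J(1,2) have "\<exists>b>a. (\<forall>x. a < x \<and> x < b \<longrightarrow> x \<in> \<Union>\<J>) \<or> (\<forall>x. a < x \<and> x < b \<longrightarrow> x \<notin> \<Union>\<J>)"
  proof (induction \<J> rule: finite_induct)
    case empty
    have "a < a + 1" by simp
    then show ?case by blast
  next
    case (insert J \<J>)
    then obtain b where b: "b > a"
        "(\<forall>x. a < x \<and> x < b \<longrightarrow> x \<in> \<Union>\<J>) \<or> (\<forall>x. a < x \<and> x < b \<longrightarrow> x \<notin> \<Union>\<J>)"
      by auto
    obtain c where c: "c > a"
        "(\<forall>x. a < x \<and> x < c \<longrightarrow> x \<in> J) \<or> (\<forall>x. a < x \<and> x < c \<longrightarrow> x \<notin> J)"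
      using point_or_open_interval_right insert.prems by blast
    show ?case using b c by (intro exI[of _ "min b c"]) auto
  qed
  with J show ?thesis by simp
qed

text \<open>One of the finitely many pieces is infinite, hence not a point.\<close>

lemma tame_infinite:
  fixes S :: "'a::linordered_field set"
  assumes "tame S" "infinite S"
  obtains a b where "a < b" "{a<..<b} \<subseteq> S"
proof -
  obtain \<J> where J: "finite \<J>" "\<forall>J\<in>\<J>. point_or_open_interval J" "S = \<Union>\<J>"
    using assms unfolding tame_def by blast
  then obtain J where "J \<in> \<J>" "infinite J" using assms(2) by auto
  then have "\<exists>a b. a < b \<and> {a<..<b} \<subseteq> J"
  proof -
    from J(2) \<open>J \<in> \<J>\<close> have "point_or_open_interval J" ..
    then consider c where "J = {c}" | c d where "J = {c<..<d}" | c where "J = {c<..}"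
      | d where "J = {..<d}" | "J = UNIV"
      unfolding point_or_open_interval_def by blast
    then show ?thesis
    proof cases
      case 2
      then have "c < d" using \<open>infinite J\<close> by (cases "c < d") auto
      with 2 show ?thesis by blast
    next
      case (3 c)
      then show ?thesis by (intro exI[of _ c] exI[of _ "c + 1"]) auto
    next
      case (4 d)
      then show ?thesis by (intro exI[of _ "d - 1"] exI[of _ d]) auto
    next
      case 5
      then show ?thesis by (intro exI[of _ 0] exI[of _ 1]) auto
    qed (use \<open>infinite J\<close> in auto)
  qed
  with \<open>J \<in> \<J>\<close> J(3) that show thesis by blast
qed

section \<open>Definable completeness and its consequences for intervals\<close>

lemma is_lub_Ioo: "c < (d::'a::linordered_field) \<Longrightarrow> is_lub {c<..<d} d"
  unfolding is_lub_def
proof (intro conjI allI impI)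
  fix u assume "c < d" and u: "\<forall>x\<in>{c<..<d}. x \<le> u"
  show "d \<le> u"
  proof (rule ccontr)
    assume "\<not> d \<le> u"
    with \<open>c < d\<close> obtain x where "max c u < x" "x < d" using dense[of "max c u" d] by auto
    then have "x \<in> {c<..<d}" by auto
    with u have "x \<le> u" by blast
    with \<open>max c u < x\<close> show False by simp
  qed
qed auto

lemma point_or_open_interval_lub:
  fixes J :: "'a::linordered_field set"
  assumes "point_or_open_interval J" "x0 \<in> J" and bd: "\<forall>x\<in>J. x \<le> C"
  shows "\<exists>s. is_lub J s"
proof -
  have up: "is_lub J s" if "c < s" "{c<..<s} \<subseteq> J" "\<forall>x\<in>J. x \<le> s" for c s
    using is_lub_Ioo[OF that(1)] that(2,3) unfolding is_lub_def by blast
  from assms(1) consider c where "J = {c}" | c d where "J = {c<..<d}" | c where "J = {c<..}"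
    | d where "J = {..<d}" | "J = UNIV"
    unfolding point_or_open_interval_def by blast
  then show ?thesis
  proof cases
    case (1 c)
    then show ?thesis by (auto simp: is_lub_def)
  next
    case 2
    with assms(2) show ?thesis by (intro exI[of _ d] up[of c]) auto
  next
    case (3 c)
    have "max c C + 1 \<in> J" unfolding 3 by (simp add: max_def)
    with bd have "max c C + 1 \<le> C" by blast
    then have False by (simp add: max_def split: if_splits)
    then show ?thesis ..
  next
    case (4 d)
    then show ?thesis by (intro exI[of _ d] up[of "d - 1"]) auto
  next
    case 5
    then have "C + 1 \<le> C" using bd by blast
    then have False by simp
    then show ?thesis ..
  qed
qed

lemma lub_upper: "is_lub S s \<Longrightarrow> x \<in> S \<Longrightarrow> x \<le> s"
  unfolding is_lub_def by blast

lemma lub_least: "is_lub S s \<Longrightarrow> (\<And>x. x \<in> S \<Longrightarrow> x \<le> u) \<Longrightarrow> s \<le> u"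
  unfolding is_lub_def by blast

text \<open>Substitute for Dedekind completeness: the supremum of a finite union is the largest of
  the suprema of its nonempty pieces.\<close>

lemma tame_lub:
  fixes S :: "'a::linordered_field set"
  assumes "tame S" "x0 \<in> S" "\<forall>x\<in>S. x \<le> C"
  shows "is_lub S (lub S)"
proof -
  obtain \<J> where J: "finite \<J>" "\<forall>J\<in>\<J>. point_or_open_interval J" "S = \<Union>\<J>"
    using assms unfolding tame_def by blast
  have "\<exists>s. is_lub (\<Union>\<J>) s" if "\<Union>\<J> \<noteq> {}" "\<forall>x\<in>\<Union>\<J>. x \<le> C"
    using J(1,2) that
  proof (induction \<J> rule: finite_induct)
    case (insert J \<J>)
    show ?case
    proof (cases "J = {} \<or> \<Union>\<J> = {}")
      case True
      then show ?thesis
      proof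
        assume "J = {}"
        with insert show ?thesis by auto
      next
        assume "\<Union>\<J> = {}"
        then have eq: "\<Union> (insert J \<J>) = J" by auto
        with insert.prems obtain x where "x \<in> J" by auto
        with insert.prems show ?thesis
          unfolding eq by (intro point_or_open_interval_lub[of J x C]) auto
      qed
    next
      case False
      then obtain s where s: "is_lub (\<Union>\<J>) s" using insert by auto
      from False obtain x where "x \<in> J" by auto
      with insert.prems have "\<exists>t. is_lub J t"
        by (intro point_or_open_interval_lub[of J x C]) auto
      then obtain t where t: "is_lub J t" ..
      have "is_lub (\<Union> (insert J \<J>)) (max s t)"
        unfolding is_lub_def
      proof (intro conjI allI impI ballI)
        show "x \<le> max s t" if "x \<in> \<Union> (insert J \<J>)" for x
          using that lub_upper[OF s, of x] lub_upper[OF t, of x] by (auto simp: le_max_iff_disj)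
        show "max s t \<le> u" if "\<forall>x\<in>\<Union> (insert J \<J>). x \<le> u" for u
          using that lub_least[OF s, of u] lub_least[OF t, of u] by auto
      qed
      then show ?thesis by blast
    qed
  qed auto
  with assms J have "\<exists>s. is_lub S s" by auto
  then show ?thesis using is_lub_lub by blast
qed

lemma lub_approx: "is_lub S s \<Longrightarrow> u < s \<Longrightarrow> \<exists>x\<in>S. u < x"
  unfolding is_lub_def by (meson not_le)

lemma definable_lub:
  fixes M :: "('a::linordered_field, 'f, 'r) expansion"
  assumes "o_minimal M" "dfn M (\<lambda>v. R (v 0))" "R x0" "\<And>x. R x \<Longrightarrow> x \<le> C"
  shows "is_lub {x. R x} (lub {x. R x})"
  by (rule tame_lub[OF tame_definable[OF assms(1,2)], of x0 C]) (use assms in auto)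

text \<open>Heine-Borel for a definable predicate. Let \<open>s\<close> be the supremum of the
  \<open>t\<close> such that one radius works on [a, t]; the local radius at \<open>s\<close>
  carries the property beyond \<open>s\<close> unless \<open>s\<close> is \<open>b\<close>.\<close>

lemma definable_compact:
  fixes M :: "('a::linordered_field, 'f, 'r) expansion"
  assumes om: "o_minimal M" and P: "dfn M (\<lambda>v. P (v 0) (v 1))"
    and anti: "\<And>\<delta> \<delta>' u. 0 < \<delta>' \<Longrightarrow> \<delta>' \<le> \<delta> \<Longrightarrow> P \<delta> u \<Longrightarrow> P \<delta>' u"
    and loc: "\<And>t. t \<in> {a..b} \<Longrightarrow> \<exists>\<delta>>0. \<forall>u\<in>{a..b}. \<bar>u - t\<bar> < \<delta> \<longrightarrow> P \<delta> u"
  shows "\<exists>\<delta>>0. \<forall>u\<in>{a..b}. P \<delta> u"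
proof (cases "a \<le> b")
  case False
  then show ?thesis by (intro exI[of _ 1]) auto
next
  case True
  define R where "R = (\<lambda>t. t \<in> {a..b} \<and> (\<exists>\<delta>. 0 < \<delta> \<and> (\<forall>u\<in>{a..t}. P \<delta> u)))"
  have "dfn M (\<lambda>v. R (v 0))"
    unfolding R_def by (intro dfn_intros dfn_app2[OF P])
  moreover have Ra: "R a"
    using loc[of a] True unfolding R_def by (auto 0 3)
  ultimately have "is_lub {t. R t} (lub {t. R t})"
    by (rule definable_lub[OF om, of R a b]) (auto simp: R_def)
  then obtain s where s: "is_lub {t. R t} s" ..
  have sab: "s \<in> {a..b}"
    using lub_upper[OF s, of a] lub_least[OF s, of b] Ra by (auto simp: R_def)
  from loc[OF this] obtain \<delta> where d: "\<delta> > 0" "\<forall>u\<in>{a..b}. \<bar>u - s\<bar> < \<delta> \<longrightarrow> P \<delta> u" by blast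
  obtain t where t: "R t" "s - \<delta> < t" using lub_approx[OF s, of "s - \<delta>"] d(1) by auto
  then obtain \<delta>' where d': "\<delta>' > 0" "\<forall>u\<in>{a..t}. P \<delta>' u" unfolding R_def by blast
  \<comment> \<open>Half the local radius keeps [s, c] inside the neighbourhood of \<open>s\<close>;
    points up to \<open>t\<close> are served by \<open>\<delta>'\<close>, those between
    \<open>t\<close> and \<open>c\<close> by \<open>\<delta>\<close>.\<close>
  define c where "c = min b (s + \<delta> / 2)"
  have sc: "s \<le> c" "c \<le> b" using sab d(1) by (auto simp: c_def)
  have "P (min \<delta> \<delta>') u" if "u \<in> {a..c}" for u
  proof (cases "u \<le> t")
    case True
    then show ?thesis using anti[of "min \<delta> \<delta>'" \<delta>' u] d d' that by auto
  next
    case False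
    then have "\<bar>u - s\<bar> < \<delta>" using t that d(1) by (auto simp: c_def abs_less_iff field_simps)
    then show ?thesis using anti[of "min \<delta> \<delta>'" \<delta> u] d d' that sc by auto
  qed
  then have all: "\<exists>\<delta>>0. \<forall>u\<in>{a..c}. P \<delta> u" using d(1) d'(1) by (intro exI[of _ "min \<delta> \<delta>'"]) auto
  then have "R c" unfolding R_def using sab sc by auto
  then have "c \<le> s" using lub_upper[OF s, of c] by simp
  then have "c = b" using d(1) by (auto simp: c_def min_def split: if_splits)
  with all show ?thesis by simp
qed

text \<open>Definable connectedness: a locally constant definable predicate is constant on an
  interval, as seen at the supremum of the initial segments on which it keeps its value at
  \<open>a\<close>.\<close>

lemma definable_switch:
  fixes M :: "('a::linordered_field, 'f, 'r) expansion"
  assumes om: "o_minimal M" and R: "dfn M (\<lambda>v. R (v 0))" and ab: "a \<le> b" "R a \<noteq> R b"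
  shows "\<exists>d\<in>{a..b}. \<forall>\<delta>>0. \<exists>u\<in>{a..b}. \<bar>u - d\<bar> < \<delta> \<and> R u \<noteq> R d"
proof (rule ccontr)
  assume *: "\<not> ?thesis"
  have "\<exists>\<delta>>0. \<forall>u\<in>{a..b}. \<bar>u - d\<bar> < \<delta> \<longrightarrow> R u = R d" if "d \<in> {a..b}" for d
    using * that by blast
  note loc = this
  define Q where "Q = (\<lambda>t. t \<in> {a..b} \<and> (\<forall>u\<in>{a..t}. R u = R a))"
  have "dfn M (\<lambda>v. Q (v 0))"
    unfolding Q_def by (intro dfn_intros dfn_app1[OF R])
  moreover have Qa: "Q a" using ab unfolding Q_def by auto
  ultimately have "is_lub {t. Q t} (lub {t. Q t})"
    by (rule definable_lub[OF om, of Q a b]) (auto simp: Q_def)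
  then obtain s where s: "is_lub {t. Q t} s" ..
  have sab: "s \<in> {a..b}"
    using lub_upper[OF s, of a] lub_least[OF s, of b] Qa by (auto simp: Q_def)
  from loc[OF this] obtain \<delta> where d: "\<delta> > 0" "\<forall>u\<in>{a..b}. \<bar>u - s\<bar> < \<delta> \<longrightarrow> R u = R s" by blast
  obtain t where t: "Q t" "s - \<delta> < t" using lub_approx[OF s, of "s - \<delta>"] d(1) by auto
  have tQ: "t \<in> {a..b}" "\<And>u. u \<in> {a..t} \<Longrightarrow> R u = R a"
    using t(1) unfolding Q_def by blast+
  have "t \<le> s" using lub_upper[OF s] t by auto
  then have "\<bar>t - s\<bar> < \<delta>" using t(2) d(1) by (simp add: abs_less_iff)
  then have "R t = R s" using d(2) tQ(1) by blast
  then have Rs: "R s = R a" using tQ(2)[of t] tQ(1) by simp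
  define c where "c = min b (s + \<delta> / 2)"
  have sc: "s \<le> c" "c \<le> b" using sab d(1) by (auto simp: c_def)
  have all: "R u = R a" if "u \<in> {a..c}" for u
  proof (cases "u \<le> t")
    case True
    then show ?thesis using tQ(2)[of u] that by simp
  next
    case False
    then have "\<bar>u - s\<bar> < \<delta>" using t that d(1) by (auto simp: c_def abs_less_iff field_simps)
    moreover have "u \<in> {a..b}" using that sc by auto
    ultimately have "R u = R s" using d(2) by blast
    with Rs show ?thesis by simp
  qed
  have "c \<in> {a..b}" using sab sc by auto
  then have "Q c" unfolding Q_def using all by blast
  then have "c \<le> s" using lub_upper[OF s, of c] by simp
  then have "c = b" using d(1) by (auto simp: c_def min_def split: if_splits)
  with all[of b] ab show False by auto
qed

text \<open>A bounded definable function has a right limit at \<open>a\<close>, namely the supremum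
  \<open>s\<close> of the values that it eventually exceeds. The Cauchy form of the conclusion
  avoids naming the limit.\<close>

lemma right_limit_oscillation:
  fixes M :: "('a::linordered_field, 'f, 'r) expansion"
  assumes om: "o_minimal M" and h: "dsc M (\<lambda>v. h (v 0))" and bd: "\<And>x. \<bar>h x\<bar> \<le> C"
    and e: "0 < \<epsilon>"
  shows "\<exists>b>a. \<forall>x y. a < x \<and> x < b \<and> a < y \<and> y < b \<longrightarrow> \<bar>h x - h y\<bar> < \<epsilon>"
proof -
  define R where "R = (\<lambda>r. \<exists>b. a < b \<and> (\<forall>x. a < x \<and> x < b \<longrightarrow> r < h x))"
  have bd': "- C \<le> h x" "h x \<le> C" for x using bd[of x] by (auto simp: abs_le_iff)
  have "dfn M (\<lambda>v. R (v 0))"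
    unfolding R_def by (intro dfn_intros dsc_app1[OF h])
  moreover have "R (- C - 1)"
  proof -
    have "- C - 1 < h x" for x using bd'(1)[of x] by simp
    then show ?thesis unfolding R_def by (intro exI[of _ "a + 1"]) auto
  qed
  ultimately have "is_lub {t. R t} (lub {t. R t})"
  proof (rule definable_lub[OF om, of R _ C])
    fix r assume "R r"
    then obtain b where b: "a < b" "\<forall>x. a < x \<and> x < b \<longrightarrow> r < h x" unfolding R_def by blast
    from dense[OF b(1)] b obtain x where "r < h x" by blast
    with bd'(2)[of x] show "r \<le> C" by simp
  qed
  then obtain s where s: "is_lub {t. R t} s" ..
  obtain r where "R r" "s - \<epsilon> / 2 < r" using lub_approx[OF s, of "s - \<epsilon> / 2"] e by auto
  then obtain b where b: "a < b" "\<forall>x. a < x \<and> x < b \<longrightarrow> s - \<epsilon> / 2 < h x"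
    unfolding R_def by fastforce
  have nR: "\<not> R (s + \<epsilon> / 4)" using lub_upper[OF s, of "s + \<epsilon> / 4"] e by auto
  have "dfn M (\<lambda>v. s + \<epsilon> / 4 < h (v 0))"
    by (intro dfn_intros dsc_app1[OF h])
  \<comment> \<open>By the choice of \<open>s\<close> the function does not eventually exceed
    \<open>s + \<epsilon> / 4\<close>; the dichotomy turns this into an eventual upper
    bound.\<close>
  from tame_right[OF tame_definable[OF om this], of a] obtain c where c: "a < c"
    "(\<forall>x. a < x \<and> x < c \<longrightarrow> s + \<epsilon> / 4 < h x) \<or> (\<forall>x. a < x \<and> x < c \<longrightarrow> \<not> s + \<epsilon> / 4 < h x)"
    by auto
  have "\<not> (\<forall>x. a < x \<and> x < c \<longrightarrow> s + \<epsilon> / 4 < h x)"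
    using nR c(1) unfolding R_def by blast
  with c(2) have c': "\<forall>x. a < x \<and> x < c \<longrightarrow> h x \<le> s + \<epsilon> / 4"
    by (simp add: not_less)
  show ?thesis
  proof (intro exI[of _ "min b c"] conjI allI impI)
    show "a < min b c" using b c by auto
    fix x y assume xy: "a < x \<and> x < min b c \<and> a < y \<and> y < min b c"
    then have "s - \<epsilon> / 2 < h x" "h x \<le> s + \<epsilon> / 4" "s - \<epsilon> / 2 < h y" "h y \<le> s + \<epsilon> / 4"
      using b c' by auto
    moreover have "\<epsilon> / 4 < \<epsilon> / 2" using e by simp
    ultimately show "\<bar>h x - h y\<bar> < \<epsilon>" by (simp add: abs_less_iff field_simps)
  qed
qed

definition cont_at :: "('a::linordered_field \<Rightarrow> 'a) \<Rightarrow> 'a \<Rightarrow> bool" where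
  "cont_at h x \<longleftrightarrow> (\<forall>\<epsilon>. 0 < \<epsilon> \<longrightarrow> (\<exists>\<delta>. 0 < \<delta> \<and> (\<forall>x'. \<bar>x' - x\<bar> < \<delta> \<longrightarrow> \<bar>h x' - h x\<bar> < \<epsilon>)))"

text \<open>The sets of points with jump at least \<open>\<epsilon>\<close> are finite and exhaust the discontinuities as
  \<open>\<epsilon>\<close> tends to \<open>0\<close>. If they exhausted an interval, then by o-minimality every point near its left
  end would be the least point of one of them, so that the jumps would increase from left to
  right; but then one of these sets would be infinite.\<close>

lemma finite_discontinuities:
  fixes M :: "('a::linordered_field, 'f, 'r) expansion"
  assumes om: "o_minimal M" and h: "dsc M (\<lambda>v. h (v 0))" and bd: "\<And>x. \<bar>h x\<bar> \<le> C"
  shows "finite {x. \<not> cont_at h x}"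
proof (rule ccontr)
  assume inf: "infinite {x. \<not> cont_at h x}"
  have "dfn M (\<lambda>v. \<not> cont_at h (v 0))"
    unfolding cont_at_def by (intro dfn_intros dsc_app1[OF h])
  from tame_infinite[OF tame_definable[OF om this] inf] obtain a b where
    ab: "a < b" "{a<..<b} \<subseteq> {x. \<not> cont_at h x}" by blast
  define J where "J = (\<lambda>\<epsilon> x. \<forall>\<delta>. 0 < \<delta> \<longrightarrow> (\<exists>x'. \<bar>x' - x\<bar> < \<delta> \<and> \<epsilon> \<le> \<bar>h x' - h x\<bar>))"
  have dJ: "dfn M (\<lambda>v. J (v 0) (v 1))"
    unfolding J_def by (intro dfn_intros dsc_app1[OF h])
  have exJ: "\<exists>\<epsilon>>0. J \<epsilon> x" if "a < x" "x < b" for x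
    using ab(2) that unfolding cont_at_def J_def by (force simp: not_less subset_iff)
  \<comment> \<open>A whole interval of points with jump at least \<open>\<epsilon>\<close>
    contradicts the small oscillation just to the right of its left end.\<close>
  have finJ: "finite {x. J \<epsilon> x}" if "0 < \<epsilon>" for \<epsilon>
  proof (rule ccontr)
    assume inf: "infinite {x. J \<epsilon> x}"
    have "dfn M (\<lambda>v. J \<epsilon> (v 0))" by (intro dfn_intros dfn_app2[OF dJ])
    from tame_infinite[OF tame_definable[OF om this] inf] obtain c d where
      cd: "c < d" "{c<..<d} \<subseteq> {x. J \<epsilon> x}" by blast
    obtain e where e: "c < e" "\<forall>x y. c < x \<and> x < e \<and> c < y \<and> y < e \<longrightarrow> \<bar>h x - h y\<bar> < \<epsilon>"
      using right_limit_oscillation[OF om h bd \<open>0 < \<epsilon>\<close>, of c] by blast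
    obtain x where x: "c < x" "x < min d e" using dense[of c "min d e"] cd e by auto
    then have "J \<epsilon> x" using cd by auto
    moreover have "0 < min (x - c) (e - x)" using x by auto
    ultimately obtain x' where x': "\<bar>x' - x\<bar> < min (x - c) (e - x)" "\<epsilon> \<le> \<bar>h x' - h x\<bar>"
      unfolding J_def by blast
    then have "c < x'" "x' < e" by (auto simp: abs_less_iff)
    with e x x'(2) show False by fastforce
  qed
  have antiJ: "J \<epsilon> x" if "J \<epsilon>' x" "\<epsilon> \<le> \<epsilon>'" for \<epsilon> \<epsilon>' x
    using that unfolding J_def by (meson order_trans)
  define P where "P = (\<lambda>x. a < x \<and> x < b \<and> (\<exists>\<epsilon>. 0 < \<epsilon> \<and> J \<epsilon> x \<and> (\<forall>x'. a < x' \<and> x' < x \<longrightarrow> \<not> J \<epsilon> x')))"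
  have "dfn M (\<lambda>v. P (v 0))"
    unfolding P_def by (intro dfn_intros dfn_app2[OF dJ])
  from tame_right[OF tame_definable[OF om this], of a] obtain c where c: "a < c"
    "(\<forall>x. a < x \<and> x < c \<longrightarrow> P x) \<or> (\<forall>x. a < x \<and> x < c \<longrightarrow> \<not> P x)" by auto
  \<comment> \<open>By the dichotomy one such point before \<open>c\<close> suffices: the least
    element of the finite set \<open>A\<close> of points in (a, b) with jump at least
    \<open>\<epsilon>\<close>.\<close>
  have Pc: "P x" if "a < x" "x < c" for x
  proof -
    obtain y where y: "a < y" "y < min b c" using dense[of a "min b c"] ab c by auto
    then obtain \<epsilon> where e: "\<epsilon> > 0" "J \<epsilon> y" using exJ by auto
    define A where "A = {z. a < z \<and> z < b \<and> J \<epsilon> z}"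
    have A: "finite A" "y \<in> A"
      using finJ[OF e(1)] e y by (auto simp: A_def intro: finite_subset[rotated])
    then have m: "Min A \<in> A" "Min A \<le> y" by (auto intro: Min_in)
    have "\<not> J \<epsilon> x'" if "a < x'" "x' < Min A" for x'
    proof
      assume "J \<epsilon> x'"
      then have "x' \<in> A" using that m(1) by (auto simp: A_def)
      from Min_le[OF A(1) this] that show False by simp
    qed
    moreover have mA: "a < Min A" "Min A < b" "J \<epsilon> (Min A)" using m(1) unfolding A_def by blast+
    ultimately have "P (Min A)" using e(1) unfolding P_def by blast
    moreover have "Min A < c" using m y by simp
    ultimately show ?thesis using c that mA(1) by blast
  qed
  obtain x where x: "a < x" "x < min b c" using dense[of a "min b c"] ab c by auto
  then obtain \<epsilon> where e: "\<epsilon> > 0" "J \<epsilon> x" using exJ by auto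
  \<comment> \<open>Since \<open>z\<close> comes first for some \<open>\<epsilon>'\<close>, the
    earlier point \<open>x\<close> does not have jump \<open>\<epsilon>'\<close>. Hence
    \<open>\<epsilon>'\<close> exceeds \<open>\<epsilon>\<close>, and \<open>z\<close> has jump at
    least \<open>\<epsilon>\<close> as well.\<close>
  have "{x<..<min b c} \<subseteq> {z. J \<epsilon> z}"
  proof
    fix z assume z: "z \<in> {x<..<min b c}"
    then obtain \<epsilon>' where "J \<epsilon>' z" "\<not> J \<epsilon>' x" using Pc[of z] x unfolding P_def by auto
    moreover from this have "\<epsilon> \<le> \<epsilon>'" using antiJ[OF e(2), of \<epsilon>'] by (cases "\<epsilon>' \<le> \<epsilon>") auto
    ultimately show "z \<in> {z. J \<epsilon> z}" using antiJ by blast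
  qed
  with finJ[OF e(1)] have "finite {x<..<min b c}" by (rule finite_subset[rotated])
  with x show False using infinite_Ioo by blast
qed

section \<open>Uniform finiteness\<close>

text \<open>Near \<open>(x, t)\<close> the relation is empty or the graph of a function that is continuous at \<open>x\<close>.\<close>

definition normal :: "('a::linordered_field \<Rightarrow> 'a \<Rightarrow> bool) \<Rightarrow> 'a \<Rightarrow> 'a \<Rightarrow> bool" where
  "normal R x t \<longleftrightarrow>
    (\<exists>\<delta>. 0 < \<delta> \<and> (\<forall>x'. \<bar>x' - x\<bar> < \<delta> \<longrightarrow>
       (\<forall>t1 t2. \<bar>t1 - t\<bar> < \<delta> \<and> \<bar>t2 - t\<bar> < \<delta> \<and> R x' t1 \<and> R x' t2 \<longrightarrow> t1 = t2) \<and>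
       (R x t \<or> (\<forall>t'. \<bar>t' - t\<bar> < \<delta> \<longrightarrow> \<not> R x' t')))) \<and>
    (R x t \<longrightarrow> (\<forall>\<epsilon>. 0 < \<epsilon> \<longrightarrow>
       (\<exists>\<delta>. 0 < \<delta> \<and> (\<forall>x'. \<bar>x' - x\<bar> < \<delta> \<longrightarrow> (\<exists>t'. \<bar>t' - t\<bar> < \<epsilon> \<and> R x' t')))))"

lemma normal_unique:
  assumes "normal R x t"
  obtains \<delta> where "0 < \<delta>"
    "\<And>x' t1 t2. \<bar>x' - x\<bar> < \<delta> \<Longrightarrow> \<bar>t1 - t\<bar> < \<delta> \<Longrightarrow> \<bar>t2 - t\<bar> < \<delta> \<Longrightarrow> R x' t1 \<Longrightarrow> R x' t2 \<Longrightarrow> t1 = t2"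
    "\<And>x' t'. \<not> R x t \<Longrightarrow> \<bar>x' - x\<bar> < \<delta> \<Longrightarrow> \<bar>t' - t\<bar> < \<delta> \<Longrightarrow> \<not> R x' t'"
proof -
  from assms[unfolded normal_def, THEN conjunct1] obtain \<delta> where d: "0 < \<delta>"
    "\<forall>x'. \<bar>x' - x\<bar> < \<delta> \<longrightarrow>
       (\<forall>t1 t2. \<bar>t1 - t\<bar> < \<delta> \<and> \<bar>t2 - t\<bar> < \<delta> \<and> R x' t1 \<and> R x' t2 \<longrightarrow> t1 = t2) \<and>
       (R x t \<or> (\<forall>t'. \<bar>t' - t\<bar> < \<delta> \<longrightarrow> \<not> R x' t'))"
    by (elim exE conjE)
  show thesis
  proof (rule that[OF d(1)])
    fix x' t1 t2
    assume "\<bar>x' - x\<bar> < \<delta>" "\<bar>t1 - t\<bar> < \<delta>" "\<bar>t2 - t\<bar> < \<delta>" "R x' t1" "R x' t2"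
    with d(2)[rule_format, THEN conjunct1, of x'] show "t1 = t2" by blast
  next
    fix x' t' assume "\<not> R x t" "\<bar>x' - x\<bar> < \<delta>" "\<bar>t' - t\<bar> < \<delta>"
    with d(2)[rule_format, THEN conjunct2, of x'] show "\<not> R x' t'" by blast
  qed
qed

lemma normal_persistent:
  assumes "normal R x t" "R x t" "0 < \<epsilon>"
  shows "\<exists>\<delta>>0. \<forall>x'. \<bar>x' - x\<bar> < \<delta> \<longrightarrow> (\<exists>t'. \<bar>t' - t\<bar> < \<epsilon> \<and> R x' t')"
  using assms(1)[unfolded normal_def, THEN conjunct2] assms(2,3) by blast

lemma normalI:
  assumes "0 < \<delta>"
    "\<And>x' t1 t2. \<bar>x' - x\<bar> < \<delta> \<Longrightarrow> \<bar>t1 - t\<bar> < \<delta> \<Longrightarrow> \<bar>t2 - t\<bar> < \<delta> \<Longrightarrow> R x' t1 \<Longrightarrow> R x' t2 \<Longrightarrow> t1 = t2"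
    "\<And>x' t'. \<not> R x t \<Longrightarrow> \<bar>x' - x\<bar> < \<delta> \<Longrightarrow> \<bar>t' - t\<bar> < \<delta> \<Longrightarrow> \<not> R x' t'"
    "\<And>\<epsilon>. R x t \<Longrightarrow> 0 < \<epsilon> \<Longrightarrow> \<exists>\<delta>>0. \<forall>x'. \<bar>x' - x\<bar> < \<delta> \<longrightarrow> (\<exists>t'. \<bar>t' - t\<bar> < \<epsilon> \<and> R x' t')"
  shows "normal R x t"
proof -
  have "R x t \<or> (\<forall>t'. \<bar>t' - t\<bar> < \<delta> \<longrightarrow> \<not> R x' t')" if "\<bar>x' - x\<bar> < \<delta>" for x'
    using assms(3) that by blast
  moreover have "\<forall>t1 t2. \<bar>t1 - t\<bar> < \<delta> \<and> \<bar>t2 - t\<bar> < \<delta> \<and> R x' t1 \<and> R x' t2 \<longrightarrow> t1 = t2"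
    if "\<bar>x' - x\<bar> < \<delta>" for x'
    using assms(2) that by blast
  ultimately show ?thesis
    unfolding normal_def using assms(1,4) by (intro conjI exI[of _ \<delta>]) blast+
qed

lemma finite_uniform_bound:
  fixes Q :: "'b \<Rightarrow> 'a::linordered_field \<Rightarrow> bool"
  assumes "finite A" "\<And>t. t \<in> A \<Longrightarrow> \<exists>\<delta>>0. Q t \<delta>"
    and anti: "\<And>t \<delta> \<delta>'. 0 < \<delta>' \<Longrightarrow> \<delta>' \<le> \<delta> \<Longrightarrow> Q t \<delta> \<Longrightarrow> Q t \<delta>'"
  shows "\<exists>\<delta>>0. \<forall>t\<in>A. Q t \<delta>"
  using assms(1,2)
proof (induction A rule: finite_induct)
  case empty
  show ?case by (intro exI[of _ 1]) auto
next
  case (insert t A)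
  then obtain \<delta> \<delta>' where d: "\<delta> > 0" "\<forall>t\<in>A. Q t \<delta>" "\<delta>' > 0" "Q t \<delta>'" by (meson insertCI)
  then show ?case using anti[of "min \<delta> \<delta>'" \<delta>] anti[of "min \<delta> \<delta>'" \<delta>']
    by (intro exI[of _ "min \<delta> \<delta>'"]) auto
qed

text \<open>Three radii match the fibre over \<open>x\<close> with the finite fibre \<open>D\<close>
  over \<open>x0\<close>: each point of \<open>D\<close> continues, its continuation is unique
  nearby, and by definable compactness of the vertical segment no further point appears
  elsewhere.\<close>

lemma card_locally_constant:
  fixes M :: "('a::linordered_field, 'f, 'r) expansion"
  assumes om: "o_minimal M" and R: "dfn M (\<lambda>v. R (v 0) (v 1))"
    and bd: "\<And>x t. R x t \<Longrightarrow> t \<in> {-1..1}" and fin: "finite {t. R x0 t}"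
    and good: "\<And>t. t \<in> {-1..1} \<Longrightarrow> normal R x0 t"
  shows "\<exists>\<delta>>0. \<forall>x. \<bar>x - x0\<bar> < \<delta> \<longrightarrow> card {t. R x t} = card {t. R x0 t}"
proof -
  define D where "D = {t. R x0 t}"
  have D: "finite D" "\<And>t. t \<in> D \<Longrightarrow> R x0 t" "\<And>t. t \<in> D \<Longrightarrow> t \<in> {-1..1}"
    using fin bd unfolding D_def by auto
  \<comment> \<open>The factor 2 serves injectivity: two points of \<open>D\<close> with a common
    continuation within \<open>\<delta>0\<close> are less than \<open>2 * \<delta>0\<close>
    apart.\<close>
  define Q where "Q = (\<lambda>t \<delta>. \<forall>x t1 t2. \<bar>x - x0\<bar> < 2 * \<delta> \<and> \<bar>t1 - t\<bar> < 2 * \<delta> \<and> \<bar>t2 - t\<bar> < 2 * \<delta>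
      \<and> R x t1 \<and> R x t2 \<longrightarrow> t1 = t2)"
  have "\<exists>\<delta>>0. \<forall>t\<in>D. Q t \<delta>"
  proof (rule finite_uniform_bound[OF D(1)])
    fix t assume "t \<in> D"
    then have "normal R x0 t" using good D by blast
    then obtain \<delta> where d: "0 < \<delta>"
      "\<And>x' t1 t2. \<bar>x' - x0\<bar> < \<delta> \<Longrightarrow> \<bar>t1 - t\<bar> < \<delta> \<Longrightarrow> \<bar>t2 - t\<bar> < \<delta> \<Longrightarrow> R x' t1 \<Longrightarrow> R x' t2 \<Longrightarrow> t1 = t2"
      by (rule normal_unique) blast
    have "2 * (\<delta> / 2) = \<delta>" by simp
    with d(2) have "Q t (\<delta> / 2)" unfolding Q_def by metis
    with d(1) show "\<exists>\<delta>>0. Q t \<delta>" by (intro exI[of _ "\<delta> / 2"]) simp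
  next
    fix t \<delta> \<delta>' :: 'a assume "\<delta>' \<le> \<delta>" "Q t \<delta>"
    then show "Q t \<delta>'" unfolding Q_def
      by (meson mult_left_mono order_less_le_trans zero_le_numeral)
  qed
  then obtain \<delta>0 where d0: "\<delta>0 > 0" "\<And>t. t \<in> D \<Longrightarrow> Q t \<delta>0" by blast
  have sep: "t = t'" if "t \<in> D" "t' \<in> D" "\<bar>t - t'\<bar> < 2 * \<delta>0" for t t'
    using d0(2)[OF that(2)] that d0(1) D(2)[OF that(1)] D(2)[OF that(2)]
    unfolding Q_def by (metis abs_zero diff_self mult_pos_pos zero_less_numeral)
  have "\<exists>\<delta>>0. \<forall>t\<in>D. \<forall>x. \<bar>x - x0\<bar> < \<delta> \<longrightarrow> (\<exists>t'. \<bar>t' - t\<bar> < \<delta>0 \<and> R x t')"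
  proof (rule finite_uniform_bound[OF D(1)])
    fix t assume "t \<in> D"
    then have "normal R x0 t" "R x0 t" using good D by blast+
    then show "\<exists>\<delta>>0. \<forall>x. \<bar>x - x0\<bar> < \<delta> \<longrightarrow> (\<exists>t'. \<bar>t' - t\<bar> < \<delta>0 \<and> R x t')"
      using d0(1) by (intro normal_persistent)
  qed (meson order_less_le_trans)
  then obtain \<delta>1 where d1: "\<delta>1 > 0"
    "\<And>t x. t \<in> D \<Longrightarrow> \<bar>x - x0\<bar> < \<delta>1 \<Longrightarrow> \<exists>t'. \<bar>t' - t\<bar> < \<delta>0 \<and> R x t'" by blast
  \<comment> \<open>Compactness is applied to the height \<open>u\<close>: it makes the range of
    \<open>x\<close> for which points at height \<open>u\<close> stay close to \<open>D\<close>
    independent of \<open>u\<close>.\<close>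
  define P where "P = (\<lambda>\<delta> u. \<forall>x. \<bar>x - x0\<bar> < \<delta> \<longrightarrow> R x u \<longrightarrow> (\<exists>t. R x0 t \<and> \<bar>u - t\<bar> < \<delta>0))"
  have "\<exists>\<delta>>0. \<forall>u\<in>{-1..1}. P \<delta> u"
  proof (rule definable_compact[OF om])
    show "dfn M (\<lambda>v. P (v 0) (v 1))"
      unfolding P_def by (intro dfn_intros dfn_app2[OF R])
  next
    show "P \<delta>' u" if "\<delta>' \<le> \<delta>" "P \<delta> u" for \<delta> \<delta>' u
      using that unfolding P_def by (meson order_less_le_trans)
  next
    fix t :: 'a assume t: "t \<in> {-1..1}"
    show "\<exists>\<delta>>0. \<forall>u\<in>{-1..1}. \<bar>u - t\<bar> < \<delta> \<longrightarrow> P \<delta> u"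
    proof (cases "R x0 t")
      case True
      then show ?thesis using d0(1) unfolding P_def by blast
    next
      case False
      obtain \<delta> where "0 < \<delta>" "\<And>x' t'. \<bar>x' - x0\<bar> < \<delta> \<Longrightarrow> \<bar>t' - t\<bar> < \<delta> \<Longrightarrow> \<not> R x' t'"
        using normal_unique[OF good[OF t]] False by metis
      then show ?thesis unfolding P_def by blast
    qed
  qed
  then obtain \<delta>2 where d2: "\<delta>2 > 0" "\<And>u. u \<in> {-1..1} \<Longrightarrow> P \<delta>2 u" by blast
  show ?thesis
  proof (intro exI[of _ "min \<delta>0 (min \<delta>1 \<delta>2)"] conjI allI impI)
    show "0 < min \<delta>0 (min \<delta>1 \<delta>2)" using d0(1) d1(1) d2(1) by simp
    fix x assume "\<bar>x - x0\<bar> < min \<delta>0 (min \<delta>1 \<delta>2)"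
    then have x: "\<bar>x - x0\<bar> < \<delta>0" "\<bar>x - x0\<bar> < \<delta>1" "\<bar>x - x0\<bar> < \<delta>2" by auto
    define f where "f t = (SOME t'. \<bar>t' - t\<bar> < \<delta>0 \<and> R x t')" for t
    have f: "\<bar>f t - t\<bar> < \<delta>0" "R x (f t)" if "t \<in> D" for t
      using someI_ex[OF d1(2)[OF that x(2)]] unfolding f_def by auto
    have "inj_on f D"
    proof (rule inj_onI)
      fix t t' assume tt: "t \<in> D" "t' \<in> D" "f t = f t'"
      have "\<bar>t - t'\<bar> < 2 * \<delta>0"
        using f(1)[OF tt(1)] f(1)[OF tt(2)] tt(3) by (simp add: abs_less_iff)
      with sep tt show "t = t'" by blast
    qed
    moreover have "f ` D = {t. R x t}"
    proof (intro equalityI subsetI)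
      fix u assume "u \<in> f ` D"
      then show "u \<in> {t. R x t}" using f by auto
    next
      fix u assume "u \<in> {t. R x t}"
      then have u: "R x u" by simp
      then obtain t where t: "t \<in> D" "\<bar>u - t\<bar> < \<delta>0"
        using d2(2)[OF bd[OF u]] x unfolding P_def D_def by blast
      have "u = f t"
        using d0(2)[OF t(1), unfolded Q_def, rule_format, of x u "f t"] t(2) f[OF t(1)] u x(1) d0(1)
        by linarith
      with t(1) show "u \<in> f ` D" by blast
    qed
    ultimately show "card {t. R x t} = card {t. R x0 t}"
      using card_image[of f D] unfolding D_def by simp
  qed
qed

text \<open>Otherwise failures occur over a whole interval of base points. The lowest failing height
  \<open>\<beta> x\<close> and its neighbours in the fibre are bounded definable functions, so some
  \<open>x\<close> in the interval is a point of continuity of all three. There a strip around the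
  graph of \<open>\<beta>\<close> contains no fibre points off that graph, which makes every height
  in the strip normal.\<close>

lemma finite_not_normal:
  fixes M :: "('a::linordered_field, 'f, 'r) expansion"
  assumes om: "o_minimal M" and R: "dfn M (\<lambda>v. R (v 0) (v 1))"
    and bd: "\<And>x t. R x t \<Longrightarrow> t \<in> {-1..1}" and fin: "\<And>x. finite {t. R x t}"
  shows "finite {x. \<exists>t\<in>{-1..1}. \<not> normal R x t}"
proof (rule ccontr)
  assume inf: "infinite {x. \<exists>t\<in>{-1..1}. \<not> normal R x t}"
  have dN: "dfn M (\<lambda>v. normal R (v 0) (v 1))"
    unfolding normal_def by (intro dfn_intros dfn_app2[OF R])
  have "dfn M (\<lambda>v. \<exists>t\<in>{-1..1}. \<not> normal R (v 0) t)"
    by (intro dfn_intros dfn_app2[OF dN])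
  from tame_infinite[OF tame_definable[OF om this] inf] obtain a b where
    ab: "a < b" "{a<..<b} \<subseteq> {x. \<exists>t\<in>{-1..1}. \<not> normal R x t}" by blast
  \<comment> \<open>The supremum \<open>\<beta> x\<close> of these heights is the infimum of the
    failing heights.\<close>
  define Bt where "Bt x = (\<lambda>r. r \<in> {-1..1} \<and> (\<forall>t\<in>{-1..1}. t < r \<longrightarrow> normal R x t))" for x
  define \<beta> where "\<beta> x = lub {r. Bt x r}" for x
  have lBt: "is_lub {r. Bt x r} (\<beta> x)" for x
    unfolding \<beta>_def
  proof (rule definable_lub[OF om])
    show "dfn M (\<lambda>v. Bt x (v 0))"
      unfolding Bt_def by (intro dfn_intros dfn_app2[OF dN])
    show "Bt x (-1)" by (simp add: Bt_def)
    show "r \<le> 1" if "Bt x r" for r using that by (simp add: Bt_def)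
  qed
  have d\<beta>: "dsc M (\<lambda>v. \<beta> (v 0))"
    unfolding \<beta>_def
  proof (rule dsc_lub)
    show "\<exists>s. is_lub {a. Bt (v 0) a} s" for v using lBt by blast
    show "dfn M (\<lambda>v. Bt (v (Suc 0)) (v 0))"
      unfolding Bt_def by (intro dfn_intros dfn_app2[OF dN])
  qed
  have \<beta>bd: "\<beta> x \<in> {-1..1}" for x
    using lub_upper[OF lBt, of "-1" x] lub_least[OF lBt, of x 1] by (auto simp: Bt_def)
  \<comment> \<open>The supremum \<open>up x\<close> is the first fibre point above
    \<open>\<beta> x\<close>, or the sentinel 2 beyond all fibres. For the neighbour below the sign
    is reversed, so that \<open>dn x\<close> is a supremum too.\<close>
  define Up where "Up x = (\<lambda>r. r \<in> {-1..2} \<and> (\<forall>t. \<beta> x < t \<and> t < r \<longrightarrow> \<not> R x t))" for x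
  define up where "up x = lub {r. Up x r}" for x
  have Up1: "Up x (\<beta> x)" for x using \<beta>bd[of x] by (auto simp: Up_def)
  have dUp: "dfn M (\<lambda>v. Up (v (Suc 0)) (v 0))"
    unfolding Up_def by (intro dfn_intros dfn_app2[OF R] dsc_app1[OF d\<beta>])
  have lUp: "is_lub {r. Up x r} (up x)" for x
    unfolding up_def
  proof (rule definable_lub[OF om])
    show "dfn M (\<lambda>v. Up x (v 0))"
      unfolding Up_def by (intro dfn_intros dfn_app2[OF R] dsc_app1[OF d\<beta>])
    show "Up x (\<beta> x)" by (rule Up1)
    show "r \<le> 2" if "Up x r" for r using that by (simp add: Up_def)
  qed
  have dup: "dsc M (\<lambda>v. up (v 0))"
    unfolding up_def by (rule dsc_lub) (use lUp dUp in blast)+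
  have upbd: "up x \<in> {-1..2}" for x
    using lub_upper[OF lUp, of "\<beta> x" x] lub_least[OF lUp, of x 2] Up1[of x] \<beta>bd[of x] by (auto simp: Up_def)
  define Dn where "Dn x = (\<lambda>r. r \<in> {-1..2} \<and> (\<forall>t. - r < t \<and> t < \<beta> x \<longrightarrow> \<not> R x t))" for x
  define dn where "dn x = lub {r. Dn x r}" for x
  have Dn1: "Dn x (- \<beta> x)" for x using \<beta>bd[of x] by (auto simp: Dn_def)
  have dDn: "dfn M (\<lambda>v. Dn (v (Suc 0)) (v 0))"
    unfolding Dn_def by (intro dfn_intros dfn_app2[OF R] dsc_app1[OF d\<beta>])
  have lDn: "is_lub {r. Dn x r} (dn x)" for x
    unfolding dn_def
  proof (rule definable_lub[OF om])
    show "dfn M (\<lambda>v. Dn x (v 0))"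
      unfolding Dn_def by (intro dfn_intros dfn_app2[OF R] dsc_app1[OF d\<beta>])
    show "Dn x (- \<beta> x)" by (rule Dn1)
    show "r \<le> 2" if "Dn x r" for r using that by (simp add: Dn_def)
  qed
  have ddn: "dsc M (\<lambda>v. dn (v 0))"
    unfolding dn_def by (rule dsc_lub) (use lDn dDn in blast)+
  have dnbd: "dn x \<in> {-1..2}" for x
    using lub_upper[OF lDn, of "- \<beta> x" x] lub_least[OF lDn, of x 2] Dn1[of x] \<beta>bd[of x] by (auto simp: Dn_def)
  have up_gap: "\<not> R x t" if "\<beta> x < t" "t < up x" for x t
    using lub_approx[OF lUp that(2)] that(1) by (auto simp: Up_def)
  have dn_gap: "\<not> R x t" if "t < \<beta> x" "- t < dn x" for x t
    using lub_approx[OF lDn that(2)] that(1) by (auto simp: Dn_def)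
  have up_gt: "\<beta> x < up x" for x
  proof -
    \<comment> \<open>Finiteness of the fibre enters here: there is a next point, hence a gap of
      positive length.\<close>
    define r where "r = Min (insert 2 {t. R x t \<and> \<beta> x < t})"
    have f: "finite (insert 2 {t. R x t \<and> \<beta> x < t})" using fin[of x] by auto
    have "r \<in> insert 2 {t. R x t \<and> \<beta> x < t}" unfolding r_def using f by (intro Min_in) auto
    then have r: "\<beta> x < r" "r \<in> {-1..2}" using \<beta>bd[of x] bd[of x r] by auto
    have "Up x r" unfolding Up_def
    proof (intro conjI allI impI notI)
      fix t assume "\<beta> x < t \<and> t < r" "R x t"
      then show False using Min_le[OF f, of t] unfolding r_def by auto
    qed (rule r(2))
    then show ?thesis using lub_upper[OF lUp, of r x] r(1) by auto
  qed
  have dn_lt: "- dn x < \<beta> x" for x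
  proof -
    define r where "r = Max (insert (-2) {t. R x t \<and> t < \<beta> x})"
    have f: "finite (insert (-2) {t. R x t \<and> t < \<beta> x})" using fin[of x] by auto
    have "r \<in> insert (-2) {t. R x t \<and> t < \<beta> x}" unfolding r_def using f by (intro Max_in) auto
    then have r: "r < \<beta> x" "- r \<in> {-1..2}" using \<beta>bd[of x] bd[of x r] by auto
    have "Dn x (- r)" unfolding Dn_def
    proof (intro conjI allI impI notI)
      fix t assume "- (- r) < t \<and> t < \<beta> x" "R x t"
      then show False using Max_ge[OF f, of t] unfolding r_def by auto
    qed (rule r(2))
    then show ?thesis using lub_upper[OF lDn, of "- r" x] r(1) by auto
  qed
  have "dfn M (\<lambda>v. R (v 0) (\<beta> (v 0)))"
    by (intro dfn_intros dfn_app2[OF R] dsc_app1[OF d\<beta>])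
  \<comment> \<open>Just to the right of \<open>a\<close> the graph of \<open>\<beta>\<close> lies
    entirely in the relation or entirely outside it.\<close>
  from tame_right[OF tame_definable[OF om this], of a] obtain c where c: "a < c"
    "(\<forall>x. a < x \<and> x < c \<longrightarrow> R x (\<beta> x)) \<or> (\<forall>x. a < x \<and> x < c \<longrightarrow> \<not> R x (\<beta> x))" by auto
  have "\<bar>\<beta> z\<bar> \<le> 2" "\<bar>up z\<bar> \<le> 2" "\<bar>dn z\<bar> \<le> 2" for z
    using \<beta>bd[of z] upbd[of z] dnbd[of z] by (auto simp: abs_le_iff intro: order_trans)
  then have "finite ({x. \<not> cont_at \<beta> x} \<union> {x. \<not> cont_at up x} \<union> {x. \<not> cont_at dn x})"
    using finite_discontinuities[OF om d\<beta>, of 2] finite_discontinuities[OF om dup, of 2]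
      finite_discontinuities[OF om ddn, of 2] by blast
  moreover have "infinite {a<..<min b c}" using ab c infinite_Ioo[of a "min b c"] by auto
  ultimately have "\<not> {a<..<min b c} \<subseteq> {x. \<not> cont_at \<beta> x} \<union> {x. \<not> cont_at up x} \<union> {x. \<not> cont_at dn x}"
    using finite_subset by blast
  then obtain x where x: "a < x" "x < b" "x < c" "cont_at \<beta> x" "cont_at up x" "cont_at dn x"
    by (auto simp: subset_iff)
  \<comment> \<open>Half of the smaller gap: a height within \<open>\<eta>\<close> of
    \<open>\<beta> x\<close> cannot meet a neighbour that is displaced by less than
    \<open>\<eta>\<close>.\<close>
  define \<eta> where "\<eta> = min (up x - \<beta> x) (\<beta> x + dn x) / 2"
  have \<eta>: "0 < \<eta>" "2 * \<eta> \<le> up x - \<beta> x" "2 * \<eta> \<le> \<beta> x + dn x"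
    using up_gt[of x] dn_lt[of x] by (auto simp: \<eta>_def)
  obtain \<delta>1 where d1: "0 < \<delta>1" "\<And>x'. \<bar>x' - x\<bar> < \<delta>1 \<Longrightarrow> \<bar>up x' - up x\<bar> < \<eta>"
    using x(5) \<eta>(1) unfolding cont_at_def by blast
  obtain \<delta>2 where d2: "0 < \<delta>2" "\<And>x'. \<bar>x' - x\<bar> < \<delta>2 \<Longrightarrow> \<bar>dn x' - dn x\<bar> < \<eta>"
    using x(6) \<eta>(1) unfolding cont_at_def by blast
  define \<delta> where "\<delta> = Min {\<delta>1, \<delta>2, x - a, c - x}"
  have \<delta>: "0 < \<delta>" "\<delta> \<le> \<delta>1" "\<delta> \<le> \<delta>2" "\<delta> \<le> x - a" "\<delta> \<le> c - x"
    using d1(1) d2(1) x unfolding \<delta>_def by auto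
  have near: "R x' t \<longleftrightarrow> t = \<beta> x' \<and> R x' (\<beta> x')" if "\<bar>x' - x\<bar> < \<delta>" "\<bar>t - \<beta> x\<bar> < \<eta>" for x' t
  proof -
    have "\<bar>up x' - up x\<bar> < \<eta>" "\<bar>dn x' - dn x\<bar> < \<eta>" using d1(2) d2(2) that(1) \<delta> by auto
    then have "t < up x'" "- t < dn x'" using that(2) \<eta> by (auto simp: abs_less_iff)
    then show ?thesis using up_gap[of x' t] dn_gap[of t x'] by (cases t "\<beta> x'" rule: linorder_cases) auto
  qed
  have near_c: "R x' (\<beta> x') \<longleftrightarrow> R x (\<beta> x)" if "\<bar>x' - x\<bar> < \<delta>" for x'
  proof -
    have "a < x'" "x' < c" using that \<delta> by (auto simp: abs_less_iff)
    with c(2) x show ?thesis by blast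
  qed
  have norm: "normal R x t" if t: "\<bar>t - \<beta> x\<bar> < \<eta>" for t
  proof (cases "R x t")
    case True
    then have t\<beta>: "t = \<beta> x" "R x (\<beta> x)" using near[of x t] t \<delta>(1) by auto
    show ?thesis
    proof (rule normalI[of "min \<delta> \<eta>"])
      show "0 < min \<delta> \<eta>" using \<delta>(1) \<eta>(1) by simp
      show "t1 = t2" if "\<bar>x' - x\<bar> < min \<delta> \<eta>" "\<bar>t1 - t\<bar> < min \<delta> \<eta>" "\<bar>t2 - t\<bar> < min \<delta> \<eta>"
        "R x' t1" "R x' t2" for x' t1 t2
        using near[of x' t1] near[of x' t2] that t\<beta>(1) by simp
    next
      fix \<epsilon> :: 'a assume "0 < \<epsilon>"
      then obtain \<delta>3 where d3: "0 < \<delta>3" "\<And>x'. \<bar>x' - x\<bar> < \<delta>3 \<Longrightarrow> \<bar>\<beta> x' - \<beta> x\<bar> < \<epsilon>"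
        using x(4) unfolding cont_at_def by blast
      then show "\<exists>\<delta>>0. \<forall>x'. \<bar>x' - x\<bar> < \<delta> \<longrightarrow> (\<exists>t'. \<bar>t' - t\<bar> < \<epsilon> \<and> R x' t')"
        using near_c t\<beta> \<delta>(1) by (intro exI[of _ "min \<delta> \<delta>3"]) auto
    qed (use True in blast)
  next
    case False
    have "\<exists>\<delta>3>0. \<forall>x' t'. \<bar>x' - x\<bar> < \<delta>3 \<longrightarrow> \<bar>t' - t\<bar> < \<delta>3 \<longrightarrow> \<not> R x' t'"
    proof (cases "R x (\<beta> x)")
      case nR: False
      define \<delta>3 where "\<delta>3 = min \<delta> (\<eta> - \<bar>t - \<beta> x\<bar>)"
      have "\<not> R x' t'" if "\<bar>x' - x\<bar> < \<delta>3" "\<bar>t' - t\<bar> < \<delta>3" for x' t'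
      proof -
        have "\<bar>t' - \<beta> x\<bar> \<le> \<bar>t' - t\<bar> + \<bar>t - \<beta> x\<bar>" by (rule order_trans[OF _ abs_triangle_ineq]) simp
        then have "\<bar>t' - \<beta> x\<bar> < \<eta>" using that unfolding \<delta>3_def by simp
        then show ?thesis using near[of x' t'] near_c[of x'] nR that unfolding \<delta>3_def by auto
      qed
      moreover have "0 < \<delta>3" unfolding \<delta>3_def using \<delta>(1) t by simp
      ultimately show ?thesis by blast
    next
      case True
      \<comment> \<open>Half the distance from \<open>t\<close> to the graph of
        \<open>\<beta>\<close> at \<open>x\<close>; by continuity the graph does not come closer to
        \<open>t\<close> than that over nearby points.\<close>
      define \<rho> where "\<rho> = \<bar>t - \<beta> x\<bar> / 2"
      have \<rho>: "0 < \<rho>" using True False by (auto simp: \<rho>_def)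
      then obtain \<delta>4 where d4: "0 < \<delta>4" "\<And>x'. \<bar>x' - x\<bar> < \<delta>4 \<Longrightarrow> \<bar>\<beta> x' - \<beta> x\<bar> < \<rho>"
        using x(4) unfolding cont_at_def by blast
      define \<delta>3 where "\<delta>3 = min (min \<delta>4 \<rho>) (min \<delta> (\<eta> - \<bar>t - \<beta> x\<bar>))"
      have "\<not> R x' t'" if xt: "\<bar>x' - x\<bar> < \<delta>3" "\<bar>t' - t\<bar> < \<delta>3" for x' t'
      proof
        assume R': "R x' t'"
        have "\<bar>t' - \<beta> x\<bar> \<le> \<bar>t' - t\<bar> + \<bar>t - \<beta> x\<bar>" by (rule order_trans[OF _ abs_triangle_ineq]) simp
        then have "\<bar>t' - \<beta> x\<bar> < \<eta>" using xt unfolding \<delta>3_def by simp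
        with R' have "t' = \<beta> x'" using near[of x' t'] xt unfolding \<delta>3_def by auto
        then have "\<bar>t' - \<beta> x\<bar> < \<rho>" using d4(2)[of x'] xt unfolding \<delta>3_def by auto
        moreover have "\<bar>t' - t\<bar> < \<rho>" using xt unfolding \<delta>3_def by auto
        moreover have "\<bar>t - \<beta> x\<bar> \<le> \<bar>t' - t\<bar> + \<bar>t' - \<beta> x\<bar>"
          using abs_triangle_ineq[of "t - t'" "t' - \<beta> x"] by (simp add: abs_minus_commute)
        ultimately show False unfolding \<rho>_def by simp
      qed
      moreover have "0 < \<delta>3" unfolding \<delta>3_def using \<delta>(1) t d4(1) \<rho> by simp
      ultimately show ?thesis by blast
    qed
    then obtain \<delta>3 where "\<delta>3 > 0" "\<forall>x' t'. \<bar>x' - x\<bar> < \<delta>3 \<longrightarrow> \<bar>t' - t\<bar> < \<delta>3 \<longrightarrow> \<not> R x' t'"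
      by blast
    with False show ?thesis by (intro normalI[of \<delta>3]) blast+
  qed
  obtain t0 where t0: "t0 \<in> {-1..1}" "\<not> normal R x t0" using ab(2) x by auto
  \<comment> \<open>All heights below \<open>r\<close> are normal, so \<open>r\<close> cannot exceed
    \<open>\<beta> x\<close>. This forces the failing height \<open>t0\<close> to be
    \<open>\<beta> x\<close>, which lies in the normal strip.\<close>
  define r where "r = min (\<beta> x + \<eta> / 2) t0"
  have "\<beta> x \<le> t0"
  proof (rule lub_least[OF lBt])
    show "s \<le> t0" if "s \<in> {r. Bt x r}" for s
      using that t0 unfolding Bt_def by (auto simp: not_less[symmetric])
  qed
  have "Bt x r" unfolding Bt_def
  proof (intro conjI ballI impI)
    show "r \<in> {-1..1}" using \<open>\<beta> x \<le> t0\<close> t0 \<beta>bd[of x] \<eta>(1) unfolding r_def by auto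
    fix t :: 'a assume t: "t \<in> {-1..1}" "t < r"
    show "normal R x t"
    proof (cases "t < \<beta> x")
      case True
      then obtain s where "Bt x s" "t < s" using lub_approx[OF lBt True] by auto
      with t show ?thesis unfolding Bt_def by blast
    next
      case False
      then show ?thesis using t \<eta>(1) unfolding r_def by (intro norm) (auto simp: abs_less_iff)
    qed
  qed
  then have "r \<le> \<beta> x" using lub_upper[OF lBt] by blast
  then have "t0 \<le> \<beta> x" using \<eta>(1) unfolding r_def by (auto simp: min_def split: if_splits)
  then have "t0 = \<beta> x" using \<open>\<beta> x \<le> t0\<close> by simp
  with t0 norm[of t0] \<eta>(1) show False by simp
qed

section \<open>Counting fibre points by first-order conditions\<close>

lemma Suc_le_card_above_iff:
  fixes A :: "'a::linorder set"
  assumes "finite A"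
  shows "Suc n \<le> card {t. t \<in> A \<and> c < t} \<longleftrightarrow> (\<exists>t. t \<in> A \<and> c < t \<and> n \<le> card {t'. t' \<in> A \<and> t < t'})"
proof
  define B where "B = {t. t \<in> A \<and> c < t}"
  have B: "finite B" using assms by (auto simp: B_def)
  assume "Suc n \<le> card {t. t \<in> A \<and> c < t}"
  then have c: "Suc n \<le> card B" unfolding B_def .
  then have "B \<noteq> {}" by auto
  then have m: "Min B \<in> B" using B by (rule Min_in[rotated])
  have "B - {Min B} \<subseteq> {t'. t' \<in> A \<and> Min B < t'}"
    using Min_le[OF B] by (auto simp: B_def order_less_le)
  then have "card (B - {Min B}) \<le> card {t'. t' \<in> A \<and> Min B < t'}"
    using assms by (intro card_mono) auto
  then have "n \<le> card {t'. t' \<in> A \<and> Min B < t'}" using c m B by simp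
  then show "\<exists>t. t \<in> A \<and> c < t \<and> n \<le> card {t'. t' \<in> A \<and> t < t'}"
    using m unfolding B_def by blast
next
  assume "\<exists>t. t \<in> A \<and> c < t \<and> n \<le> card {t'. t' \<in> A \<and> t < t'}"
  then obtain t where t: "t \<in> A" "c < t" "n \<le> card {t'. t' \<in> A \<and> t < t'}" by blast
  have "Suc n \<le> card (insert t {t'. t' \<in> A \<and> t < t'})" using t assms by simp
  also have "\<dots> \<le> card {t. t \<in> A \<and> c < t}"
    using assms t by (intro card_mono) auto
  finally show "Suc n \<le> card {t. t \<in> A \<and> c < t}" .
qed

text \<open>The moving lower bound makes a recursion on \<open>n\<close> possible: more than
  \<open>n\<close> points lie above \<open>c\<close> exactly if some point above \<open>c\<close>
  has at least \<open>n\<close> points above itself.\<close>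

lemma dfn_le_card_above:
  assumes R: "dfn M (\<lambda>v. R (v 0) (v 1))" and fin: "\<And>x. finite {t. R x t}"
  shows "dfn M (\<lambda>v. n \<le> card {t. R (v 0) t \<and> v 1 < t})"
proof (induction n)
  case 0
  show ?case by (simp add: dfn_const)
next
  case (Suc n)
  have "dfn M (\<lambda>v. \<exists>t. R (v 0) t \<and> v 1 < t \<and> n \<le> card {t'. R (v 0) t' \<and> t < t'})"
    by (intro dfn_intros dfn_app2[OF R]
      dfn_app2[where R = "\<lambda>a b. n \<le> card {t'. R a t' \<and> b < t'}", OF Suc])
  moreover have "Suc n \<le> card {t. R x t \<and> c < t} \<longleftrightarrow> (\<exists>t. R x t \<and> c < t \<and> n \<le> card {t'. R x t' \<and> t < t'})" for x c
    using Suc_le_card_above_iff[OF fin[of x], of n c] by simp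
  ultimately show ?case by simp
qed

text \<open>Each condition \<open>n \<le> card\<close> is definable and locally constant, hence
  constant on the segment by definable connectedness.\<close>

lemma card_constant_on_segment:
  fixes M :: "('a::linordered_field, 'f, 'r) expansion"
  assumes om: "o_minimal M" and R: "dfn M (\<lambda>v. R (v 0) (v 1))"
    and bd: "\<And>x t. R x t \<Longrightarrow> t \<in> {-1..1}" and fin: "\<And>x. finite {t. R x t}"
    and good: "\<And>x t. x \<in> {a..b} \<Longrightarrow> t \<in> {-1..1} \<Longrightarrow> normal R x t" and ab: "a \<le> b"
  shows "card {t. R a t} = card {t. R b t}"
proof -
  have "n \<le> card {t. R a t} \<longleftrightarrow> n \<le> card {t. R b t}" for n
  proof (rule ccontr)
    assume neq: "\<not> ?thesis"
    \<comment> \<open>-2 lies below every fibre, so counting above it counts everything.\<close>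
    have eq: "{t. R x t \<and> -2 < t} = {t. R x t}" for x
      using bd[of x] by (force intro: less_le_trans[of "-2" "-1"])
    have "dfn M (\<lambda>v. n \<le> card {t. R (v 0) t \<and> -2 < t})"
      by (intro dfn_intros dfn_app2[where R = "\<lambda>a b. n \<le> card {t'. R a t' \<and> b < t'}",
            OF dfn_le_card_above[OF R fin]])
    then have "dfn M (\<lambda>v. n \<le> card {t. R (v 0) t})" by (simp only: eq)
    from definable_switch[OF om this ab neq] obtain d where d: "d \<in> {a..b}"
      "\<forall>\<delta>>0. \<exists>u\<in>{a..b}. \<bar>u - d\<bar> < \<delta> \<and> (n \<le> card {t. R u t}) \<noteq> (n \<le> card {t. R d t})"
      by blast
    have "\<exists>\<delta>>0. \<forall>x. \<bar>x - d\<bar> < \<delta> \<longrightarrow> card {t. R x t} = card {t. R d t}"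
      by (rule card_locally_constant[OF om R _ fin]) (use bd good[OF d(1)] in blast)+
    with d(2) show False by metis
  qed
  from this[of "card {t. R a t}"] this[of "card {t. R b t}"] show ?thesis by simp
qed

lemma definable_snocI:
  assumes "dfn M (\<lambda>v. P (map v [0..<m]) (v m))"
  shows "definable M (Suc m) {y @ [z] | y z. length y = m \<and> P y z}"
proof (rule definableI)
  have "map v [0..<Suc m] \<in> {y @ [z] | y z. length y = m \<and> P y z} \<longleftrightarrow> P (map v [0..<m]) (v m)" for v
    by auto
  with assms show "dfn M (\<lambda>v. map v [0..<Suc m] \<in> {y @ [z] | y z. length y = m \<and> P y z})"
    by (simp del: upt_Suc)
qed auto

definition uniformly_finite :: "('a::linordered_field, 'f, 'r) expansion \<Rightarrow> nat \<Rightarrow> bool" where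
  "uniformly_finite M m \<longleftrightarrow> (\<forall>D. definable M (Suc m) D \<longrightarrow>
     (\<forall>y. length y = m \<longrightarrow> finite {t. y @ [t] \<in> D}) \<longrightarrow>
     (\<exists>N. \<forall>y. length y = m \<longrightarrow> card {t. y @ [t] \<in> D} \<le> N))"

lemma uniformly_finiteD:
  assumes "uniformly_finite M m" "dfn M (\<lambda>v. P (map v [0..<m]) (v m))"
    and "\<And>y. length y = m \<Longrightarrow> finite {t. P y t}"
  shows "\<exists>N. \<forall>y. length y = m \<longrightarrow> card {t. P y t} \<le> N"
proof -
  define D where "D = {y @ [z] | y z. length y = m \<and> P y z}"
  have eq: "{t. y @ [t] \<in> D} = {t. P y t}" if "length y = m" for y
    using that by (auto simp: D_def)
  have "definable M (Suc m) D" unfolding D_def by (rule definable_snocI[OF assms(2)])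
  then have "\<exists>N. \<forall>y. length y = m \<longrightarrow> card {t. y @ [t] \<in> D} \<le> N"
    using assms(1)[unfolded uniformly_finite_def, rule_format, of D] assms(3) eq by auto
  then show ?thesis using eq by auto
qed

text \<open>\<open>t / (1 + \<bar>t\<bar>)\<close> embeds the line into the definably compact interval from \<open>-1\<close> to \<open>1\<close>.\<close>

lemma inj_squash: "inj (\<lambda>x::'a::linordered_field. x / (1 + \<bar>x\<bar>))"
proof (rule injI)
  fix x y :: 'a
  assume "x / (1 + \<bar>x\<bar>) = y / (1 + \<bar>y\<bar>)"
  moreover have "1 + \<bar>x\<bar> > 0" "1 + \<bar>y\<bar> > 0" by (auto intro: add_pos_nonneg)
  ultimately have e: "x * (1 + \<bar>y\<bar>) = y * (1 + \<bar>x\<bar>)" by (simp add: frac_eq_eq)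
  \<comment> \<open>The denominators are positive, so \<open>x\<close> and \<open>y\<close> have the
    same sign and the cross terms \<open>x * \<bar>y\<bar>\<close> and
    \<open>y * \<bar>x\<bar>\<close> cancel.\<close>
  have "sgn x = sgn y"
    using arg_cong[OF e, of sgn] \<open>1 + \<bar>x\<bar> > 0\<close> \<open>1 + \<bar>y\<bar> > 0\<close> by (simp add: sgn_mult)
  then have "x * \<bar>y\<bar> = y * \<bar>x\<bar>"
    by (metis abs_sgn mult.assoc mult.commute)
  with e show "x = y" by (simp add: algebra_simps)
qed

lemma uniformly_finite_unbounded:
  fixes M :: "('a::linordered_field, 'f, 'r) expansion"
  assumes "\<And>D. definable M (Suc m) D \<Longrightarrow> (\<And>y. length y = m \<Longrightarrow> finite {t. y @ [t] \<in> D}) \<Longrightarrow>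
    (\<And>y t. y @ [t] \<in> D \<Longrightarrow> t \<in> {-1..1}) \<Longrightarrow>
    \<exists>N. \<forall>y. length y = m \<longrightarrow> card {t. y @ [t] \<in> D} \<le> N"
  shows "uniformly_finite M m"
  unfolding uniformly_finite_def
proof (intro allI impI)
  fix D assume D: "definable M (Suc m) D" and fin: "\<forall>y. length y = m \<longrightarrow> finite {t. y @ [t] \<in> D}"
  define f where "f = (\<lambda>x::'a. x / (1 + \<bar>x\<bar>))"
  define D' where "D' = {y @ [t] | y t. length y = m \<and> (\<exists>x. y @ [x] \<in> D \<and> t = x / (1 + \<bar>x\<bar>))}"
  have eq: "{t. y @ [t] \<in> D'} = f ` {t. y @ [t] \<in> D}" if "length y = m" for y
    using that by (auto simp: D'_def f_def)
  have "\<exists>N. \<forall>y. length y = m \<longrightarrow> card {t. y @ [t] \<in> D'} \<le> N"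
  proof (rule assms)
    show "definable M (Suc m) D'"
      unfolding D'_def
      by (rule definable_snocI, intro dfn_intros dfn_mem[OF D])
    show "finite {t. y @ [t] \<in> D'}" if "length y = m" for y
      using eq[OF that] fin that by simp
    show "t \<in> {-1..1}" if yt: "y @ [t] \<in> D'" for y t
    proof -
      obtain x where x: "t = x / (1 + \<bar>x\<bar>)" using yt unfolding D'_def by blast
      have "0 < 1 + \<bar>x\<bar>" by (simp add: add_pos_nonneg)
      then show ?thesis unfolding x
        by (simp add: le_divide_eq divide_le_eq abs_if not_less)
    qed
  qed
  moreover have "card {t. y @ [t] \<in> D'} = card {t. y @ [t] \<in> D}" if "length y = m" for y
    unfolding eq[OF that] using inj_squash by (intro card_image) (auto simp: f_def inj_on_def)
  ultimately show "\<exists>N. \<forall>y. length y = m \<longrightarrow> card {t. y @ [t] \<in> D} \<le> N" by auto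
qed

text \<open>Induction on the bound \<open>k\<close> for the number of samples. The least sample
  depends definably on \<open>y\<close>, so the fibres of \<open>D\<close> over it form a family
  with \<open>m\<close> parameters, which \<open>uniformly_finite M m\<close> bounds; removing it
  leaves fewer samples.\<close>

lemma uniformly_finite_along:
  fixes M :: "('a::linordered_field, 'f, 'r) expansion"
  assumes UF: "uniformly_finite M m" and D: "definable M (Suc (Suc m)) D"
    and finD: "\<And>y z. length y = m \<Longrightarrow> finite {t. y @ [z, t] \<in> D}"
    and "dfn M (\<lambda>v. Z (map v [0..<m]) (v m))"
    and "\<And>y. length y = m \<Longrightarrow> finite {z. Z y z}" "\<And>y. length y = m \<Longrightarrow> card {z. Z y z} \<le> k"
  shows "\<exists>N. \<forall>y z. length y = m \<longrightarrow> Z y z \<longrightarrow> card {t. y @ [z, t] \<in> D} \<le> N"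
  using assms(4-)
proof (induction k arbitrary: Z)
  case 0
  then show ?case by fastforce
next
  case (Suc k)
  have Z: "dfn M (\<lambda>v. Z (L v) (T v))" if "dl M L" "\<And>v. length (L v) = m" "dsc M T" for L T
  proof -
    have "dfn M (\<lambda>v. L v @ [T v] \<in> {y @ [z] | y z. length y = m \<and> Z y z})"
      using that by (intro dfn_mem[OF definable_snocI[OF Suc.prems(1)]] dfn_intros) auto
    then show ?thesis using that(2) by simp
  qed
  define lo where "lo = (\<lambda>y z. Z y z \<and> (\<forall>z'. Z y z' \<longrightarrow> z \<le> z'))"
  have "\<exists>N. \<forall>y. length y = m \<longrightarrow> card {t. \<exists>z. lo y z \<and> y @ [z, t] \<in> D} \<le> N"
  proof (rule uniformly_finiteD[OF UF])
    show "dfn M (\<lambda>v. \<exists>z. lo (map v [0..<m]) z \<and> map v [0..<m] @ [z, v m] \<in> D)"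
      unfolding lo_def by (intro dfn_intros Z dfn_mem[OF D]) auto
    show "finite {t. \<exists>z. lo y z \<and> y @ [z, t] \<in> D}" if "length y = m" for y
    proof (rule finite_subset)
      show "{t. \<exists>z. lo y z \<and> y @ [z, t] \<in> D} \<subseteq> (\<Union>z\<in>{z. Z y z}. {t. y @ [z, t] \<in> D})"
        by (auto simp: lo_def)
      show "finite (\<Union>z\<in>{z. Z y z}. {t. y @ [z, t] \<in> D})"
        using Suc.prems(2)[OF that] finD[OF that] by blast
    qed
  qed
  then obtain N1 where N1: "\<And>y. length y = m \<Longrightarrow> card {t. \<exists>z. lo y z \<and> y @ [z, t] \<in> D} \<le> N1" by blast
  have "\<exists>N. \<forall>y z. length y = m \<longrightarrow> Z y z \<and> \<not> lo y z \<longrightarrow> card {t. y @ [z, t] \<in> D} \<le> N"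
  proof (rule Suc.IH)
    show "dfn M (\<lambda>v. Z (map v [0..<m]) (v m) \<and> \<not> lo (map v [0..<m]) (v m))"
      unfolding lo_def by (intro dfn_intros Z) auto
    fix y :: "'a list" assume y: "length y = m"
    show "finite {z. Z y z \<and> \<not> lo y z}" using Suc.prems(2)[OF y] by auto
    show "card {z. Z y z \<and> \<not> lo y z} \<le> k"
    proof (cases "{z. Z y z} = {}")
      case True
      then have "{z. Z y z \<and> \<not> lo y z} = {}" by blast
      then show ?thesis by (simp only: card.empty)
    next
      case False
      define l where "l = Min {z. Z y z}"
      have l: "l \<in> {z. Z y z}" "lo y l"
        using Min_in[OF Suc.prems(2)[OF y] False] Min_le[OF Suc.prems(2)[OF y]] by (auto simp: l_def lo_def)
      have "{z. Z y z \<and> \<not> lo y z} \<subseteq> {z. Z y z} - {l}" using l by auto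
      then have "card {z. Z y z \<and> \<not> lo y z} \<le> card ({z. Z y z} - {l})"
        using Suc.prems(2)[OF y] by (intro card_mono) auto
      also have "\<dots> \<le> k" using Suc.prems(2)[OF y] Suc.prems(3)[OF y] l by simp
      finally show ?thesis .
    qed
  qed
  then obtain N2 where N2: "\<And>y z. length y = m \<Longrightarrow> Z y z \<Longrightarrow> \<not> lo y z \<Longrightarrow> card {t. y @ [z, t] \<in> D} \<le> N2"
    by blast
  have "card {t. y @ [z, t] \<in> D} \<le> max N1 N2" if y: "length y = m" "Z y z" for y z
  proof (cases "lo y z")
    case True
    then have "\<And>z'. lo y z' \<Longrightarrow> z' = z" by (auto simp: lo_def intro: antisym)
    with True have "{t. \<exists>z. lo y z \<and> y @ [z, t] \<in> D} = {t. y @ [z, t] \<in> D}" by blast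
    with N1[OF y(1)] show ?thesis by simp
  next
    case False
    with N2[OF y] show ?thesis by simp
  qed
  then show ?case by blast
qed

text \<open>Each component of the complement of a finite set is represented by a point definable
  from the set: 0 if the set is empty, a point one unit beyond an extreme element, or the midpoint
  of two adjacent elements.\<close>

lemma sample_point:
  fixes A :: "'a::linordered_field set"
  assumes "finite A" "z \<notin> A"
  obtains z0 where "z0 = 0 \<or> (\<exists>b\<in>A. z0 = b + 1 \<or> z0 = b - 1 \<or> (\<exists>b'\<in>A. z0 = (b + b') / 2))"
    "A \<inter> {min z z0..max z z0} = {}"
proof -
  define L where "L = {b\<in>A. b < z}"
  define U where "U = {b\<in>A. z < b}"
  have fin: "finite L" "finite U" using assms(1) by (auto simp: L_def U_def)
  have split: "b \<in> L \<or> b \<in> U" if "b \<in> A" for b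
    using that assms(2) by (cases b z rule: linorder_cases) (auto simp: L_def U_def)
  have Lmax: "x \<le> Max L" if "x \<in> L" for x using that fin by simp
  have Umin: "Min U \<le> x" if "x \<in> U" for x using that fin by simp
  have maxL: "Max L \<in> A" "Max L < z" if "L \<noteq> {}" using Max_in[OF fin(1) that] by (auto simp: L_def)
  have minU: "Min U \<in> A" "z < Min U" if "U \<noteq> {}" using Min_in[OF fin(2) that] by (auto simp: U_def)
  consider "L = {}" "U = {}" | "L \<noteq> {}" "U = {}" | "L = {}" "U \<noteq> {}" | "L \<noteq> {}" "U \<noteq> {}" by blast
  then show thesis
  proof cases
    case 1
    then have "A = {}" using split by blast
    then show ?thesis using that[of 0] by simp
  next
    case 2
    have "b < min z (Max L + 1)" if "b \<in> A" for b
      using split[OF that] 2 Lmax[of b] maxL by auto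
    then have "A \<inter> {min z (Max L + 1)..max z (Max L + 1)} = {}" by force
    then show ?thesis using that[of "Max L + 1"] maxL 2 by blast
  next
    case 3
    have "max z (Min U - 1) < b" if "b \<in> A" for b
      using split[OF that] 3 Umin[of b] minU by auto
    then have "A \<inter> {min z (Min U - 1)..max z (Min U - 1)} = {}" by force
    then show ?thesis using that[of "Min U - 1"] minU 3 by blast
  next
    case 4
    define z0 where "z0 = (Max L + Min U) / 2"
    have z0: "Max L < z0" "z0 < Min U" using maxL minU 4 by (auto simp: z0_def)
    have "b < min z z0 \<or> max z z0 < b" if "b \<in> A" for b
      using split[OF that] 4 Lmax[of b] Umin[of b] maxL minU z0 by auto
    then have "A \<inter> {min z z0..max z z0} = {}" by force
    then show ?thesis using that[of z0] maxL minU 4 unfolding z0_def by blast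
  qed
qed

theorem uniform_finiteness:
  fixes M :: "('a::linordered_field, 'f, 'r) expansion"
  assumes om: "o_minimal M"
  shows "uniformly_finite M m"
proof (induction m)
  case 0
  \<comment> \<open>Without parameters the only \<open>y\<close> is the empty list, and the
    cardinality of its fibre is the bound.\<close>
  show ?case unfolding uniformly_finite_def by auto
next
  case (Suc m)
  note UF = this
  show ?case
  proof (rule uniformly_finite_unbounded)
    fix D :: "'a list set"
    assume D: "definable M (Suc (Suc m)) D" and fin: "\<And>y. length y = Suc m \<Longrightarrow> finite {t. y @ [t] \<in> D}"
      and bd: "\<And>y t. y @ [t] \<in> D \<Longrightarrow> t \<in> {-1..1}"
    define R where "R = (\<lambda>y z t. y @ [z, t] \<in> D)"
    have Rbd: "t \<in> {-1..1}" if "R y z t" for y z t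
      using bd[of "y @ [z]" t] that by (simp add: R_def)
    have Rfin: "finite {t. R y z t}" if "length y = m" for y z
      using fin[of "y @ [z]"] that by (simp add: R_def)
    have dR: "dfn M (\<lambda>v. R y (v 0) (v 1))" if "length y = m" for y
      unfolding R_def by (intro dfn_intros dfn_mem[OF D])
    define bad where "bad = (\<lambda>y z. \<exists>t\<in>{-1..1}. \<not> normal (R y) z t)"
    have finbad: "finite {z. bad y z}" if "length y = m" for y
      unfolding bad_def by (rule finite_not_normal[OF om dR[OF that] Rbd Rfin[OF that]])
    have "dfn M (\<lambda>v. bad (map v [0..<m]) (v m))"
      unfolding bad_def normal_def R_def by (intro dfn_intros dfn_mem[OF D])
    note bad_snoc = definable_snocI[OF this]
    have dbad: "dfn M (\<lambda>v. bad (L v) (T v))" if "dl M L" "\<And>v. length (L v) = m" "dsc M T" for L T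
    proof -
      have "dfn M (\<lambda>v. L v @ [T v] \<in> {y @ [z] | y z. length y = m \<and> bad y z})"
        using that by (intro dfn_mem[OF bad_snoc] dfn_intros) auto
      then show ?thesis using that(2) by simp
    qed
    \<comment> \<open>Bad points are samples too, being midpoints of themselves with themselves. The
      induction hypothesis bounds first the number of samples and then, along the samples, the
      fibres of \<open>D\<close>.\<close>
    define Z where "Z = (\<lambda>y z. z = 0 \<or> (\<exists>b. bad y b \<and> (z = b + 1 \<or> z = b - 1 \<or> (\<exists>b'. bad y b' \<and> z = (b + b') / 2))))"
    have dZ: "dfn M (\<lambda>v. Z (map v [0..<m]) (v m))"
      unfolding Z_def by (intro dfn_intros dbad) auto
    have finZ: "finite {z. Z y z}" if "length y = m" for y
    proof (rule finite_subset)
      let ?A = "{z. bad y z}"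
      show "{z. Z y z} \<subseteq> {0} \<union> (\<lambda>b. b + 1) ` ?A \<union> (\<lambda>b. b - 1) ` ?A \<union> (\<Union>b\<in>?A. \<Union>b'\<in>?A. {(b + b') / 2})"
        unfolding Z_def by blast
      show "finite ({0} \<union> (\<lambda>b. b + 1) ` ?A \<union> (\<lambda>b. b - 1) ` ?A \<union> (\<Union>b\<in>?A. \<Union>b'\<in>?A. {(b + b') / 2}))"
        using finbad[OF that] by auto
    qed
    obtain K where K: "\<And>y. length y = m \<Longrightarrow> card {z. Z y z} \<le> K"
      using uniformly_finiteD[OF UF dZ finZ] by blast
    have "\<exists>N. \<forall>y z. length y = m \<longrightarrow> Z y z \<longrightarrow> card {t. y @ [z, t] \<in> D} \<le> N"
      by (rule uniformly_finite_along[OF UF D _ dZ finZ K]) (use Rfin in \<open>simp_all add: R_def\<close>)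
    then obtain N where N: "\<And>y z. length y = m \<Longrightarrow> Z y z \<Longrightarrow> card {t. R y z t} \<le> N"
      unfolding R_def by blast
    have "card {t. R y z t} \<le> N" if y: "length y = m" for y z
    proof (cases "bad y z")
      case True
      have "z = (z + z) / 2" by simp
      with True have "Z y z" unfolding Z_def by blast
      with N[OF y] show ?thesis by blast
    next
      case False
      then obtain z0 where z0: "z0 = 0 \<or> (\<exists>b\<in>{z. bad y z}. z0 = b + 1 \<or> z0 = b - 1 \<or> (\<exists>b'\<in>{z. bad y z}. z0 = (b + b') / 2))"
        "{z. bad y z} \<inter> {min z z0..max z z0} = {}"
        using sample_point[OF finbad[OF y], of z] by blast
      have "Z y z0" using z0(1) unfolding Z_def by blast
      \<comment> \<open>No bad point lies between \<open>z\<close> and its sample \<open>z0\<close>,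
        so their fibres have equally many points.\<close>
      have "card {t. R y (min z z0) t} = card {t. R y (max z z0) t}"
      proof (rule card_constant_on_segment[OF om dR[OF y] Rbd[of y] Rfin[OF y]])
        show "normal (R y) x t" if "x \<in> {min z z0..max z z0}" "t \<in> {-1..1}" for x t
          using z0(2) that unfolding bad_def by blast
      qed (auto intro: order_trans[of _ z])
      then have "card {t. R y z t} = card {t. R y z0 t}"
        by (cases "z \<le> z0") (auto simp: min_def max_def)
      with N[OF y \<open>Z y z0\<close>] show ?thesis by simp
    qed
    then have "card {t. y @ [t] \<in> D} \<le> N" if "length y = Suc m" for y
      using that by (cases y rule: rev_cases) (auto simp: R_def)
    then show "\<exists>N. \<forall>y. length y = Suc m \<longrightarrow> card {t. y @ [t] \<in> D} \<le> N" by blast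
  qed
qed

section \<open>Continuity in coordinates\<close>

lemma near_length: "near \<epsilon> x y \<Longrightarrow> length x = length y"
  unfolding near_def by (rule list_all2_lengthD)

lemma near_append:
  "length x = length x' \<Longrightarrow> near \<epsilon> (x @ y) (x' @ y') \<longleftrightarrow> near \<epsilon> x x' \<and> near \<epsilon> y y'"
  unfolding near_def by (rule list_all2_append)

lemma near_single [simp]: "near \<epsilon> [a] [b] \<longleftrightarrow> \<bar>a - b\<bar> < \<epsilon>"
  unfolding near_def by simp

lemma near_snoc: "near \<epsilon> (x @ [s]) (y @ [t]) \<longleftrightarrow> near \<epsilon> x y \<and> \<bar>s - t\<bar> < \<epsilon>"
  by (cases "length x = length y") (auto simp: near_append dest: near_length)

lemma near_refl: "0 < \<epsilon> \<Longrightarrow> near \<epsilon> x x"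
  unfolding near_def by (simp add: list_all2_refl)

lemma near_mono: "near \<delta> x y \<Longrightarrow> \<delta> \<le> \<epsilon> \<Longrightarrow> near \<epsilon> x y"
  unfolding near_def by (erule list_all2_mono) simp

lemma near_min: "near (min \<delta> \<epsilon>) x y \<longleftrightarrow> near \<delta> x y \<and> near \<epsilon> x y"
  unfolding near_def list_all2_conv_all_nth by auto

lemma near_sym: "near \<epsilon> x y \<Longrightarrow> near \<epsilon> y x"
  unfolding near_def list_all2_conv_all_nth by (simp add: abs_minus_commute)

lemma near_trans:
  assumes "near \<delta> x y" "near \<epsilon> y z" shows "near (\<delta> + \<epsilon>) x z"
  unfolding near_def
proof (rule list_all2_trans[OF _ assms[unfolded near_def]])
  fix a b c assume "\<bar>a - b\<bar> < \<delta>" "\<bar>b - c\<bar> < \<epsilon>"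
  then show "\<bar>a - c\<bar> < \<delta> + \<epsilon>" using abs_triangle_ineq[of "a - b" "b - c"] by simp
qed

lemma near_butlast_last:
  assumes "near \<epsilon> z w" "z \<noteq> []"
  shows "near \<epsilon> (butlast z) (butlast w)" "\<bar>last z - last w\<bar> < \<epsilon>"
proof -
  have "w \<noteq> []" using assms near_length by fastforce
  then have "near \<epsilon> (butlast z @ [last z]) (butlast w @ [last w])" using assms by simp
  then show "near \<epsilon> (butlast z) (butlast w)" "\<bar>last z - last w\<bar> < \<epsilon>"
    unfolding near_snoc by auto
qed

lemma openin_near_ball: "length x = n \<Longrightarrow> openin (power_topology n) {y. near \<epsilon> x y}"
proof -
  assume x: "length x = n"
  have "{y. near \<epsilon> x y} = open_box n (\<lambda>i. x ! i - \<epsilon>) (\<lambda>i. x ! i + \<epsilon>)"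
    using x unfolding near_def open_box_def list_all2_conv_all_nth
    by (auto simp: abs_less_iff algebra_simps)
  then show ?thesis
    unfolding power_topology_def openin_topology_generated_by_iff
    by (auto intro: generate_topology_on.Basis)
qed

lemma open_box_near:
  fixes x :: "'a::linordered_field list"
  assumes "x \<in> open_box n a b"
  shows "\<exists>\<epsilon>>0. \<forall>y. near \<epsilon> x y \<longrightarrow> y \<in> open_box n a b"
proof -
  have x: "length x = n" "\<And>i. i < n \<Longrightarrow> a i < x ! i \<and> x ! i < b i"
    using assms by (auto simp: open_box_def)
  have "\<exists>\<epsilon>>0. \<forall>i\<in>{..<n}. \<epsilon> \<le> x ! i - a i \<and> \<epsilon> \<le> b i - x ! i"
  proof (rule finite_uniform_bound)
    fix i assume "i \<in> {..<n}"
    then show "\<exists>\<epsilon>>0. \<epsilon> \<le> x ! i - a i \<and> \<epsilon> \<le> b i - x ! i"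
      using x(2)[of i] by (intro exI[of _ "min (x ! i - a i) (b i - x ! i)"]) auto
  qed auto
  then obtain \<epsilon> where e: "\<epsilon> > 0" "\<And>i. i < n \<Longrightarrow> \<epsilon> \<le> x ! i - a i \<and> \<epsilon> \<le> b i - x ! i" by auto
  have "y \<in> open_box n a b" if "near \<epsilon> x y" for y
    unfolding open_box_def
  proof (intro CollectI conjI allI impI)
    show "length y = n" using near_length[OF that] x by simp
    fix i assume i: "i < n"
    then have "\<bar>x ! i - y ! i\<bar> < \<epsilon>" using that x unfolding near_def list_all2_conv_all_nth by simp
    then show "a i < y ! i" "y ! i < b i" using e(2)[OF i] by (auto simp: abs_less_iff)
  qed
  with e(1) show ?thesis by blast
qed

lemma openin_power_topology_near:
  assumes "openin (power_topology n) S" "x \<in> S"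
  shows "\<exists>\<epsilon>>0. \<forall>y. near \<epsilon> x y \<longrightarrow> y \<in> S"
proof -
  have "generate_topology_on {open_box n a b | a b. True} S"
    using assms(1) unfolding power_topology_def openin_topology_generated_by_iff .
  then show ?thesis using assms(2)
  proof (induction S arbitrary: x rule: generate_topology_on.induct)
    case (Int S T)
    then obtain \<epsilon> where "\<epsilon> > 0" "\<forall>y. near \<epsilon> x y \<longrightarrow> y \<in> S" by blast
    moreover obtain \<delta> where "\<delta> > 0" "\<forall>y. near \<delta> x y \<longrightarrow> y \<in> T" using Int by blast
    ultimately show ?case by (intro exI[of _ "min \<epsilon> \<delta>"]) (auto simp: near_min)
  next
    case (UN K)
    then obtain S where S: "S \<in> K" "x \<in> S" by blast
    with UN.IH[of S x] obtain \<epsilon> where "\<epsilon> > 0" "\<forall>y. near \<epsilon> x y \<longrightarrow> y \<in> S" by blast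
    with S show ?case by blast
  next
    case (Basis S)
    then show ?case using open_box_near by blast
  qed simp
qed

lemma topspace_power_topology:
  "topspace (power_topology n) = {x :: 'a::linordered_field list. length x = n}"
proof
  show "{x :: 'a list. length x = n} \<subseteq> topspace (power_topology n)"
  proof
    fix x :: "'a list" assume "x \<in> {x. length x = n}"
    then show "x \<in> topspace (power_topology n)"
      using openin_subset[OF openin_near_ball[of x n 1]] near_refl[of 1 x] by auto
  qed
  show "topspace (power_topology n) \<subseteq> {x :: 'a list. length x = n}"
    unfolding power_topology_def topology_generated_by_topspace by (auto simp: open_box_def)
qed

text \<open>The balls of the maximum norm with radii in the field are neighbourhood bases. This
  turns openness, and below continuity, into epsilon-delta statements within reach of definability
  arguments.\<close>

lemma openin_subtopology_near:
  assumes X: "X \<subseteq> {x. length x = n}"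
  shows "openin (subtopology (power_topology n) X) W \<longleftrightarrow>
    W \<subseteq> X \<and> (\<forall>x\<in>W. \<exists>\<epsilon>>0. \<forall>y\<in>X. near \<epsilon> x y \<longrightarrow> y \<in> W)"
proof
  assume "openin (subtopology (power_topology n) X) W"
  then obtain T where T: "openin (power_topology n) T" "W = T \<inter> X"
    unfolding openin_subtopology by blast
  have "\<exists>\<epsilon>>0. \<forall>y\<in>X. near \<epsilon> x y \<longrightarrow> y \<in> W" if "x \<in> W" for x
  proof -
    from that T(2) have "x \<in> T" by simp
    from openin_power_topology_near[OF T(1) this] T(2) show ?thesis by auto
  qed
  with T(2) show "W \<subseteq> X \<and> (\<forall>x\<in>W. \<exists>\<epsilon>>0. \<forall>y\<in>X. near \<epsilon> x y \<longrightarrow> y \<in> W)"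
    by simp
next
  assume W: "W \<subseteq> X \<and> (\<forall>x\<in>W. \<exists>\<epsilon>>0. \<forall>y\<in>X. near \<epsilon> x y \<longrightarrow> y \<in> W)"
  define T where "T = \<Union>{{y. near \<epsilon> x y} | x \<epsilon>. x \<in> W \<and> (\<forall>y\<in>X. near \<epsilon> x y \<longrightarrow> y \<in> W)}"
  have "openin (power_topology n) T"
    unfolding T_def using W X by (intro openin_Union) (auto intro: openin_near_ball)
  moreover have "W = T \<inter> X"
  proof (intro equalityI subsetI)
    fix x assume x: "x \<in> W"
    with W obtain \<epsilon> where "\<epsilon> > 0" "\<forall>y\<in>X. near \<epsilon> x y \<longrightarrow> y \<in> W" by blast
    with x near_refl[of \<epsilon> x] have "x \<in> T" unfolding T_def by blast
    with x W show "x \<in> T \<inter> X" by blast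
  qed (auto simp: T_def)
  ultimately show "openin (subtopology (power_topology n) X) W"
    unfolding openin_subtopology by blast
qed

definition cont_on :: "'a::linordered_field list set \<Rightarrow> ('a list \<Rightarrow> 'a list) \<Rightarrow> bool" where
  "cont_on X f \<longleftrightarrow> (\<forall>x\<in>X. \<forall>\<epsilon>>0. \<exists>\<delta>>0. \<forall>y\<in>X. near \<delta> x y \<longrightarrow> near \<epsilon> (f x) (f y))"

lemma continuous_map_power_topology:
  assumes X: "X \<subseteq> {x. length x = m}" and Y: "Y \<subseteq> {y. length y = n}"
  shows "continuous_map (subtopology (power_topology m) X) (subtopology (power_topology n) Y) f
    \<longleftrightarrow> f \<in> X \<rightarrow> Y \<and> cont_on X f"
proof -
  have top: "topspace (subtopology (power_topology m) X) = X" "topspace (subtopology (power_topology n) Y) = Y"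
    using X Y by (auto simp: topspace_power_topology)
  show ?thesis
  proof
    assume L: "continuous_map (subtopology (power_topology m) X) (subtopology (power_topology n) Y) f"
    then have fXY: "f \<in> X \<rightarrow> Y" unfolding continuous_map_def top by blast
    have "cont_on X f" unfolding cont_on_def
    proof (intro ballI allI impI)
      fix x \<epsilon> assume x: "x \<in> X" and e: "(0::'a) < \<epsilon>"
      have "length (f x) = n" using x fXY Y by auto
      then have "openin (subtopology (power_topology n) Y) (Y \<inter> {y. near \<epsilon> (f x) y})"
        by (intro openin_subtopology_Int2 openin_near_ball)
      then have "openin (subtopology (power_topology m) X) {z \<in> X. f z \<in> Y \<inter> {y. near \<epsilon> (f x) y}}"
        using L unfolding continuous_map_def top by blast
      then have o: "\<forall>z\<in>{z \<in> X. f z \<in> Y \<inter> {y. near \<epsilon> (f x) y}}. \<exists>\<delta>>0. \<forall>y\<in>X. near \<delta> z y \<longrightarrow>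
          y \<in> {z \<in> X. f z \<in> Y \<inter> {y. near \<epsilon> (f x) y}}"
        unfolding openin_subtopology_near[OF X] by blast
      have "x \<in> {z \<in> X. f z \<in> Y \<inter> {y. near \<epsilon> (f x) y}}" using x fXY near_refl[OF e] by auto
      from bspec[OF o this] show "\<exists>\<delta>>0. \<forall>y\<in>X. near \<delta> x y \<longrightarrow> near \<epsilon> (f x) (f y)" by blast
    qed
    with fXY show "f \<in> X \<rightarrow> Y \<and> cont_on X f" by blast
  next
    assume R: "f \<in> X \<rightarrow> Y \<and> cont_on X f"
    show "continuous_map (subtopology (power_topology m) X) (subtopology (power_topology n) Y) f"
      unfolding continuous_map_def top
    proof (intro conjI allI impI)
      show "f \<in> X \<rightarrow> Y" using R by blast
      fix V assume "openin (subtopology (power_topology n) Y) V"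
      then have V: "V \<subseteq> Y" "\<And>y. y \<in> V \<Longrightarrow> \<exists>\<epsilon>>0. \<forall>z\<in>Y. near \<epsilon> y z \<longrightarrow> z \<in> V"
        unfolding openin_subtopology_near[OF Y] by blast+
      show "openin (subtopology (power_topology m) X) {x \<in> X. f x \<in> V}"
        unfolding openin_subtopology_near[OF X]
      proof (intro conjI ballI)
        fix x assume "x \<in> {x \<in> X. f x \<in> V}"
        then have x: "x \<in> X" "f x \<in> V" by auto
        obtain \<epsilon> where e: "\<epsilon> > 0" "\<forall>z\<in>Y. near \<epsilon> (f x) z \<longrightarrow> z \<in> V" using V(2)[OF x(2)] by blast
        obtain \<delta> where "\<delta> > 0" "\<forall>y\<in>X. near \<delta> x y \<longrightarrow> near \<epsilon> (f x) (f y)"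
          using R x(1) e(1) unfolding cont_on_def by blast
        then show "\<exists>\<delta>>0. \<forall>y\<in>X. near \<delta> x y \<longrightarrow> y \<in> {x \<in> X. f x \<in> V}"
          using e(2) R by blast
      qed blast
    qed
  qed
qed

lemma definable_continuous_map_iff:
  "definable_continuous_map M m n X Y f \<longleftrightarrow> definable M m X \<and> definable M n Y \<and> f \<in> X \<rightarrow> Y \<and>
     definable M (m + n) {x @ f x | x. x \<in> X} \<and> cont_on X f"
proof (cases "definable M m X \<and> definable M n Y")
  case True
  then have "X \<subseteq> {x. length x = m}" "Y \<subseteq> {y. length y = n}" using definable_length by blast+
  from continuous_map_power_topology[OF this] show ?thesis
    unfolding definable_continuous_map_def definable_map_def by blast
qed (auto simp: definable_continuous_map_def definable_map_def)

lemma cont_on_subset: "cont_on X f \<Longrightarrow> Y \<subseteq> X \<Longrightarrow> cont_on Y f"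
  unfolding cont_on_def by (meson subsetD)

lemma cont_on_compose:
  assumes "cont_on X g" "g \<in> X \<rightarrow> Y" "cont_on Y f" shows "cont_on X (\<lambda>x. f (g x))"
  unfolding cont_on_def
proof (intro ballI allI impI)
  fix x \<epsilon> assume x: "x \<in> X" and "(0::'a) < \<epsilon>"
  then obtain \<delta> where d: "\<delta> > 0" "\<forall>y\<in>Y. near \<delta> (g x) y \<longrightarrow> near \<epsilon> (f (g x)) (f y)"
    using assms(2,3) unfolding cont_on_def by blast
  then obtain \<eta> where "\<eta> > 0" "\<forall>y\<in>X. near \<eta> x y \<longrightarrow> near \<delta> (g x) (g y)"
    using assms(1) x unfolding cont_on_def by blast
  with d show "\<exists>\<delta>>0. \<forall>y\<in>X. near \<delta> x y \<longrightarrow> near \<epsilon> (f (g x)) (f (g y))"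
    using assms(2) by blast
qed

lemma cont_on_append:
  assumes "cont_on X f" "cont_on X g" shows "cont_on X (\<lambda>x. f x @ g x)"
  unfolding cont_on_def
proof (intro ballI allI impI)
  fix x \<epsilon> assume x: "x \<in> X" and e: "(0::'a) < \<epsilon>"
  obtain \<delta> where d: "\<delta> > 0" "\<forall>y\<in>X. near \<delta> x y \<longrightarrow> near \<epsilon> (f x) (f y)"
    using assms(1) x e unfolding cont_on_def by blast
  obtain \<eta> where h: "\<eta> > 0" "\<forall>y\<in>X. near \<eta> x y \<longrightarrow> near \<epsilon> (g x) (g y)"
    using assms(2) x e unfolding cont_on_def by blast
  show "\<exists>\<delta>>0. \<forall>y\<in>X. near \<delta> x y \<longrightarrow> near \<epsilon> (f x @ g x) (f y @ g y)"
  proof (intro exI[of _ "min \<delta> \<eta>"] conjI ballI impI)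
    fix y assume y: "y \<in> X" "near (min \<delta> \<eta>) x y"
    then have "near \<epsilon> (f x) (f y)" "near \<epsilon> (g x) (g y)"
      using d(2) h(2) unfolding near_min by auto
    then show "near \<epsilon> (f x @ g x) (f y @ g y)" using near_append near_length by metis
  qed (use d h in auto)
qed

lemma cont_on_id: "cont_on X (\<lambda>x. x)"
  unfolding cont_on_def by blast

lemma cont_on_butlast: "[] \<notin> X \<Longrightarrow> cont_on X butlast"
  unfolding cont_on_def using near_butlast_last(1) by blast

text \<open>Scalars are wrapped as lists of length one, so that the rules for \<open>cont_on\<close>
  apply to them.\<close>

definition cont_fun :: "'a::linordered_field list set \<Rightarrow> ('a list \<Rightarrow> 'a) \<Rightarrow> bool" where
  "cont_fun X s \<longleftrightarrow> cont_on X (\<lambda>x. [s x])"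

lemma cont_funI:
  assumes "\<And>x \<epsilon>. x \<in> X \<Longrightarrow> 0 < \<epsilon> \<Longrightarrow> \<exists>\<delta>>0. \<forall>y\<in>X. near \<delta> x y \<longrightarrow> \<bar>s x - s y\<bar> < \<epsilon>"
  shows "cont_fun X s"
  using assms unfolding cont_fun_def cont_on_def by simp

lemma cont_funD:
  assumes "cont_fun X s" "x \<in> X" "0 < \<epsilon>"
  shows "\<exists>\<delta>>0. \<forall>y\<in>X. near \<delta> x y \<longrightarrow> \<bar>s x - s y\<bar> < \<epsilon>"
  using assms unfolding cont_fun_def cont_on_def by simp

lemma cont_funD2:
  assumes "cont_fun X s" "cont_fun X t" "x \<in> X" "0 < \<epsilon>"
  shows "\<exists>\<delta>>0. \<forall>y\<in>X. near \<delta> x y \<longrightarrow> \<bar>s x - s y\<bar> < \<epsilon> \<and> \<bar>t x - t y\<bar> < \<epsilon>"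
proof -
  obtain \<delta> where d: "\<delta> > 0" "\<forall>y\<in>X. near \<delta> x y \<longrightarrow> \<bar>s x - s y\<bar> < \<epsilon>"
    using cont_funD[OF assms(1,3,4)] by blast
  obtain \<eta> where h: "\<eta> > 0" "\<forall>y\<in>X. near \<eta> x y \<longrightarrow> \<bar>t x - t y\<bar> < \<epsilon>"
    using cont_funD[OF assms(2,3,4)] by blast
  from d h show ?thesis
    by (intro exI[of _ "min \<delta> \<eta>"]) (auto simp: near_min)
qed

lemma cont_fun_compose: "cont_on X g \<Longrightarrow> g \<in> X \<rightarrow> Y \<Longrightarrow> cont_fun Y s \<Longrightarrow> cont_fun X (\<lambda>x. s (g x))"
  unfolding cont_fun_def by (rule cont_on_compose)

lemma cont_fun_last: "[] \<notin> X \<Longrightarrow> cont_fun X last"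
  by (rule cont_funI) (use near_butlast_last(2) in blast)

lemma cont_fun_const: "cont_fun X (\<lambda>x. c)"
  by (rule cont_funI) (auto intro: exI[of _ 1])

text \<open>Covers sum, difference, maximum and minimum, which change by less than
  \<open>\<epsilon>\<close> when both arguments change by less than \<open>\<epsilon> / 2\<close>.
  Division has no such uniform modulus and is treated separately.\<close>

lemma cont_fun_binary:
  fixes s t :: "'a::linordered_field list \<Rightarrow> 'a"
  assumes "cont_fun X s" "cont_fun X t"
    and F: "\<And>a b a' b' \<epsilon> :: 'a. 0 < \<epsilon> \<Longrightarrow> \<bar>a - a'\<bar> < \<epsilon> / 2 \<Longrightarrow> \<bar>b - b'\<bar> < \<epsilon> / 2 \<Longrightarrow> \<bar>F a b - F a' b'\<bar> < \<epsilon>"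
  shows "cont_fun X (\<lambda>x. F (s x) (t x))"
proof (rule cont_funI)
  fix x and \<epsilon> :: 'a assume x: "x \<in> X" "0 < \<epsilon>"
  then have "0 < \<epsilon> / 2" by simp
  from cont_funD2[OF assms(1,2) x(1) this] obtain \<delta> where "\<delta> > 0"
    "\<forall>y\<in>X. near \<delta> x y \<longrightarrow> \<bar>s x - s y\<bar> < \<epsilon> / 2 \<and> \<bar>t x - t y\<bar> < \<epsilon> / 2" by blast
  with F[OF x(2)] show "\<exists>\<delta>>0. \<forall>y\<in>X. near \<delta> x y \<longrightarrow> \<bar>F (s x) (t x) - F (s y) (t y)\<bar> < \<epsilon>" by blast
qed

lemma cont_fun_add: "cont_fun X s \<Longrightarrow> cont_fun X t \<Longrightarrow> cont_fun X (\<lambda>x. s x + t x)"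
  by (rule cont_fun_binary[where F = "(+)"], assumption+, linarith)

lemma cont_fun_diff: "cont_fun X s \<Longrightarrow> cont_fun X t \<Longrightarrow> cont_fun X (\<lambda>x. s x - t x)"
  by (rule cont_fun_binary[where F = "(-)"], assumption+, linarith)

lemma cont_fun_uminus: "cont_fun X s \<Longrightarrow> cont_fun X (\<lambda>x. - s x)"
  using cont_fun_diff[OF cont_fun_const[of X 0], of s] by simp

lemma cont_fun_max: "cont_fun X s \<Longrightarrow> cont_fun X t \<Longrightarrow> cont_fun X (\<lambda>x. max (s x) (t x))"
  by (rule cont_fun_binary[where F = "max"], assumption+, linarith)

lemma cont_fun_min: "cont_fun X s \<Longrightarrow> cont_fun X t \<Longrightarrow> cont_fun X (\<lambda>x. min (s x) (t x))"
  by (rule cont_fun_binary[where F = "min"], assumption+, linarith)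

lemma cont_fun_divide:
  fixes s t :: "'a::linordered_field list \<Rightarrow> 'a"
  assumes "cont_fun X s" "cont_fun X t" and pos: "\<And>x. x \<in> X \<Longrightarrow> 0 < t x" "\<And>x. x \<in> X \<Longrightarrow> \<bar>s x\<bar> \<le> t x"
  shows "cont_fun X (\<lambda>x. s x / t x)"
proof (rule cont_funI)
  fix x \<epsilon> assume x: "x \<in> X" "0 < (\<epsilon>::'a)"
  \<comment> \<open>The first bound gives \<open>t y > t x / 2\<close>. With the second, and since
    \<open>\<bar>s x\<bar> \<le> t x\<close>, the numerator of the difference is at most
    \<open>2 * \<eta> * t x\<close>, which is below \<open>\<epsilon> * t x * t y\<close>.\<close>
  define \<eta> where "\<eta> = min (t x / 2) (\<epsilon> * t x / 8)"
  have tx: "0 < t x" using pos x by blast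
  then have \<eta>: "0 < \<eta>" "\<eta> \<le> t x / 2" "\<eta> \<le> \<epsilon> * t x / 8" using x by (auto simp: \<eta>_def)
  from cont_funD2[OF assms(1,2) x(1) \<eta>(1)] obtain \<delta> where d: "\<delta> > 0"
    "\<forall>y\<in>X. near \<delta> x y \<longrightarrow> \<bar>s x - s y\<bar> < \<eta> \<and> \<bar>t x - t y\<bar> < \<eta>" by blast
  have "\<bar>s x / t x - s y / t y\<bar> < \<epsilon>" if "y \<in> X" "near \<delta> x y" for y
  proof -
    have y: "\<bar>s x - s y\<bar> < \<eta>" "\<bar>t x - t y\<bar> < \<eta>" "0 < t y" using d that pos by auto
    have ty: "t x / 2 < t y" using y(2) \<eta>(2) by (simp add: abs_less_iff)
    have "s x / t x - s y / t y = ((s x - s y) * t x - s x * (t x - t y)) / (t x * t y)"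
      using tx y(3) by (simp add: field_simps)
    moreover have "\<bar>(s x - s y) * t x - s x * (t x - t y)\<bar> \<le> \<bar>s x - s y\<bar> * t x + \<bar>s x\<bar> * \<bar>t x - t y\<bar>"
      using abs_triangle_ineq4[of "(s x - s y) * t x" "s x * (t x - t y)"] tx by (simp add: abs_mult)
    moreover have "\<bar>s x - s y\<bar> * t x + \<bar>s x\<bar> * \<bar>t x - t y\<bar> \<le> \<eta> * t x + t x * \<eta>"
      using y tx pos(2)[OF x(1)] by (intro add_mono mult_mono) auto
    moreover have "\<eta> * t x + t x * \<eta> < \<epsilon> * (t x * t y)"
    proof -
      have "\<eta> * t x + t x * \<eta> \<le> (\<epsilon> * t x / 8) * t x + t x * (\<epsilon> * t x / 8)"
        using \<eta> tx by (intro add_mono mult_mono) auto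
      also have "\<dots> = \<epsilon> * t x * (t x / 4)" by (simp add: field_simps)
      also have "\<dots> < \<epsilon> * t x * t y" using ty tx x(2) by (intro mult_strict_left_mono) auto
      finally show ?thesis by (simp add: mult.assoc)
    qed
    ultimately have "\<bar>(s x - s y) * t x - s x * (t x - t y)\<bar> < \<epsilon> * (t x * t y)"
      and "s x / t x - s y / t y = ((s x - s y) * t x - s x * (t x - t y)) / (t x * t y)"
      by linarith+
    moreover have "0 < t x * t y" using tx y(3) by simp
    ultimately show ?thesis
      by (simp only: abs_divide abs_of_pos divide_less_eq if_True)
  qed
  with d(1) show "\<exists>\<delta>>0. \<forall>y\<in>X. near \<delta> x y \<longrightarrow> \<bar>s x / t x - s y / t y\<bar> < \<epsilon>" by blast
qed

lemma cont_fun_openin: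
  assumes "X \<subseteq> {x. length x = n}" "cont_fun X s"
  shows "openin (subtopology (power_topology n) X) {x \<in> X. s x < c}"
  unfolding openin_subtopology_near[OF assms(1)]
proof (intro conjI ballI)
  fix x assume "x \<in> {x \<in> X. s x < c}"
  then have x: "x \<in> X" "0 < c - s x" by auto
  then obtain \<delta> where "\<delta> > 0" "\<forall>y\<in>X. near \<delta> x y \<longrightarrow> \<bar>s x - s y\<bar> < c - s x"
    using cont_funD[OF assms(2)] by blast
  then show "\<exists>\<delta>>0. \<forall>y\<in>X. near \<delta> x y \<longrightarrow> y \<in> {x \<in> X. s x < c}"
    by (intro exI[of _ \<delta>]) (auto simp: abs_less_iff)
qed blast

section \<open>Distance to a definable set\<close>

text \<open>Distance to \<open>A\<close> in the maximum norm, cut off at 1 so that the supremum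
  exists also for empty \<open>A\<close>.\<close>

definition set_dist :: "'a::linordered_field list set \<Rightarrow> 'a list \<Rightarrow> 'a" where
  "set_dist A z = lub {\<epsilon>. \<epsilon> \<in> {0..1} \<and> (\<forall>a\<in>A. \<not> near \<epsilon> z a)}"

lemma set_dist_is_lub:
  fixes M :: "('a::linordered_field, 'f, 'r) expansion"
  assumes om: "o_minimal M" and A: "definable M (Suc n) A"
  shows "is_lub {\<epsilon>. \<epsilon> \<in> {0..1} \<and> (\<forall>a\<in>A. \<not> near \<epsilon> z a)} (set_dist A z)"
  unfolding set_dist_def
proof (rule definable_lub[OF om])
  show "dfn M (\<lambda>v. v 0 \<in> {0..1} \<and> (\<forall>a\<in>A. \<not> near (v 0) z a))"
    by (intro dfn_ball_list[OF A] dfn_intros)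
  \<comment> \<open>In a positive power no two points are near with radius 0, so 0 belongs to the
    set.\<close>
  have "\<not> near 0 z a" if "a \<in> A" for a
  proof
    assume "near 0 z a"
    moreover from this have "z \<noteq> []" using near_length[of 0 z a] definable_length[OF A that] by auto
    ultimately have "\<bar>last z - last a\<bar> < 0" by (rule near_butlast_last)
    then show False by simp
  qed
  then show "(0::'a) \<in> {0..1} \<and> (\<forall>a\<in>A. \<not> near 0 z a)" by simp
qed auto

lemma dsf_set_dist:
  fixes M :: "('a::linordered_field, 'f, 'r) expansion"
  assumes om: "o_minimal M" and A: "definable M (Suc n) A"
  shows "dsf M (Suc n) (set_dist A)"
  unfolding dsf_def set_dist_def
proof (rule dsc_lub)
  show "\<exists>s. is_lub {a. a \<in> {0..1} \<and> (\<forall>aa\<in>A. \<not> near a (map v [0..<Suc n]) aa)} s" for v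
    using set_dist_is_lub[OF om A] by blast
  show "dfn M (\<lambda>v. v 0 \<in> {0..1} \<and> (\<forall>aa\<in>A. \<not> near (v 0) (map (\<lambda>i. v (Suc i)) [0..<Suc n]) aa))"
    by (intro dfn_ball_list[OF A] dfn_intros)
qed

context
  fixes M :: "('a::linordered_field, 'f, 'r) expansion" and n A
  assumes om: "o_minimal M" and A: "definable M (Suc n) A"
begin

lemma set_dist_range: "set_dist A z \<in> {0..1}"
proof -
  note l = set_dist_is_lub[OF om A, of z]
  have "set_dist A z \<le> 1" by (rule lub_least[OF l]) auto
  moreover have "0 \<le> set_dist A z"
  proof (rule ccontr)
    assume "\<not> 0 \<le> set_dist A z"
    \<comment> \<open>The set has no negative element, so a negative bound would make it empty; a
      smaller bound would then do as well.\<close>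
    then have "\<forall>x\<in>{\<epsilon>. \<epsilon> \<in> {0..1} \<and> (\<forall>a\<in>A. \<not> near \<epsilon> z a)}. x \<le> set_dist A z - 1"
      using l unfolding is_lub_def by force
    then show False using lub_least[OF l, of "set_dist A z - 1"] by auto
  qed
  ultimately show ?thesis by simp
qed

text \<open>If the ball of radius \<open>\<epsilon>\<close> at \<open>z\<close> misses
  \<open>A\<close>, then so does the ball of radius \<open>\<epsilon> - \<delta>\<close> at
  \<open>z'\<close>.\<close>

lemma set_dist_lipschitz:
  assumes "near \<delta> z z'" "0 < \<delta>" shows "set_dist A z \<le> set_dist A z' + \<delta>"
proof (rule lub_least[OF set_dist_is_lub[OF om A, of z]])
  fix \<epsilon> assume e: "\<epsilon> \<in> {\<epsilon>. \<epsilon> \<in> {0..1} \<and> (\<forall>a\<in>A. \<not> near \<epsilon> z a)}"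
  show "\<epsilon> \<le> set_dist A z' + \<delta>"
  proof (cases "\<epsilon> \<le> \<delta>")
    case True
    then show ?thesis using set_dist_range[of z'] by (simp add: add_increasing)
  next
    case False
    have "\<not> near (\<epsilon> - \<delta>) z' a" if "a \<in> A" for a
      using near_trans[OF assms(1), of "\<epsilon> - \<delta>" a] e that by auto
    then have "\<epsilon> - \<delta> \<in> {\<epsilon>. \<epsilon> \<in> {0..1} \<and> (\<forall>a\<in>A. \<not> near \<epsilon> z' a)}"
      using e False assms(2) by (auto simp: le_diff_eq diff_le_eq intro: order_trans)
    from lub_upper[OF set_dist_is_lub[OF om A, of z'] this] show ?thesis by (simp add: algebra_simps)
  qed
qed

lemma cont_fun_set_dist: "cont_fun X (set_dist A)"
proof (rule cont_funI)
  fix x and \<epsilon> :: 'a assume e: "0 < \<epsilon>"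
  have "\<bar>set_dist A x - set_dist A y\<bar> < \<epsilon>" if "near (\<epsilon> / 2) x y" for y
    using set_dist_lipschitz[OF that] set_dist_lipschitz[OF near_sym[OF that]] e
    by (simp add: abs_less_iff field_simps)
  then show "\<exists>\<delta>>0. \<forall>y\<in>X. near \<delta> x y \<longrightarrow> \<bar>set_dist A x - set_dist A y\<bar> < \<epsilon>"
    using e by (intro exI[of _ "\<epsilon> / 2"]) simp
qed

lemma set_dist_mem: "z \<in> A \<Longrightarrow> set_dist A z = 0"
proof -
  assume z: "z \<in> A"
  have "set_dist A z \<le> 0"
  proof (rule lub_least[OF set_dist_is_lub[OF om A, of z]])
    fix \<epsilon> assume e: "\<epsilon> \<in> {\<epsilon>. \<epsilon> \<in> {0..1} \<and> (\<forall>a\<in>A. \<not> near \<epsilon> z a)}"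
    with z near_refl[of \<epsilon> z] show "\<epsilon> \<le> 0" by (auto simp: not_less[symmetric])
  qed
  with set_dist_range[of z] show ?thesis by simp
qed

lemma set_dist_pos:
  assumes "0 < \<epsilon>" "\<And>a. a \<in> A \<Longrightarrow> \<not> near \<epsilon> z a" shows "0 < set_dist A z"
proof -
  have "min \<epsilon> 1 \<in> {\<epsilon>. \<epsilon> \<in> {0..1} \<and> (\<forall>a\<in>A. \<not> near \<epsilon> z a)}"
    using assms near_mono[of "min \<epsilon> 1" z _ \<epsilon>] by auto
  from lub_upper[OF set_dist_is_lub[OF om A, of z] this] assms(1) show ?thesis
    by (simp add: min_def split: if_splits)
qed

end

section \<open>Maxima and stopping times along the fibres of a cylinder\<close>

lemma snoc_mem_cylinder [simp]: "x @ [t] \<in> cylinder X \<longleftrightarrow> x \<in> X \<and> t \<in> {0..1}"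
  unfolding cylinder_def by auto

lemma cylinder_cases:
  assumes "z \<in> cylinder X"
  obtains x t where "z = x @ [t]" "x \<in> X" "t \<in> {0..1}"
  using assms unfolding cylinder_def by blast

lemma Nil_notin_cylinder: "[] \<notin> cylinder X"
  unfolding cylinder_def by auto

lemma definable_cylinder:
  assumes "definable M m X" shows "definable M (Suc m) (cylinder X)"
proof -
  have "definable M (Suc m) {x @ [t] | x t. length x = m \<and> x \<in> X \<and> t \<in> {0..1}}"
    by (rule definable_snocI, intro dfn_intros dfn_mem[OF assms])
  moreover have "{x @ [t] | x t. length x = m \<and> x \<in> X \<and> t \<in> {0..1}} = cylinder X"
    using definable_length[OF assms] unfolding cylinder_def by blast
  ultimately show ?thesis by simp
qed

lemma cont_fun_fibre:
  assumes "cont_fun (cylinder X) q" "x \<in> X" "t \<in> {0..1}" "0 < \<epsilon>"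
  shows "\<exists>\<delta>>0. \<forall>u\<in>{0..1}. \<bar>u - t\<bar> < \<delta> \<longrightarrow> \<bar>q (x @ [t]) - q (x @ [u])\<bar> < \<epsilon>"
proof -
  have "x @ [t] \<in> cylinder X" using assms by simp
  from cont_funD[OF assms(1) this assms(4)] obtain \<delta> where d: "\<delta> > 0"
    "\<forall>y\<in>cylinder X. near \<delta> (x @ [t]) y \<longrightarrow> \<bar>q (x @ [t]) - q y\<bar> < \<epsilon>" by blast
  show ?thesis
  proof (intro exI[of _ \<delta>] conjI ballI impI)
    fix u assume u: "u \<in> {0..1}" "\<bar>u - t\<bar> < \<delta>"
    have "near \<delta> (x @ [t]) (x @ [u])"
      using u near_refl[OF d(1)] by (simp add: near_snoc abs_minus_commute)
    with d(2) u assms(2) show "\<bar>q (x @ [t]) - q (x @ [u])\<bar> < \<epsilon>" by simp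
  qed (rule d(1))
qed

text \<open>Taken as a supremum of values; \<open>fibre_max_approx\<close> replaces a point at which
  the maximum is attained.\<close>

definition fibre_max :: "('a::linordered_field list \<Rightarrow> 'a) \<Rightarrow> 'a list \<Rightarrow> 'a" where
  "fibre_max F y = lub {r. r \<in> {-1..1} \<and> (\<exists>u\<in>{0..1}. r \<le> F (y @ [u]))}"

context
  fixes M :: "('a::linordered_field, 'f, 'r) expansion" and n F
  assumes om: "o_minimal M" and F: "dsf M (Suc n) F" and bd: "\<And>w. F w \<in> {-1..1}"
begin

lemma fibre_max_is_lub:
  assumes "length y = n"
  shows "is_lub {r. r \<in> {-1..1} \<and> (\<exists>u\<in>{0..1}. r \<le> F (y @ [u]))} (fibre_max F y)"
  unfolding fibre_max_def
proof (rule definable_lub[OF om])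
  show "dfn M (\<lambda>v. v 0 \<in> {-1..1} \<and> (\<exists>u\<in>{0..1}. v 0 \<le> F (y @ [u])))"
    by (intro dfn_intros dsc_app[OF F]) (simp add: assms)
  show "- 1 \<in> {- 1..1 :: 'a} \<and> (\<exists>u\<in>{0..1}. - 1 \<le> F (y @ [u]))"
    using bd[of "y @ [0]"] by (auto intro!: bexI[of _ 0])
qed auto

lemma dsf_fibre_max: "dsf M n (fibre_max F)"
  unfolding dsf_def fibre_max_def
proof (rule dsc_lub)
  show "\<exists>s. is_lub {r. r \<in> {-1..1} \<and> (\<exists>u\<in>{0..1}. r \<le> F (map v [0..<n] @ [u]))} s" for v
    using fibre_max_is_lub[of "map v [0..<n]"] by auto
  show "dfn M (\<lambda>v. v 0 \<in> {-1..1} \<and> (\<exists>u\<in>{0..1}. v 0 \<le> F (map (\<lambda>i. v (Suc i)) [0..<n] @ [u])))"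
    by (intro dfn_intros dsc_app[OF F]) simp
qed

lemma fibre_max_upper: "length y = n \<Longrightarrow> u \<in> {0..1} \<Longrightarrow> F (y @ [u]) \<le> fibre_max F y"
  by (rule lub_upper[OF fibre_max_is_lub]) (use bd in auto)

lemma fibre_max_least:
  "length y = n \<Longrightarrow> (\<And>u. u \<in> {0..1} \<Longrightarrow> F (y @ [u]) \<le> c) \<Longrightarrow> fibre_max F y \<le> c"
  by (rule lub_least[OF fibre_max_is_lub]) (auto intro: order_trans)

lemma fibre_max_approx:
  assumes "length y = n" "c < fibre_max F y"
  shows "\<exists>u\<in>{0..1}. c < F (y @ [u])"
  using lub_approx[OF fibre_max_is_lub[OF assms(1)] assms(2)] by (auto intro: less_le_trans)

text \<open>From below, a point \<open>u\<close> with almost maximal value keeps a large value on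
  nearby fibres. From above, one radius must serve all \<open>u\<close> in [0, 1], which is
  definable compactness.\<close>

lemma cont_fun_fibre_max:
  assumes Y: "definable M n Y" and cF: "cont_fun (cylinder Y) F"
  shows "cont_fun Y (fibre_max F)"
proof (rule cont_funI)
  fix y \<epsilon> assume y: "y \<in> Y" and e: "(0::'a) < \<epsilon>"
  have len: "length z = n" if "z \<in> Y" for z using definable_length[OF Y that] .
  define c where "c = fibre_max F y"
  have e2: "0 < \<epsilon> / 2" using e by simp
  obtain u where u: "u \<in> {0..1}" "c - \<epsilon> / 2 < F (y @ [u])"
    using fibre_max_approx[OF len[OF y], of "c - \<epsilon> / 2"] e by (auto simp: c_def)
  have "y @ [u] \<in> cylinder Y" using y u by simp
  from cont_funD[OF cF this e2] obtain \<delta>1 where d1: "\<delta>1 > 0"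
    "\<forall>z\<in>cylinder Y. near \<delta>1 (y @ [u]) z \<longrightarrow> \<bar>F (y @ [u]) - F z\<bar> < \<epsilon> / 2" by blast
  have low: "c - \<epsilon> < fibre_max F z" if "z \<in> Y" "near \<delta>1 y z" for z
  proof -
    have "near \<delta>1 (y @ [u]) (z @ [u])" using that d1(1) by (simp add: near_snoc)
    then have "\<bar>F (y @ [u]) - F (z @ [u])\<bar> < \<epsilon> / 2" using d1(2) that u by simp
    then have "c - \<epsilon> < F (z @ [u])" using u(2) by linarith
    also have "\<dots> \<le> fibre_max F z" using fibre_max_upper[OF len[OF that(1)] u(1)] .
    finally show ?thesis .
  qed
  define P where "P = (\<lambda>\<delta> u. \<forall>z\<in>Y. near \<delta> y z \<longrightarrow> F (z @ [u]) < c + \<epsilon> / 2)"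
  have "\<exists>\<delta>>0. \<forall>u\<in>{0..1}. P \<delta> u"
  proof (rule definable_compact[OF om])
    show "dfn M (\<lambda>v. P (v 0) (v 1))"
      unfolding P_def by (intro dfn_ball_list[OF Y] dfn_intros dsc_app[OF F]) simp
    show "P \<delta>' u" if "\<delta>' \<le> \<delta>" "P \<delta> u" for \<delta> \<delta>' u
      using that near_mono unfolding P_def by blast
    fix t :: 'a assume t: "t \<in> {0..1}"
    then have "y @ [t] \<in> cylinder Y" using y by simp
    from cont_funD[OF cF this e2] obtain \<delta> where d: "\<delta> > 0"
      "\<forall>z\<in>cylinder Y. near \<delta> (y @ [t]) z \<longrightarrow> \<bar>F (y @ [t]) - F z\<bar> < \<epsilon> / 2" by blast
    have "P \<delta> u" if "u \<in> {0..1}" "\<bar>u - t\<bar> < \<delta>" for u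
      unfolding P_def
    proof (intro ballI impI)
      fix z assume z: "z \<in> Y" "near \<delta> y z"
      then have "near \<delta> (y @ [t]) (z @ [u])" using that by (simp add: near_snoc abs_minus_commute)
      then have "\<bar>F (y @ [t]) - F (z @ [u])\<bar> < \<epsilon> / 2" using d(2) that z by simp
      moreover have "F (y @ [t]) \<le> c" unfolding c_def by (rule fibre_max_upper[OF len[OF y] t])
      ultimately show "F (z @ [u]) < c + \<epsilon> / 2" by linarith
    qed
    with d(1) show "\<exists>\<delta>>0. \<forall>u\<in>{0..1}. \<bar>u - t\<bar> < \<delta> \<longrightarrow> P \<delta> u" by blast
  qed
  then obtain \<delta>2 where d2: "\<delta>2 > 0" "\<And>u. u \<in> {0..1} \<Longrightarrow> P \<delta>2 u" by blast
  have up: "fibre_max F z \<le> c + \<epsilon> / 2" if "z \<in> Y" "near \<delta>2 y z" for z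
    by (rule fibre_max_least[OF len[OF that(1)]]) (use d2(2) that in \<open>auto simp: P_def less_imp_le\<close>)
  show "\<exists>\<delta>>0. \<forall>z\<in>Y. near \<delta> y z \<longrightarrow> \<bar>fibre_max F y - fibre_max F z\<bar> < \<epsilon>"
  proof (intro exI[of _ "min \<delta>1 \<delta>2"] conjI ballI impI)
    show "0 < min \<delta>1 \<delta>2" using d1(1) d2(1) by simp
    fix z assume z: "z \<in> Y" "near (min \<delta>1 \<delta>2) y z"
    then have "c - \<epsilon> < fibre_max F z" "fibre_max F z \<le> c + \<epsilon> / 2"
      using low up by (auto simp: near_min)
    then show "\<bar>fibre_max F y - fibre_max F z\<bar> < \<epsilon>"
      using e e2 unfolding c_def[symmetric] by (auto simp: abs_less_iff)
  qed
qed

end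

text \<open>The last time from \<open>s x\<close> on at which the clock \<open>q\<close> is not
  positive; the default is \<open>s x\<close> itself, for a clock that is positive from the
  start.\<close>

definition stop :: "('a::linordered_field list \<Rightarrow> 'a) \<Rightarrow> ('a list \<Rightarrow> 'a) \<Rightarrow> 'a list \<Rightarrow> 'a" where
  "stop q s x = lub {t. t \<in> {s x..1} \<and> (t = s x \<or> q (x @ [t]) \<le> 0)}"

context
  fixes M :: "('a::linordered_field, 'f, 'r) expansion" and m q s X
  assumes om: "o_minimal M" and X: "definable M m X"
    and q: "dsf M (Suc m) q" and s: "dsf M m s"
    and srange: "\<And>x. length x = m \<Longrightarrow> s x \<in> {0..1}"
    and cq: "cont_fun (cylinder X) q" and cs: "cont_fun X s"
    and mono: "\<And>x t t'. x \<in> X \<Longrightarrow> t \<in> {0..1} \<Longrightarrow> t' \<in> {0..1} \<Longrightarrow> t < t' \<Longrightarrow> q (x @ [t]) < q (x @ [t'])"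
begin

lemma stop_is_lub:
  assumes "length x = m"
  shows "is_lub {t. t \<in> {s x..1} \<and> (t = s x \<or> q (x @ [t]) \<le> 0)} (stop q s x)"
  unfolding stop_def
proof (rule definable_lub[OF om])
  show "dfn M (\<lambda>v. v 0 \<in> {s x..1} \<and> (v 0 = s x \<or> q (x @ [v 0]) \<le> 0))"
    by (intro dfn_intros dsc_app[OF q]) (simp add: assms)
  show "s x \<in> {s x..1} \<and> (s x = s x \<or> q (x @ [s x]) \<le> 0)" using srange[OF assms] by auto
  show "t \<le> 1" if "t \<in> {s x..1} \<and> (t = s x \<or> q (x @ [t]) \<le> 0)" for t using that by simp
qed

lemma dsf_stop: "dsf M m (stop q s)"
  unfolding dsf_def stop_def
proof (rule dsc_lub)
  show "\<exists>l. is_lub {t. t \<in> {s (map v [0..<m])..1} \<and>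
      (t = s (map v [0..<m]) \<or> q (map v [0..<m] @ [t]) \<le> 0)} l" for v
    using stop_is_lub[of "map v [0..<m]"] by auto
  show "dfn M (\<lambda>v. v 0 \<in> {s (map (\<lambda>i. v (Suc i)) [0..<m])..1} \<and>
      (v 0 = s (map (\<lambda>i. v (Suc i)) [0..<m]) \<or> q (map (\<lambda>i. v (Suc i)) [0..<m] @ [v 0]) \<le> 0))"
    by (intro dfn_intros dsc_app[OF q] dsc_app[OF s]) simp_all
qed

lemma stop_range: "length x = m \<Longrightarrow> stop q s x \<in> {s x..1}"
  using lub_upper[OF stop_is_lub, of x "s x"] lub_least[OF stop_is_lub, of x 1] srange[of x] by auto

lemma stop_after:
  assumes "x \<in> X" "stop q s x < t" "t \<le> 1" shows "0 < q (x @ [t])"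
proof (rule ccontr)
  assume "\<not> 0 < q (x @ [t])"
  then have "t \<le> stop q s x"
    using stop_range[of x] definable_length[OF X assms(1)] assms
    by (intro lub_upper[OF stop_is_lub]) auto
  with assms(2) show False by simp
qed

lemma stop_before:
  assumes "x \<in> X" "s x \<le> t" "t < stop q s x" shows "q (x @ [t]) < 0"
proof -
  have len: "length x = m" by (rule definable_length[OF X assms(1)])
  obtain t' where t': "t' \<in> {s x..1}" "t' = s x \<or> q (x @ [t']) \<le> 0" "t < t'"
    using lub_approx[OF stop_is_lub[OF len] assms(3)] by blast
  then have "q (x @ [t']) \<le> 0" using assms(2) by auto
  moreover have "q (x @ [t]) < q (x @ [t'])"
    using mono[OF assms(1), of t t'] t' assms(2) srange[OF len] by auto
  ultimately show ?thesis by simp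
qed

text \<open>Otherwise the clock would stay negative for a while after the stop, against
  \<open>stop_after\<close>. Together with \<open>stop_nonpos\<close>: the clock reads exactly 0 at
  a stop strictly between \<open>s x\<close> and 1.\<close>

lemma stop_nonneg:
  assumes x: "x \<in> X" and "stop q s x < 1" shows "0 \<le> q (x @ [stop q s x])"
proof (rule ccontr)
  assume "\<not> ?thesis"
  then have neg: "0 < - q (x @ [stop q s x])" by simp
  have len: "length x = m" by (rule definable_length[OF X x])
  have I: "stop q s x \<in> {0..1}" using stop_range[OF len] srange[OF len] by auto
  from cont_fun_fibre[OF cq x I neg] obtain \<delta> where d: "\<delta> > 0"
    "\<forall>u\<in>{0..1}. \<bar>u - stop q s x\<bar> < \<delta> \<longrightarrow> \<bar>q (x @ [stop q s x]) - q (x @ [u])\<bar> < - q (x @ [stop q s x])" by blast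
  obtain u where u: "stop q s x < u" "u < min 1 (stop q s x + \<delta>)"
    using dense[of "stop q s x" "min 1 (stop q s x + \<delta>)"] assms(2) d(1) by auto
  then have "\<bar>q (x @ [stop q s x]) - q (x @ [u])\<bar> < - q (x @ [stop q s x])"
    using d(2) I by (auto simp: abs_less_iff)
  moreover have "0 < q (x @ [u])" using stop_after[OF x u(1)] u(2) by simp
  ultimately show False by (simp add: abs_less_iff)
qed

lemma stop_nonpos:
  assumes x: "x \<in> X" and "s x < stop q s x" shows "q (x @ [stop q s x]) \<le> 0"
proof (rule ccontr)
  assume "\<not> ?thesis"
  then have pos: "0 < q (x @ [stop q s x])" by simp
  have len: "length x = m" by (rule definable_length[OF X x])
  have I: "stop q s x \<in> {0..1}" using stop_range[OF len] srange[OF len] by auto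
  from cont_fun_fibre[OF cq x I pos] obtain \<delta> where d: "\<delta> > 0"
    "\<forall>u\<in>{0..1}. \<bar>u - stop q s x\<bar> < \<delta> \<longrightarrow> \<bar>q (x @ [stop q s x]) - q (x @ [u])\<bar> < q (x @ [stop q s x])" by blast
  obtain u where u: "max (s x) (stop q s x - \<delta>) < u" "u < stop q s x"
    using dense[of "max (s x) (stop q s x - \<delta>)" "stop q s x"] assms(2) d(1) by auto
  then have "\<bar>q (x @ [stop q s x]) - q (x @ [u])\<bar> < q (x @ [stop q s x])"
    using d(2) I srange[OF len] by (auto simp: abs_less_iff)
  moreover have "q (x @ [u]) < 0" using stop_before[OF x _ u(2)] u(1) by simp
  ultimately show False by (simp add: abs_less_iff)
qed

lemma cont_fun_section:
  assumes "t \<in> {0..1}" shows "cont_fun X (\<lambda>x. q (x @ [t]))"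
  unfolding cont_fun_def
  by (rule cont_on_compose[of X "\<lambda>x. x @ [t]" "cylinder X" "\<lambda>z. [q z]"])
    (use assms cq in \<open>auto intro!: cont_on_append cont_on_id simp: cont_fun_const[unfolded cont_fun_def] cont_fun_def\<close>)

text \<open>At a fixed time slightly after the stop the clock is strictly positive, and slightly
  before it strictly negative, by strict monotonicity. Both signs persist on nearby fibres and
  confine the stop there.\<close>

lemma cont_fun_stop: "cont_fun X (stop q s)"
proof (rule cont_funI)
  fix x \<epsilon> assume x: "x \<in> X" and e: "(0::'a) < \<epsilon>"
  have len: "length y = m" if "y \<in> X" for y using definable_length[OF X that] .
  let ?\<sigma> = "stop q s"
  have "\<exists>\<delta>>0. \<forall>y\<in>X. near \<delta> x y \<longrightarrow> ?\<sigma> y < ?\<sigma> x + \<epsilon>"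
  proof (cases "?\<sigma> x < 1")
    case False
    then have "?\<sigma> y < ?\<sigma> x + \<epsilon>" if "y \<in> X" for y
      using stop_range[OF len[OF that]] e by auto
    then show ?thesis by (intro exI[of _ 1]) auto
  next
    case True
    obtain r where r: "?\<sigma> x < r" "r < min 1 (?\<sigma> x + \<epsilon>)"
      using dense[of "?\<sigma> x" "min 1 (?\<sigma> x + \<epsilon>)"] True e by auto
    have r01: "r \<in> {0..1}" using r stop_range[OF len[OF x]] srange[OF len[OF x]] by auto
    have qr: "0 < q (x @ [r])" using stop_after[OF x r(1)] r(2) by simp
    obtain \<delta>1 where d1: "\<delta>1 > 0" "\<forall>y\<in>X. near \<delta>1 x y \<longrightarrow> \<bar>q (x @ [r]) - q (y @ [r])\<bar> < q (x @ [r])"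
      using cont_funD[OF cont_fun_section[OF r01] x qr] by blast
    have "s x < r" using r stop_range[OF len[OF x]] by auto
    then obtain \<delta>2 where d2: "\<delta>2 > 0" "\<forall>y\<in>X. near \<delta>2 x y \<longrightarrow> \<bar>s x - s y\<bar> < r - s x"
      using cont_funD[OF cs x, of "r - s x"] by auto
    have "?\<sigma> y < ?\<sigma> x + \<epsilon>" if y: "y \<in> X" "near (min \<delta>1 \<delta>2) x y" for y
    proof (rule ccontr)
      assume "\<not> ?thesis"
      then have "r < ?\<sigma> y" using r(2) by simp
      moreover have "s y \<le> r" using d2(2) y by (auto simp: near_min abs_less_iff)
      ultimately have "q (y @ [r]) < 0" by (intro stop_before[OF y(1)])
      moreover have "\<bar>q (x @ [r]) - q (y @ [r])\<bar> < q (x @ [r])" using d1(2) y by (auto simp: near_min)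
      ultimately show False by (simp add: abs_less_iff)
    qed
    then show ?thesis using d1(1) d2(1) by (intro exI[of _ "min \<delta>1 \<delta>2"]) auto
  qed
  then obtain \<delta> where d: "\<delta> > 0" "\<And>y. y \<in> X \<Longrightarrow> near \<delta> x y \<Longrightarrow> ?\<sigma> y < ?\<sigma> x + \<epsilon>" by blast
  have "\<exists>\<delta>>0. \<forall>y\<in>X. near \<delta> x y \<longrightarrow> ?\<sigma> x - \<epsilon> < ?\<sigma> y"
  \<comment> \<open>If the lower bound falls below \<open>s x\<close>, continuity of
    \<open>s\<close> suffices, as the stop never precedes \<open>s\<close>.\<close>
  proof (cases "?\<sigma> x - \<epsilon> < s x")
    case True
    then obtain \<delta>2 where d2: "\<delta>2 > 0" "\<forall>y\<in>X. near \<delta>2 x y \<longrightarrow> \<bar>s x - s y\<bar> < s x - (?\<sigma> x - \<epsilon>)"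
      using cont_funD[OF cs x, of "s x - (?\<sigma> x - \<epsilon>)"] by auto
    have "?\<sigma> x - \<epsilon> < ?\<sigma> y" if "y \<in> X" "near \<delta>2 x y" for y
      using d2(2) that stop_range[OF len[OF that(1)]] by (auto simp: abs_less_iff)
    with d2(1) show ?thesis by blast
  next
    case False
    obtain r where r: "?\<sigma> x - \<epsilon> < r" "r < ?\<sigma> x"
      using dense[of "?\<sigma> x - \<epsilon>" "?\<sigma> x"] e by auto
    have r01: "r \<in> {0..1}" using r False stop_range[OF len[OF x]] srange[OF len[OF x]] by auto
    have sr: "s x < r" using r False by simp
    have qr: "0 < - q (x @ [r])" using stop_before[OF x _ r(2)] sr by simp
    obtain \<delta>1 where d1: "\<delta>1 > 0" "\<forall>y\<in>X. near \<delta>1 x y \<longrightarrow> \<bar>q (x @ [r]) - q (y @ [r])\<bar> < - q (x @ [r])"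
      using cont_funD[OF cont_fun_section[OF r01] x qr] by blast
    have "?\<sigma> x - \<epsilon> < ?\<sigma> y" if y: "y \<in> X" "near \<delta>1 x y" for y
    proof (rule ccontr)
      assume "\<not> ?thesis"
      then have "?\<sigma> y < r" using r(1) by simp
      then have "0 < q (y @ [r])" using stop_after[OF y(1)] r01 by simp
      moreover have "\<bar>q (x @ [r]) - q (y @ [r])\<bar> < - q (x @ [r])" using d1(2) y by auto
      ultimately show False by (simp add: abs_less_iff)
    qed
    with d1(1) show ?thesis by blast
  qed
  then obtain \<eta> where h: "\<eta> > 0" "\<And>y. y \<in> X \<Longrightarrow> near \<eta> x y \<Longrightarrow> ?\<sigma> x - \<epsilon> < ?\<sigma> y" by blast
  show "\<exists>\<delta>>0. \<forall>y\<in>X. near \<delta> x y \<longrightarrow> \<bar>?\<sigma> x - ?\<sigma> y\<bar> < \<epsilon>"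
  proof (intro exI[of _ "min \<delta> \<eta>"] conjI ballI impI)
    fix y assume "y \<in> X" "near (min \<delta> \<eta>) x y"
    then show "\<bar>?\<sigma> x - ?\<sigma> y\<bar> < \<epsilon>" using d(2)[of y] h(2)[of y] by (auto simp: near_min abs_less_iff)
  qed (use d(1) h(1) in simp)
qed

end

section \<open>Extending a partial lift over one open set\<close>

lemma butlast_snoc2 [simp]: "butlast (x @ [t, u]) = x @ [t]"
  by (simp add: butlast_append)

lemma mem_graph_iff:
  assumes "definable M k R" "length z = k"
  shows "z @ y \<in> {z @ f z | z. z \<in> R} \<longleftrightarrow> z \<in> R \<and> y = f z"
proof
  assume "z @ y \<in> {z @ f z | z. z \<in> R}"
  then obtain w where w: "w \<in> R" "z @ y = w @ f w" by blast
  then have "z = w \<and> y = f w"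
    using definable_length[OF assms(1) w(1)] assms(2) append_eq_append_conv[of z w y "f w"] by simp
  with w(1) show "z \<in> R \<and> y = f z" by simp
qed blast

text \<open>The relation \<open>\<Gamma>\<close> may describe the values through other graphs, which
  is how reparametrised and piecewise maps are shown to be definable.\<close>

lemma definable_graph_snocI:
  assumes R: "definable M (Suc m) R"
    and len: "\<And>z. z \<in> R \<Longrightarrow> length (f z) = n"
    and eq: "\<And>x t y. x @ [t] \<in> R \<Longrightarrow> length x = m \<Longrightarrow> length y = n \<Longrightarrow> y = f (x @ [t]) \<longleftrightarrow> \<Gamma> x t y"
    and \<Gamma>: "dfn M (\<lambda>v. \<Gamma> (map v [0..<m]) (v m) (map (\<lambda>i. v (i + Suc m)) [0..<n]))"
  shows "definable M (Suc m + n) {z @ f z | z. z \<in> R}"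
proof (rule definableI)
  show "length z = Suc m + n" if "z \<in> {z @ f z | z. z \<in> R}" for z
    using that len definable_length[OF R] by auto
  have split: "map v [0..<Suc m + n] =
      (map v [0..<m] @ [v m]) @ map (\<lambda>i. v (i + Suc m)) [0..<n]" for v :: "nat \<Rightarrow> 'a"
  proof -
    have "map v [0..<Suc m + n] = map v [0..<Suc m] @ map v [Suc m..<Suc m + n]"
      by (subst upt_add_eq_append) auto
    also have "map v [Suc m..<Suc m + n] = map (\<lambda>i. v (i + Suc m)) [0..<n]"
      by (rule nth_equalityI) (auto simp: add.commute simp del: upt_Suc)
    finally show ?thesis by simp
  qed
  have "map v [0..<Suc m + n] \<in> {z @ f z | z. z \<in> R} \<longleftrightarrow>
      map v [0..<m] @ [v m] \<in> R \<and> \<Gamma> (map v [0..<m]) (v m) (map (\<lambda>i. v (i + Suc m)) [0..<n])" for v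
    unfolding split by (subst mem_graph_iff[OF R]) (use eq in auto)
  moreover have "dfn M (\<lambda>v. map v [0..<m] @ [v m] \<in> R \<and>
      \<Gamma> (map v [0..<m]) (v m) (map (\<lambda>i. v (i + Suc m)) [0..<n]))"
    by (intro dfn_conj dfn_mem[OF R] dfn_intros \<Gamma>)
  ultimately show "dfn M (\<lambda>v. map v [0..<Suc m + n] \<in> {z @ f z | z. z \<in> R})"
    by (simp only:)
qed

lemma definable_graphI:
  assumes R: "definable M m R"
    and len: "\<And>z. z \<in> R \<Longrightarrow> length (f z) = n"
    and eq: "\<And>x y. x \<in> R \<Longrightarrow> length y = n \<Longrightarrow> y = f x \<longleftrightarrow> \<Gamma> x y"
    and \<Gamma>: "dfn M (\<lambda>v. \<Gamma> (map v [0..<m]) (map (\<lambda>i. v (i + m)) [0..<n]))"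
  shows "definable M (m + n) {z @ f z | z. z \<in> R}"
proof (rule definableI)
  show "length z = m + n" if "z \<in> {z @ f z | z. z \<in> R}" for z
    using that len definable_length[OF R] by auto
  have split: "map v [0..<m + n] =
      map v [0..<m] @ map (\<lambda>i. v (i + m)) [0..<n]" for v :: "nat \<Rightarrow> 'a"
    by (rule nth_equalityI) (auto simp: nth_append)
  have "map v [0..<m + n] \<in> {z @ f z | z. z \<in> R} \<longleftrightarrow>
      map v [0..<m] \<in> R \<and> \<Gamma> (map v [0..<m]) (map (\<lambda>i. v (i + m)) [0..<n])" for v
    unfolding split by (subst mem_graph_iff[OF R]) (use eq in auto)
  moreover have "dfn M (\<lambda>v. map v [0..<m] \<in> R \<and>
      \<Gamma> (map v [0..<m]) (map (\<lambda>i. v (i + m)) [0..<n]))"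
    by (intro dfn_conj dfn_mem[OF R] dfn_intros \<Gamma>)
  ultimately show "dfn M (\<lambda>v. map v [0..<m + n] \<in> {z @ f z | z. z \<in> R})"
    by (simp only:)
qed

text \<open>The domain of a lift constructed up to time \<open>s x\<close> over each
  \<open>x\<close>.\<close>

definition under :: "'a::linordered_field list set \<Rightarrow> ('a list \<Rightarrow> 'a) \<Rightarrow> 'a list set" where
  "under X s = {x @ [t] | x t. x \<in> X \<and> 0 \<le> t \<and> t \<le> s x}"

lemma snoc_mem_under [simp]: "x @ [t] \<in> under X s \<longleftrightarrow> x \<in> X \<and> 0 \<le> t \<and> t \<le> s x"
  unfolding under_def by auto

lemma under_cases:
  assumes "z \<in> under X s"
  obtains x t where "z = x @ [t]" "x \<in> X" "0 \<le> t" "t \<le> s x"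
  using assms unfolding under_def by blast

lemma Nil_notin_under: "[] \<notin> under X s"
  unfolding under_def by auto

lemma definable_under:
  assumes X: "definable M m X" and s: "dsf M m s" shows "definable M (Suc m) (under X s)"
proof -
  have "definable M (Suc m) {x @ [t] | x t. length x = m \<and> x \<in> X \<and> 0 \<le> t \<and> t \<le> s x}"
    by (rule definable_snocI, intro dfn_intros dfn_mem[OF X] dsc_app[OF s]) simp
  moreover have "{x @ [t] | x t. length x = m \<and> x \<in> X \<and> 0 \<le> t \<and> t \<le> s x} = under X s"
    using definable_length[OF X] unfolding under_def by blast
  ultimately show ?thesis by simp
qed

text \<open>The clock \<open>q\<close> advances with time and with the progress of \<open>- \<gamma>\<close> towards the forbidden
  value \<open>1\<close>; being strictly increasing in time, it is stopped at a moment depending continuously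
  on the base point. Near the points where the clock cannot start, nothing has to be lifted.\<close>

lemma stopping_time_exists:
  fixes M :: "('a::linordered_field, 'f, 'r) expansion"
  assumes om: "o_minimal M" and X: "definable M m X"
    and \<gamma>: "dsf M (Suc m) \<gamma>" and c\<gamma>: "cont_fun (cylinder X) \<gamma>" and \<gamma>bd: "\<And>z. \<gamma> z \<in> {-1..1}"
    and s: "dsf M m s" and cs: "cont_fun X s" and srange: "\<And>x. length x = m \<Longrightarrow> s x \<in> {0..1}"
  shows "\<exists>s' V. dsf M m s' \<and> cont_fun X s' \<and> (\<forall>x. length x = m \<longrightarrow> s' x \<in> {s x..1}) \<and>
    V \<subseteq> X \<and> definable M m V \<and> openin (subtopology (power_topology m) X) V \<and>
    (\<forall>x\<in>V. \<forall>t\<in>{s x..s' x}. -1 < \<gamma> (x @ [t])) \<and>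
    (\<forall>x\<in>X - V. \<exists>\<delta>>0. \<forall>y\<in>X. near \<delta> x y \<longrightarrow> s' y = s y) \<and>
    (\<forall>x\<in>X. s' x = 1 \<or> s x + 1 / 4 \<le> s' x \<or> (\<exists>r\<in>{s x..s' x}. \<gamma> (x @ [r]) < 0))"
proof -
  have len: "length x = m" if "x \<in> X" for x using definable_length[OF X that] .
  have sX: "0 \<le> s x" "s x \<le> 1" if "x \<in> X" for x using srange[OF len[OF that]] by auto
  \<comment> \<open>At (x, t, u) the time \<open>u\<close> is clamped to the interval from
    \<open>s x\<close> to \<open>t\<close>. The maximum over the fixed interval [0, 1] is then the
    running maximum of \<open>- \<gamma>\<close> since \<open>s x\<close>, and its continuity in (x,
    t) follows from the lemma on fibrewise maxima.\<close>
  define F where "F = (\<lambda>w. - \<gamma> (butlast (butlast w) @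
      [max (s (butlast (butlast w))) (min (last (butlast w)) (last w))]))"
  have F_snoc: "F ((x @ [t]) @ [u]) = - \<gamma> (x @ [max (s x) (min t u)])" for x t u
    unfolding F_def by simp
  have dF: "dsf M (Suc (Suc m)) F"
    unfolding dsf_def F_def by (simp, intro dfn_intros dsc_app[OF \<gamma>] dsc_app[OF s]) simp_all
  have Fbd: "F w \<in> {-1..1}" for w
    using \<gamma>bd[of "butlast (butlast w) @ [max (s (butlast (butlast w))) (min (last (butlast w)) (last w))]"]
    unfolding F_def by auto
  define \<beta> where "\<beta> = fibre_max F"
  have d\<beta>: "dsf M (Suc m) \<beta>" unfolding \<beta>_def by (rule dsf_fibre_max[OF om dF Fbd])
  have cF: "cont_fun (cylinder (cylinder X)) F"
    unfolding F_def
  proof (rule cont_fun_uminus, rule cont_fun_compose[OF _ _ c\<gamma>])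
    have c1: "cont_on (cylinder (cylinder X)) (\<lambda>w. butlast (butlast w))"
      by (rule cont_on_compose[OF cont_on_butlast[OF Nil_notin_cylinder] _ cont_on_butlast[OF Nil_notin_cylinder[of X]]])
        (auto elim!: cylinder_cases)
    have c2: "cont_fun (cylinder (cylinder X)) (\<lambda>w. last (butlast w))"
      by (rule cont_fun_compose[OF cont_on_butlast[OF Nil_notin_cylinder] _ cont_fun_last[OF Nil_notin_cylinder[of X]]])
        (auto elim!: cylinder_cases)
    have c3: "cont_fun (cylinder (cylinder X)) (\<lambda>w. s (butlast (butlast w)))"
      by (rule cont_fun_compose[OF c1 _ cs]) (auto elim!: cylinder_cases)
    show "cont_on (cylinder (cylinder X)) (\<lambda>w. butlast (butlast w) @
        [max (s (butlast (butlast w))) (min (last (butlast w)) (last w))])"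
      by (rule cont_on_append[OF c1], fold cont_fun_def)
        (intro cont_fun_max cont_fun_min c2 c3 cont_fun_last Nil_notin_cylinder)
    show "(\<lambda>w. butlast (butlast w) @ [max (s (butlast (butlast w))) (min (last (butlast w)) (last w))])
        \<in> cylinder (cylinder X) \<rightarrow> cylinder X"
      using sX by (auto elim!: cylinder_cases simp: le_max_iff_disj min_le_iff_disj)
  qed
  have c\<beta>: "cont_fun (cylinder X) \<beta>"
    unfolding \<beta>_def by (rule cont_fun_fibre_max[OF om dF Fbd definable_cylinder[OF X] cF])
  have \<beta>_upper: "- \<gamma> (x @ [r]) \<le> \<beta> (x @ [t])" if "x \<in> X" "r \<in> {s x..t}" "r \<le> 1" for x t r
  proof -
    have "F ((x @ [t]) @ [r]) \<le> \<beta> (x @ [t])"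
      unfolding \<beta>_def by (rule fibre_max_upper[OF om dF Fbd]) (use that len sX[of x] in auto)
    moreover have "max (s x) (min t r) = r" using that by auto
    ultimately show ?thesis unfolding F_snoc by simp
  qed
  have \<beta>_approx: "\<exists>r\<in>{s x..t}. c < - \<gamma> (x @ [r])" if "x \<in> X" "c < \<beta> (x @ [t])" "s x \<le> t" for x t c
  proof -
    have "length (x @ [t]) = Suc m" using len[OF that(1)] by simp
    from fibre_max_approx[OF om dF Fbd this that(2)[unfolded \<beta>_def]]
    obtain u where "u \<in> {0..1}" "c < F ((x @ [t]) @ [u])" by blast
    then show ?thesis unfolding F_snoc using that(3) by (intro bexI[of _ "max (s x) (min t u)"]) auto
  qed
  have \<beta>_start: "\<beta> (x @ [s x]) = - \<gamma> (x @ [s x])" if "x \<in> X" for x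
  proof (rule antisym)
    show "\<beta> (x @ [s x]) \<le> - \<gamma> (x @ [s x])"
      unfolding \<beta>_def by (rule fibre_max_least[OF om dF Fbd]) (use len[OF that] in \<open>auto simp: F_snoc[simplified]\<close>)
  qed (use \<beta>_upper[of x "s x" "s x"] sX that in auto)
  have \<beta>_mono: "\<beta> (x @ [t]) \<le> \<beta> (x @ [t'])" if "x \<in> X" "0 \<le> t" "t \<le> t'" for x t t'
    unfolding \<beta>_def
  proof (rule fibre_max_least[OF om dF Fbd])
    show "length (x @ [t]) = Suc m" using len that by simp
    fix u :: 'a assume u: "u \<in> {0..1}"
    have "F ((x @ [t']) @ [min t u]) \<le> \<beta> (x @ [t'])"
      unfolding \<beta>_def by (rule fibre_max_upper[OF om dF Fbd]) (use that u len in auto)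
    moreover have "min t' (min t u) = min t u" using that by auto
    ultimately show "F ((x @ [t]) @ [u]) \<le> fibre_max F (x @ [t'])" unfolding F_snoc \<beta>_def by simp
  qed
  \<comment> \<open>Before \<open>s x\<close> the running maximum is constant, and the time term
    alone makes the clock increase, since \<open>stop\<close> requires strict monotonicity on all of
    [0, 1].\<close>
  define q where "q = (\<lambda>z. \<beta> z + (last z - s (butlast z)) - 1 / 2)"
  have q_snoc: "q (x @ [t]) = \<beta> (x @ [t]) + (t - s x) - 1 / 2" for x t unfolding q_def by simp
  have dq: "dsf M (Suc m) q"
    unfolding dsf_def q_def by (simp, intro dfn_intros dsc_app[OF d\<beta>] dsc_app[OF s]) simp_all
  have cq: "cont_fun (cylinder X) q"
    unfolding q_def
    by (intro cont_fun_diff cont_fun_add c\<beta> cont_fun_const cont_fun_last Nil_notin_cylinder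
        cont_fun_compose[OF cont_on_butlast[OF Nil_notin_cylinder] _ cs])
      (auto elim!: cylinder_cases)
  have mono: "q (x @ [t]) < q (x @ [t'])" if "x \<in> X" "t \<in> {0..1}" "t' \<in> {0..1}" "t < t'" for x t t'
    using \<beta>_mono[of x t t'] that unfolding q_snoc by auto
  define s' where "s' = stop q s"
  note stop = om X dq s srange cq cs mono
  have ds': "dsf M m s'" unfolding s'_def by (rule dsf_stop[OF stop])
  have cs': "cont_fun X s'" unfolding s'_def by (rule cont_fun_stop[OF stop])
  have s'range: "s' x \<in> {s x..1}" if "length x = m" for x
    unfolding s'_def by (rule stop_range[OF stop that])
  \<comment> \<open>A clock that runs at all reads at most 0 at its stop, and the elapsed time only
    lowers the bound for \<open>\<beta>\<close>.\<close>
  have moved: "\<beta> (x @ [s' x]) \<le> 1 / 2" if "x \<in> X" "s x < s' x" for x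
    using stop_nonpos[OF stop that(1)] that unfolding s'_def[symmetric] q_snoc by auto
  define V where "V = {x \<in> X. \<beta> (x @ [s' x]) < 1}"
  have cV: "cont_fun X (\<lambda>x. \<beta> (x @ [s' x]))"
    by (rule cont_fun_compose[OF cont_on_append[OF cont_on_id cs'[unfolded cont_fun_def]] _ c\<beta>])
      (use s'range srange len in fastforce)
  show ?thesis
  proof (intro exI[of _ s'] exI[of _ V] conjI allI impI ballI)
    show "dsf M m s'" "cont_fun X s'" by (rule ds' cs')+
    show "s' x \<in> {s x..1}" if "length x = m" for x by (rule s'range[OF that])
    show "V \<subseteq> X" unfolding V_def by blast
    show "definable M m V"
    proof (rule definableI)
      show "dfn M (\<lambda>v. map v [0..<m] \<in> V)"
        unfolding V_def mem_Collect_eq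
        by (intro dfn_intros dfn_mem[OF X] dsc_app[OF d\<beta>] dsc_app[OF ds']) simp_all
    qed (use len in \<open>auto simp: V_def\<close>)
    show "openin (subtopology (power_topology m) X) V"
      unfolding V_def by (rule cont_fun_openin[OF _ cV]) (use len in blast)
    show "-1 < \<gamma> (x @ [t])" if "x \<in> V" "t \<in> {s x..s' x}" for x t
    proof -
      have x: "x \<in> X" "\<beta> (x @ [s' x]) < 1" using that(1) by (auto simp: V_def)
      have "t \<le> 1" using that s'range[OF len[OF x(1)]] by auto
      then show ?thesis using \<beta>_upper[OF x(1) that(2)] x(2) by auto
    qed
    \<comment> \<open>Outside \<open>V\<close> the time does not advance, and
      \<open>- \<gamma>\<close> is at least 1 at the start. Over nearby points it still exceeds 1/2
      at the start, so no clock runs there either.\<close>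
    show "\<exists>\<delta>>0. \<forall>y\<in>X. near \<delta> x y \<longrightarrow> s' y = s y" if "x \<in> X - V" for x
    proof -
      have x: "x \<in> X" "1 \<le> \<beta> (x @ [s' x])" using that by (auto simp: V_def)
      have "\<not> s x < s' x" using moved[OF x(1)] x(2) by force
      then have "s' x = s x" using s'range[OF len[OF x(1)]] by auto
      then have g: "1 \<le> - \<gamma> (x @ [s x])" using x \<beta>_start by auto
      have "cont_fun X (\<lambda>x. \<gamma> (x @ [s x]))"
        by (rule cont_fun_compose[OF cont_on_append[OF cont_on_id cs[unfolded cont_fun_def]] _ c\<gamma>])
          (use sX in auto)
      from cont_funD[OF this x(1), of "1 / 2"] obtain \<delta> where d: "\<delta> > 0"
        "\<forall>y\<in>X. near \<delta> x y \<longrightarrow> \<bar>\<gamma> (x @ [s x]) - \<gamma> (y @ [s y])\<bar> < 1 / 2" by auto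
      have "s' y = s y" if y: "y \<in> X" "near \<delta> x y" for y
      proof (rule ccontr)
        assume "s' y \<noteq> s y"
        then have lt: "s y < s' y" using s'range[OF len[OF y(1)]] by auto
        have "\<bar>\<gamma> (x @ [s x]) - \<gamma> (y @ [s y])\<bar> < 1 / 2" using d(2) y by blast
        with g have "1 / 2 < - \<gamma> (y @ [s y])" by linarith
        also have "\<dots> \<le> \<beta> (y @ [s' y])" using \<beta>_upper[OF y(1), of "s y" "s' y"] lt sX[OF y(1)] by auto
        also have "\<dots> \<le> 1 / 2" by (rule moved[OF y(1) lt])
        finally show False by simp
      qed
      with d(1) show ?thesis by blast
    qed
    show "s' x = 1 \<or> s x + 1 / 4 \<le> s' x \<or> (\<exists>r\<in>{s x..s' x}. \<gamma> (x @ [r]) < 0)" if x: "x \<in> X" for x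
    proof (cases "s' x = 1 \<or> s x + 1 / 4 \<le> s' x")
      case False
      have ss: "s x \<le> s' x" "s' x < 1" using s'range[OF len[OF x]] False by auto
      then have "0 \<le> q (x @ [s' x])" using stop_nonneg[OF stop x] unfolding s'_def by simp
      \<comment> \<open>A nonnegative clock and an elapsed time below 1/4 leave a running maximum
        above 1/4.\<close>
      then have "0 < \<beta> (x @ [s' x])" using False unfolding q_snoc by auto
      from \<beta>_approx[OF x this ss(1)] show ?thesis by auto
    qed blast
  qed
qed

text \<open>Over \<open>V\<close> the part of the homotopy between \<open>s\<close> and
  \<open>s'\<close> stays in \<open>U\<close>, so the fibration over \<open>U\<close> lifts it from
  the end of the given lift. Elsewhere the homotopy may already be outside \<open>U\<close> at time
  \<open>s\<close>, but there the time does not advance.\<close>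

lemma lift_extends:
  fixes M :: "('a::linordered_field, 'f, 'r) expansion"
  assumes om: "o_minimal M" and X: "definable M m X"
    and f: "definable_continuous_map M (m + 1) b (cylinder X) B f"
    and fib: "definable_fibration M e b {x \<in> E. p x \<in> U} U p"
    and \<gamma>: "dsf M (Suc m) \<gamma>" "cont_fun (cylinder X) \<gamma>" "\<And>z. \<gamma> z \<in> {-1..1}"
    and \<gamma>U: "\<And>z. z \<in> cylinder X \<Longrightarrow> -1 < \<gamma> z \<Longrightarrow> f z \<in> U"
    and s: "dsf M m s" "cont_fun X s" "\<And>x. length x = m \<Longrightarrow> s x \<in> {0..1}"
    and h: "definable_continuous_map M (m + 1) e (under X s) E h"
    and lift: "\<And>z. z \<in> under X s \<Longrightarrow> p (h z) = f z"
  shows "\<exists>s' h'. dsf M m s' \<and> cont_fun X s' \<and> (\<forall>x. length x = m \<longrightarrow> s' x \<in> {s x..1}) \<and>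
    definable_continuous_map M (m + 1) e (under X s') E h' \<and>
    (\<forall>z\<in>under X s'. p (h' z) = f z) \<and> (\<forall>x\<in>X. h' (x @ [0]) = h (x @ [0])) \<and>
    (\<forall>x\<in>X. s' x = 1 \<or> s x + 1 / 4 \<le> s' x \<or> (\<exists>r\<in>{s x..s' x}. \<gamma> (x @ [r]) < 0))"
proof -
  have len: "length x = m" if "x \<in> X" for x using definable_length[OF X that] .
  have sX: "0 \<le> s x" "s x \<le> 1" if "x \<in> X" for x using s(3)[OF len[OF that]] by auto
  obtain s' V where s': "dsf M m s'" "cont_fun X s'" "\<And>x. length x = m \<Longrightarrow> s' x \<in> {s x..1}"
    and V: "V \<subseteq> X" "definable M m V" "openin (subtopology (power_topology m) X) V"
    and V\<gamma>: "\<And>x t. x \<in> V \<Longrightarrow> t \<in> {s x..s' x} \<Longrightarrow> -1 < \<gamma> (x @ [t])"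
    and off: "\<And>x. x \<in> X - V \<Longrightarrow> \<exists>\<delta>>0. \<forall>y\<in>X. near \<delta> x y \<longrightarrow> s' y = s y"
    and progress: "\<forall>x\<in>X. s' x = 1 \<or> s x + 1 / 4 \<le> s' x \<or> (\<exists>r\<in>{s x..s' x}. \<gamma> (x @ [r]) < 0)"
    using stopping_time_exists[OF om X \<gamma> s] by blast
  have s'X: "s x \<le> s' x" "s' x \<le> 1" if "x \<in> X" for x using s'(3)[OF len[OF that]] by auto
  have moved: "x \<in> V" if "x \<in> X" "s x < s' x" for x
  proof (rule ccontr)
    assume "x \<notin> V"
    with off[of x] that(1) obtain \<delta> where "\<delta> > 0" "\<forall>y\<in>X. near \<delta> x y \<longrightarrow> s' y = s y" by blast
    with near_refl[of \<delta> x] that show False by auto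
  qed
  note f' = f[unfolded definable_continuous_map_iff]
  note h' = h[unfolded definable_continuous_map_iff]
  note fib' = fib[unfolded definable_fibration_def definable_continuous_map_iff]
  have U: "definable M b U" and EU: "definable M e {x \<in> E. p x \<in> U}" using fib' by blast+
  have E: "definable M e E" using h' by blast
  define Gf where "Gf = {z @ f z | z. z \<in> cylinder X}"
  have Gf: "definable M (Suc m + b) Gf" using f' unfolding Gf_def by simp
  define Gh where "Gh = {z @ h z | z. z \<in> under X s}"
  have Gh: "definable M (Suc m + e) Gh" using h' unfolding Gh_def by simp
  have Gf_mem: "(x @ [t]) @ y \<in> Gf \<longleftrightarrow> x \<in> X \<and> t \<in> {0..1} \<and> y = f (x @ [t])" if "length x = m" for x t y
    unfolding Gf_def by (subst mem_graph_iff[OF definable_cylinder[OF X]]) (use that in auto)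
  have Gh_mem: "(x @ [t]) @ y \<in> Gh \<longleftrightarrow> x \<in> X \<and> 0 \<le> t \<and> t \<le> s x \<and> y = h (x @ [t])" if "length x = m" for x t y
    unfolding Gh_def by (subst mem_graph_iff[OF definable_under[OF X s(1)]]) (use that in auto)
  have fB: "length (f z) = b" if "z \<in> cylinder X" for z
    using f' that definable_length[of M b B] by auto
  have hE: "length (h z) = e" if "z \<in> under X s" for z
    using h' that definable_length[OF E] by auto
  \<comment> \<open>Time runs from \<open>s\<close> and is frozen at \<open>s'\<close>, which makes
    this part a homotopy on the whole cylinder over \<open>V\<close>.\<close>
  define F where "F z = f (butlast z @ [min (s' (butlast z)) (s (butlast z) + last z)])" for z
  define G where "G x = h (x @ [s x])" for x
  have arg: "x @ [min (s' x) (s x + t)] \<in> cylinder X" "min (s' x) (s x + t) \<in> {s x..s' x}"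
    if "x \<in> V" "0 \<le> t" for x t
    using that V(1) sX[of x] s'X[of x] by (auto simp: min_def)
  have F_dcm: "definable_continuous_map M (m + 1) b (cylinder V) U F"
    unfolding definable_continuous_map_iff
  proof (intro conjI)
    show "definable M (m + 1) (cylinder V)" using definable_cylinder[OF V(2)] by simp
    show "definable M b U" by (rule U)
    show "F \<in> cylinder V \<rightarrow> U"
    proof
      fix z assume "z \<in> cylinder V"
      then obtain x t where z: "z = x @ [t]" "x \<in> V" "t \<in> {0..1}" by (rule cylinder_cases)
      then show "F z \<in> U" unfolding F_def using \<gamma>U[OF arg(1)] V\<gamma>[OF z(2) arg(2)] by simp
    qed
    have "definable M (Suc m + b) {z @ F z | z. z \<in> cylinder V}"
    proof (rule definable_graph_snocI[OF definable_cylinder[OF V(2)]])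
      show "length (F z) = b" if "z \<in> cylinder V" for z
        using that arg(1) unfolding F_def by (auto elim!: cylinder_cases intro!: fB)
      show "y = F (x @ [t]) \<longleftrightarrow> (x @ [min (s' x) (s x + t)]) @ y \<in> Gf"
        if "x @ [t] \<in> cylinder V" "length x = m" for x t y
        using that arg(1)[of x t] unfolding Gf_mem[OF that(2)] F_def by auto
      show "dfn M (\<lambda>v. (map v [0..<m] @ [min (s' (map v [0..<m])) (s (map v [0..<m]) + v m)])
          @ map (\<lambda>i. v (i + Suc m)) [0..<b] \<in> Gf)"
        by (intro dfn_intros dfn_mem[OF Gf] dsc_app[OF s(1)] dsc_app[OF s'(1)]) simp_all
    qed
    then show "definable M (m + 1 + b) {z @ F z | z. z \<in> cylinder V}" by simp
    have cb: "cont_on (cylinder V) butlast" by (rule cont_on_butlast[OF Nil_notin_cylinder])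
    have to_X: "butlast \<in> cylinder V \<rightarrow> X" using V(1) by (auto elim!: cylinder_cases)
    have "cont_on (cylinder V) (\<lambda>z. butlast z @ [min (s' (butlast z)) (s (butlast z) + last z)])"
      by (rule cont_on_append[OF cb], fold cont_fun_def)
        (intro cont_fun_min cont_fun_add cont_fun_last Nil_notin_cylinder
          cont_fun_compose[OF cb to_X s(2)] cont_fun_compose[OF cb to_X s'(2)])
    moreover have "(\<lambda>z. butlast z @ [min (s' (butlast z)) (s (butlast z) + last z)]) \<in> cylinder V \<rightarrow> cylinder X"
    proof
      fix z assume "z \<in> cylinder V"
      then obtain x t where z: "z = x @ [t]" "x \<in> V" "t \<in> {0..1}" by (rule cylinder_cases)
      then show "butlast z @ [min (s' (butlast z)) (s (butlast z) + last z)] \<in> cylinder X"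
        using arg(1)[of x t] by simp
    qed
    ultimately show "cont_on (cylinder V) F"
      unfolding F_def[abs_def] by (rule cont_on_compose) (use f' in blast)
  qed
  have top: "x @ [s x] \<in> under X s" if "x \<in> X" for x using sX[OF that] that by simp
  have G_dcm: "definable_continuous_map M m e V {x \<in> E. p x \<in> U} G"
    unfolding definable_continuous_map_iff
  proof (intro conjI)
    show "definable M m V" "definable M e {x \<in> E. p x \<in> U}" by (rule V(2) EU)+
    show "G \<in> V \<rightarrow> {x \<in> E. p x \<in> U}"
    proof
      fix x assume x: "x \<in> V"
      then have xX: "x \<in> X" using V(1) by blast
      have "h (x @ [s x]) \<in> E" using h' top[OF xX] by blast
      moreover have "f (x @ [s x]) \<in> U"
        using \<gamma>U[of "x @ [s x]"] V\<gamma>[OF x, of "s x"] sX[OF xX] s'X[OF xX] xX by simp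
      ultimately show "G x \<in> {x \<in> E. p x \<in> U}" unfolding G_def using lift[OF top[OF xX]] by simp
    qed
    show "definable M (m + e) {x @ G x | x. x \<in> V}"
    proof (rule definable_graphI[OF V(2)])
      show "length (G x) = e" if "x \<in> V" for x
        unfolding G_def using that V(1) top by (intro hE) blast
      show "y = G x \<longleftrightarrow> (x @ [s x]) @ y \<in> Gh" if "x \<in> V" for x y
        using that V(1) top[of x] unfolding G_def by (subst Gh_mem) (auto intro: len)
      show "dfn M (\<lambda>v. (map v [0..<m] @ [s (map v [0..<m])]) @ map (\<lambda>i. v (i + m)) [0..<e] \<in> Gh)"
        by (intro dfn_intros dfn_mem[OF Gh] dsc_app[OF s(1)]) simp_all
    qed
    show "cont_on V G"
      unfolding G_def[abs_def]
    proof (rule cont_on_compose[where g = "\<lambda>x. x @ [s x]" and f = h and Y = "under X s"])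
      show "cont_on V (\<lambda>x. x @ [s x])"
        by (rule cont_on_append[OF cont_on_id], fold cont_fun_def, unfold cont_fun_def)
          (rule cont_on_subset[OF s(2)[unfolded cont_fun_def] V(1)])
      show "(\<lambda>x. x @ [s x]) \<in> V \<rightarrow> under X s" using top V(1) by blast
    qed (use h' in blast)
  qed
  have start: "p (G x) = F (x @ [0])" if "x \<in> V" for x
  proof -
    have x: "x \<in> X" using that V(1) by blast
    then have "min (s' x) (s x + 0) = s x" using s'X(1) by simp
    then show ?thesis using lift[OF top[OF x]] unfolding G_def F_def by simp
  qed
  obtain H where H: "definable_continuous_map M (m + 1) e (cylinder V) {x \<in> E. p x \<in> U} H"
    "\<And>z. z \<in> cylinder V \<Longrightarrow> p (H z) = F z" "\<And>x. x \<in> V \<Longrightarrow> H (x @ [0]) = G x"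
    using fib[unfolded definable_fibration_def, THEN conjunct2, rule_format, OF V(2) F_dcm G_dcm start]
    by blast
  note H' = H(1)[unfolded definable_continuous_map_iff]
  define GH where "GH = {z @ H z | z. z \<in> cylinder V}"
  have GH: "definable M (Suc m + e) GH" using H' unfolding GH_def by simp
  have GH_mem: "(x @ [t]) @ y \<in> GH \<longleftrightarrow> x \<in> V \<and> t \<in> {0..1} \<and> y = H (x @ [t])" if "length x = m" for x t y
    unfolding GH_def by (subst mem_graph_iff[OF definable_cylinder[OF V(2)]]) (use that in auto)
  \<comment> \<open>The shift of time is undone. Freezing leaves no trace, as only times up to
    \<open>s'\<close> are used.\<close>
  define k where "k z = (if last z \<le> s (butlast z) then h z else H (butlast z @ [last z - s (butlast z)]))" for z
  have late: "x \<in> V" "t - s x \<in> {0..1}" if "x \<in> X" "t \<le> s' x" "s x < t" for x t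
    using moved[OF that(1)] that s'X[OF that(1)] sX[OF that(1)] by auto
  have k1: "k (x @ [t]) = h (x @ [t])" if "t \<le> s x" for x t using that unfolding k_def by simp
  have k2: "k (x @ [t]) = H (x @ [t - s x])" if "s x < t" for x t using that unfolding k_def by simp
  have k_E: "k (x @ [t]) \<in> E" "p (k (x @ [t])) = f (x @ [t])" if xt: "x \<in> X" "0 \<le> t" "t \<le> s' x" for x t
  proof -
    have "k (x @ [t]) \<in> E \<and> p (k (x @ [t])) = f (x @ [t])"
    proof (cases "t \<le> s x")
      case True
      then have "x @ [t] \<in> under X s" using xt by simp
      then show ?thesis unfolding k1[OF True] using lift h' by blast
    next
      case False
      then have lt: "s x < t" by simp
      have z: "x @ [t - s x] \<in> cylinder V" using late[OF xt(1,3) lt] by simp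
      have "F (x @ [t - s x]) = f (x @ [t])" unfolding F_def using xt by simp
      with z H(2)[OF z] H' show ?thesis unfolding k2[OF lt] by auto
    qed
    then show "k (x @ [t]) \<in> E" "p (k (x @ [t])) = f (x @ [t])" by auto
  qed
  have k_cont: "cont_on (under X s') k"
    unfolding cont_on_def
  proof (intro ballI allI impI)
    fix z \<epsilon> assume "z \<in> under X s'" and e: "(0::'a) < \<epsilon>"
    then obtain x0 t0 where z: "z = x0 @ [t0]" and x0: "x0 \<in> X" and t0: "0 \<le> t0" "t0 \<le> s' x0"
      by (auto elim: under_cases)
    \<comment> \<open>The two branches are estimated separately. Off the curve
      \<open>t = s x\<close> one of them is locally absent; on the curve each is continuous by
      itself and both take the value \<open>k z\<close>.\<close>
    have away: "\<exists>\<delta>>0. \<forall>x t. x \<in> X \<longrightarrow> near \<delta> z (x @ [t]) \<longrightarrow> \<bar>s x0 - s x\<bar> < \<eta> \<and> \<bar>t0 - t\<bar> < \<eta>"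
      if \<eta>: "0 < \<eta>" for \<eta>
    proof -
      obtain \<delta> where d: "\<delta> > 0" "\<forall>y\<in>X. near \<delta> x0 y \<longrightarrow> \<bar>s x0 - s y\<bar> < \<eta>"
        using cont_funD[OF s(2) x0 \<eta>] by blast
      show ?thesis
        using d \<eta> unfolding z by (intro exI[of _ "min \<delta> \<eta>"]) (auto simp: near_snoc near_min)
    qed
    have "\<exists>\<delta>>0. \<forall>x t. x @ [t] \<in> under X s' \<longrightarrow> near \<delta> z (x @ [t]) \<longrightarrow> t \<le> s x \<longrightarrow> near \<epsilon> (k z) (h (x @ [t]))"
    proof (cases "t0 \<le> s x0")
      case True
      then have "z \<in> under X s" using z x0 t0 by simp
      then obtain \<delta> where d: "\<delta> > 0" "\<forall>y\<in>under X s. near \<delta> z y \<longrightarrow> near \<epsilon> (h z) (h y)"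
        using h' e unfolding cont_on_def by blast
      moreover have "k z = h z" using k1[OF True] z by simp
      ultimately show ?thesis by (intro exI[of _ \<delta>]) auto
    next
      case False
      define \<eta> where "\<eta> = (t0 - s x0) / 2"
      have \<eta>: "0 < \<eta>" "2 * \<eta> = (t0 - s x0)" using False by (auto simp: \<eta>_def)
      from away[OF \<eta>(1)] obtain \<delta> where d: "\<delta> > 0"
        "\<forall>x t. x \<in> X \<longrightarrow> near \<delta> z (x @ [t]) \<longrightarrow> \<bar>s x0 - s x\<bar> < \<eta> \<and> \<bar>t0 - t\<bar> < \<eta>"
        by blast
      have "\<not> t \<le> s x" if "x @ [t] \<in> under X s'" "near \<delta> z (x @ [t])" for x t
      proof -
        have "\<bar>s x0 - s x\<bar> < \<eta>" "\<bar>t0 - t\<bar> < \<eta>" using d(2) that by auto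
        then show ?thesis using \<eta>(2) by linarith
      qed
      with d(1) show ?thesis by blast
    qed
    then obtain \<delta>1 where d1: "\<delta>1 > 0" "\<And>x t. x @ [t] \<in> under X s' \<Longrightarrow> near \<delta>1 z (x @ [t]) \<Longrightarrow> t \<le> s x \<Longrightarrow>
        near \<epsilon> (k z) (h (x @ [t]))" by blast
    have "\<exists>\<delta>>0. \<forall>x t. x @ [t] \<in> under X s' \<longrightarrow> near \<delta> z (x @ [t]) \<longrightarrow> s x < t \<longrightarrow>
        near \<epsilon> (k z) (H (x @ [t - s x]))"
    proof (cases "t0 < s x0")
      case True
      define \<eta> where "\<eta> = (s x0 - t0) / 2"
      have \<eta>: "0 < \<eta>" "2 * \<eta> = (s x0 - t0)" using True by (auto simp: \<eta>_def)
      from away[OF \<eta>(1)] obtain \<delta> where d: "\<delta> > 0"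
        "\<forall>x t. x \<in> X \<longrightarrow> near \<delta> z (x @ [t]) \<longrightarrow> \<bar>s x0 - s x\<bar> < \<eta> \<and> \<bar>t0 - t\<bar> < \<eta>"
        by blast
      have "\<not> s x < t" if "x @ [t] \<in> under X s'" "near \<delta> z (x @ [t])" for x t
      proof -
        have "\<bar>s x0 - s x\<bar> < \<eta>" "\<bar>t0 - t\<bar> < \<eta>" using d(2) that by auto
        then show ?thesis using \<eta>(2) by linarith
      qed
      with d(1) show ?thesis by blast
    next
      case ge: False
      show ?thesis
      proof (cases "x0 \<in> V")
        \<comment> \<open>Near \<open>x0\<close> the times \<open>s\<close> and \<open>s'\<close>
          agree, so no point of the domain lies strictly above the curve.\<close>
        case False
        with off[of x0] x0 obtain \<delta> where d: "\<delta> > 0" "\<forall>y\<in>X. near \<delta> x0 y \<longrightarrow> s' y = s y" by blast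
        have "\<not> s x < t" if "x @ [t] \<in> under X s'" "near \<delta> z (x @ [t])" for x t
          using d(2) that unfolding z near_snoc by auto
        with d(1) show ?thesis by blast
      next
        case True
        define R where "R = {x @ [t] | x t. x \<in> V \<and> s x \<le> t \<and> t \<le> s' x}"
        have R0: "[] \<notin> R" unfolding R_def by auto
        have cb: "cont_on R butlast" by (rule cont_on_butlast[OF R0])
        have to_X: "butlast \<in> R \<rightarrow> X" using V(1) unfolding R_def by auto
        have "cont_on R (\<lambda>z. butlast z @ [last z - s (butlast z)])"
          by (rule cont_on_append[OF cb], fold cont_fun_def)
            (intro cont_fun_diff cont_fun_last R0 cont_fun_compose[OF cb to_X s(2)])
        moreover have "(\<lambda>z. butlast z @ [last z - s (butlast z)]) \<in> R \<rightarrow> cylinder V"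
        proof
          fix w assume "w \<in> R"
          then obtain x t where w: "w = x @ [t]" "x \<in> V" "s x \<le> t" "t \<le> s' x" unfolding R_def by blast
          then have "x \<in> X" using V(1) by blast
          then show "butlast w @ [last w - s (butlast w)] \<in> cylinder V" using w sX[of x] s'X[of x] by simp
        qed
        ultimately have "cont_on R (\<lambda>z. H (butlast z @ [last z - s (butlast z)]))"
          by (rule cont_on_compose) (use H' in blast)
        moreover have "z \<in> R" unfolding R_def using z True ge t0 by auto
        ultimately obtain \<delta> where d: "\<delta> > 0" "\<forall>y\<in>R. near \<delta> z y \<longrightarrow>
            near \<epsilon> (H (butlast z @ [last z - s (butlast z)])) (H (butlast y @ [last y - s (butlast y)]))"
          using e unfolding cont_on_def by blast
        have "k z = H (butlast z @ [last z - s (butlast z)])"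
        proof (cases "s x0 < t0")
          case True
          then show ?thesis using k2 z by simp
        next
          \<comment> \<open>On the curve itself \<open>H\<close> starts at \<open>G\<close>, the end
            of the old lift.\<close>
          case False
          with ge have "t0 = s x0" by simp
          then show ?thesis using z k1[of t0 x0] H(3)[OF True] unfolding G_def by simp
        qed
        moreover have "x @ [t] \<in> R" if "x @ [t] \<in> under X s'" "s x < t" for x t
          using that late[of x t] unfolding R_def by auto
        ultimately show ?thesis using d by (intro exI[of _ \<delta>]) fastforce
      qed
    qed
    then obtain \<delta>2 where d2: "\<delta>2 > 0" "\<And>x t. x @ [t] \<in> under X s' \<Longrightarrow> near \<delta>2 z (x @ [t]) \<Longrightarrow> s x < t \<Longrightarrow>
        near \<epsilon> (k z) (H (x @ [t - s x]))" by blast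
    show "\<exists>\<delta>>0. \<forall>y\<in>under X s'. near \<delta> z y \<longrightarrow> near \<epsilon> (k z) (k y)"
    proof (intro exI[of _ "min \<delta>1 \<delta>2"] conjI ballI impI)
      show "0 < min \<delta>1 \<delta>2" using d1(1) d2(1) by simp
      fix y assume y: "y \<in> under X s'" "near (min \<delta>1 \<delta>2) z y"
      then obtain x t where xt: "y = x @ [t]" by (auto elim: under_cases)
      show "near \<epsilon> (k z) (k y)"
      proof (cases "t \<le> s x")
        case True
        then show ?thesis using d1(2)[of x t] y k1[OF True] unfolding xt near_min by simp
      next
        case False
        then show ?thesis using d2(2)[of x t] y k2[of x t] unfolding xt near_min by simp
      qed
    qed
  qed
  have k_dcm: "definable_continuous_map M (m + 1) e (under X s') E k"
    unfolding definable_continuous_map_iff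
  proof (intro conjI)
    show "definable M (m + 1) (under X s')" using definable_under[OF X s'(1)] by simp
    show "definable M e E" by (rule E)
    show kE: "k \<in> under X s' \<rightarrow> E" using k_E(1) by (auto elim!: under_cases)
    have "definable M (Suc m + e) {z @ k z | z. z \<in> under X s'}"
    proof (rule definable_graph_snocI[OF definable_under[OF X s'(1)]])
      show "length (k z) = e" if "z \<in> under X s'" for z
        using kE that definable_length[OF E] by blast
      show "y = k (x @ [t]) \<longleftrightarrow> (t \<le> s x \<and> (x @ [t]) @ y \<in> Gh) \<or> (\<not> t \<le> s x \<and> (x @ [t - s x]) @ y \<in> GH)"
        if xt: "x @ [t] \<in> under X s'" "length x = m" for x t y
      proof (cases "t \<le> s x")
        case True
        then show ?thesis using xt k1[OF True] unfolding Gh_mem[OF xt(2)] by auto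
      next
        case False
        then have "s x < t" by simp
        with late[of x t] xt k2[of x t] False show ?thesis unfolding GH_mem[OF xt(2)] by auto
      qed
      show "dfn M (\<lambda>v. (v m \<le> s (map v [0..<m]) \<and>
            (map v [0..<m] @ [v m]) @ map (\<lambda>i. v (i + Suc m)) [0..<e] \<in> Gh) \<or>
          (\<not> v m \<le> s (map v [0..<m]) \<and>
            (map v [0..<m] @ [v m - s (map v [0..<m])]) @ map (\<lambda>i. v (i + Suc m)) [0..<e] \<in> GH))"
        by (intro dfn_intros dfn_mem[OF Gh] dfn_mem[OF GH] dsc_app[OF s(1)]) simp_all
    qed
    then show "definable M (m + 1 + e) {z @ k z | z. z \<in> under X s'}" by simp
  qed (rule k_cont)
  show ?thesis
  proof (intro exI[of _ s'] exI[of _ k] conjI)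
    show "dsf M m s'" "cont_fun X s'" by (rule s')+
    show "\<forall>x. length x = m \<longrightarrow> s' x \<in> {s x..1}" using s'(3) by blast
    show "definable_continuous_map M (m + 1) e (under X s') E k" by (rule k_dcm)
    show "\<forall>z\<in>under X s'. p (k z) = f z" using k_E(2) by (auto elim!: under_cases)
    show "\<forall>x\<in>X. k (x @ [0]) = h (x @ [0])" using k1 sX by blast
    show "\<forall>x\<in>X. s' x = 1 \<or> s x + 1 / 4 \<le> s' x \<or> (\<exists>r\<in>{s x..s' x}. \<gamma> (x @ [r]) < 0)"
      by (rule progress)
  qed
qed

section \<open>Gluing two open sets\<close>

text \<open>These are the boundary points, relative to [0, 1], of the set where \<open>R\<close>
  holds.\<close>

definition switch :: "('a::linordered_field \<Rightarrow> bool) \<Rightarrow> 'a \<Rightarrow> bool" where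
  "switch R t \<longleftrightarrow> t \<in> {0..1} \<and> (\<forall>\<delta>. 0 < \<delta> \<longrightarrow> (\<exists>u\<in>{0..1}. \<bar>u - t\<bar> < \<delta> \<and> (R u \<longleftrightarrow> \<not> R t)))"

lemma dfn_switch:
  assumes R: "dfn M (\<lambda>v. R (v 0))" shows "dfn M (\<lambda>v. switch R (v 0))"
  unfolding switch_def by (intro dfn_intros dfn_app1[OF R])

text \<open>No interval consists of boundary points, since \<open>R\<close> is constant just to the
  right of its left end.\<close>

lemma finite_switch:
  fixes M :: "('a::linordered_field, 'f, 'r) expansion"
  assumes om: "o_minimal M" and R: "dfn M (\<lambda>v. R (v 0))"
  shows "finite {t. switch R t}"
proof (rule ccontr)
  assume inf: "infinite {t. switch R t}"
  obtain a b where ab: "a < b" "{a<..<b} \<subseteq> {t. switch R t}"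
    using tame_infinite[OF tame_definable[OF om dfn_switch[OF R]] inf] by blast
  from tame_right[OF tame_definable[OF om R], of a] obtain c where c: "a < c"
    "(\<forall>x. a < x \<and> x < c \<longrightarrow> R x) \<or> (\<forall>x. a < x \<and> x < c \<longrightarrow> \<not> R x)" by auto
  obtain t where t: "a < t" "t < min b c" using dense[of a "min b c"] ab c by auto
  then have "switch R t" "0 < min (t - a) (c - t)" using ab(2) by auto
  then obtain u where u: "\<bar>u - t\<bar> < min (t - a) (c - t)" "R u \<longleftrightarrow> \<not> R t" unfolding switch_def by blast
  then have "a < u" "u < c" by (auto simp: abs_less_iff)
  with c(2) t u(2) show False by auto
qed

text \<open>Strictness of \<open>a < d\<close> ensures that the switch is not one already counted up
  to time \<open>a\<close>. It comes from continuity at \<open>a\<close>, where the sign is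
  strict.\<close>

lemma sign_change_switch:
  fixes M :: "('a::linordered_field, 'f, 'r) expansion" and g :: "'a \<Rightarrow> 'a"
  assumes om: "o_minimal M" and R: "dfn M (\<lambda>v. 0 < g (v 0))"
    and cont: "\<exists>\<delta>>0. \<forall>u\<in>{0..1}. \<bar>u - a\<bar> < \<delta> \<longrightarrow> \<bar>g a - g u\<bar> < - g a"
    and ab: "a \<in> {0..1}" "c \<in> {0..1}" "a \<le> c" "g a < 0" "0 < g c"
  shows "\<exists>d. a < d \<and> d \<le> c \<and> switch (\<lambda>t. 0 < g t) d"
proof -
  have "(0 < g a) \<noteq> (0 < g c)" using ab by auto
  from definable_switch[OF om R ab(3) this] obtain d where d: "d \<in> {a..c}"
    "\<forall>\<delta>>0. \<exists>u\<in>{a..c}. \<bar>u - d\<bar> < \<delta> \<and> (0 < g u) \<noteq> (0 < g d)" by blast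
  have I: "u \<in> {0..1}" if "u \<in> {a..c}" for u using that ab by auto
  have "switch (\<lambda>t. 0 < g t) d"
    unfolding switch_def
  proof (intro conjI allI impI)
    show "d \<in> {0..1}" using I d(1) by blast
    fix \<delta> :: 'a assume "0 < \<delta>"
    with d(2) obtain u where "u \<in> {a..c}" "\<bar>u - d\<bar> < \<delta>" "(0 < g u) \<noteq> (0 < g d)" by blast
    then show "\<exists>u\<in>{0..1}. \<bar>u - d\<bar> < \<delta> \<and> (0 < g u \<longleftrightarrow> \<not> 0 < g d)" using I by blast
  qed
  moreover have "d \<noteq> a"
  proof
    assume da: "d = a"
    from cont obtain \<delta> where "\<delta> > 0" and dl: "\<forall>u\<in>{0..1}. \<bar>u - a\<bar> < \<delta> \<longrightarrow> \<bar>g a - g u\<bar> < - g a" by blast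
    with d(2) da obtain u where u: "u \<in> {a..c}" "\<bar>u - a\<bar> < \<delta>" "(0 < g u) \<noteq> (0 < g a)" by blast
    with dl I have "\<bar>g a - g u\<bar> < - g a" by blast
    with u(3) ab show False by (auto simp: abs_less_iff)
  qed
  ultimately show ?thesis using d(1) by (intro exI[of _ d]) auto
qed

text \<open>Urysohn's quotient of the difference and the sum of the two distances. The sum is
  positive on \<open>Y\<close>, as no point there adheres to both sets; elsewhere a vanishing
  denominator gives 0, so the bounds hold at every list.\<close>

lemma separating_function:
  fixes M :: "('a::linordered_field, 'f, 'r) expansion"
  assumes om: "o_minimal M" and A: "definable M (Suc n) A" and C: "definable M (Suc n) C"
    and sep: "\<And>z. z \<in> Y \<Longrightarrow> (\<exists>\<epsilon>>0. \<forall>a\<in>A. \<not> near \<epsilon> z a) \<or> (\<exists>\<epsilon>>0. \<forall>a\<in>C. \<not> near \<epsilon> z a)"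
  shows "\<exists>\<gamma>. dsf M (Suc n) \<gamma> \<and> cont_fun Y \<gamma> \<and> (\<forall>z. \<gamma> z \<in> {-1..1}) \<and>
    (\<forall>z\<in>Y \<inter> A. \<gamma> z = -1) \<and> (\<forall>z\<in>Y \<inter> C. \<gamma> z = 1)"
proof -
  let ?a = "set_dist A" and ?c = "set_dist C"
  define \<gamma> where "\<gamma> z = (?a z - ?c z) / (?a z + ?c z)" for z
  have nn: "0 \<le> ?a z" "0 \<le> ?c z" for z
    using set_dist_range[OF om A, of z] set_dist_range[OF om C, of z] by auto
  have pos: "0 < ?a z + ?c z" if "z \<in> Y" for z
    using sep[OF that] set_dist_pos[OF om A, of _ z] set_dist_pos[OF om C, of _ z] nn[of z]
    by (auto intro: add_pos_nonneg add_nonneg_pos)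
  have bound: "\<bar>?a z - ?c z\<bar> \<le> ?a z + ?c z" for z using nn[of z] by (auto simp: abs_le_iff)
  show ?thesis
  proof (intro exI[of _ \<gamma>] conjI allI ballI)
    show "dsf M (Suc n) \<gamma>"
      unfolding dsf_def \<gamma>_def
      by (intro dfn_intros dsc_app[OF dsf_set_dist[OF om A]] dsc_app[OF dsf_set_dist[OF om C]]) simp_all
    show "cont_fun Y \<gamma>"
      unfolding \<gamma>_def[abs_def]
      by (intro cont_fun_divide cont_fun_diff cont_fun_add cont_fun_set_dist[OF om A] cont_fun_set_dist[OF om C])
        (use pos bound in auto)
    show "\<gamma> z \<in> {-1..1}" for z
    proof (cases "?a z + ?c z = 0")
      case False
      then have "0 < ?a z + ?c z" using nn[of z] by (simp add: less_le)
      then show ?thesis unfolding \<gamma>_def using nn[of z] by (simp add: le_divide_eq divide_le_eq)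
    qed (simp add: \<gamma>_def)
    show "\<gamma> z = -1" if "z \<in> Y \<inter> A" for z
      using that pos[of z] set_dist_mem[OF om A, of z] unfolding \<gamma>_def by (simp add: divide_eq_minus_1_iff)
    show "\<gamma> z = 1" if "z \<in> Y \<inter> C" for z
      using that pos[of z] set_dist_mem[OF om C, of z] unfolding \<gamma>_def by simp
  qed
qed

section \<open>Preimages, Boolean operations and restrictions\<close>

lemma definable_preimage:
  assumes f: "definable_continuous_map M k n Y B f" and S: "definable M n S"
  shows "definable M k {z \<in> Y. f z \<in> S}"
proof -
  note f' = f[unfolded definable_continuous_map_iff]
  define G where "G = {z @ f z | z. z \<in> Y}"
  have Y: "definable M k Y" and G: "definable M (k + n) G" using f' unfolding G_def by blast+
  have eq: "z \<in> {z \<in> Y. f z \<in> S} \<longleftrightarrow> (\<exists>y\<in>S. z @ y \<in> G)" if "length z = k" for z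
    unfolding G_def mem_graph_iff[OF Y that] by auto
  have "dfn M (\<lambda>v. \<exists>y\<in>S. map v [0..<k] @ y \<in> G)"
    by (intro dfn_bex_list[OF S] dfn_intros dfn_mem[OF G])
  then have "dfn M (\<lambda>v. map v [0..<k] \<in> {z \<in> Y. f z \<in> S})"
    by (subst eq) auto
  then show ?thesis
    by (rule definableI[rotated]) (use definable_length[OF Y] in blast)
qed

lemma definable_Diff:
  assumes "definable M n S" "definable M n T" shows "definable M n (S - T)"
proof (rule definableI)
  show "dfn M (\<lambda>v. map v [0..<n] \<in> S - T)"
    unfolding Diff_iff by (intro dfn_intros dfn_mem[OF assms(1)] dfn_mem[OF assms(2)])
qed (use definable_length[OF assms(1)] in blast)

lemma definable_Un:
  assumes "definable M n S" "definable M n T" shows "definable M n (S \<union> T)"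
proof (rule definableI)
  show "dfn M (\<lambda>v. map v [0..<n] \<in> S \<union> T)"
    unfolding Un_iff by (intro dfn_intros dfn_mem[OF assms(1)] dfn_mem[OF assms(2)])
qed (use definable_length[OF assms(1)] definable_length[OF assms(2)] in blast)

lemma definable_empty: "definable M n {}"
  by (rule definableI) (auto simp: dfn_const)

lemma definable_continuous_map_restrict:
  assumes f: "definable_continuous_map M k n Y B f" and Z: "definable M k Z" "Z \<subseteq> Y"
    and C: "definable M n C" "f \<in> Z \<rightarrow> C"
  shows "definable_continuous_map M k n Z C f"
  unfolding definable_continuous_map_iff
proof (intro conjI)
  note f' = f[unfolded definable_continuous_map_iff]
  define G where "G = {z @ f z | z. z \<in> Y}"
  have Y: "definable M k Y" and G: "definable M (k + n) G" using f' unfolding G_def by blast+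
  show "definable M k Z" "definable M n C" "f \<in> Z \<rightarrow> C" by (rule Z C)+
  show "cont_on Z f" using f' Z(2) cont_on_subset by blast
  show "definable M (k + n) {x @ f x | x. x \<in> Z}"
  proof (rule definable_graphI[OF Z(1)])
    show "length (f z) = n" if "z \<in> Z" for z using that C definable_length[OF C(1)] by blast
    show "y = f x \<longleftrightarrow> x @ y \<in> G" if "x \<in> Z" for x y
      unfolding G_def mem_graph_iff[OF Y definable_length[OF Z(1) that]] using that Z(2) by auto
    show "dfn M (\<lambda>v. map v [0..<k] @ map (\<lambda>i. v (i + k)) [0..<n] \<in> G)"
      by (intro dfn_intros dfn_mem[OF G])
  qed
qed

lemma preimage_not_near:
  assumes f: "definable_continuous_map M k n Y B f"
    and U: "openin (subtopology (power_topology n) B) U" and z: "z \<in> Y" "f z \<in> U"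
  shows "\<exists>\<epsilon>>0. \<forall>a\<in>{z \<in> Y. f z \<in> B - U}. \<not> near \<epsilon> z a"
proof -
  note f' = f[unfolded definable_continuous_map_iff]
  have B: "B \<subseteq> {y. length y = n}" using f' definable_length by blast
  obtain \<epsilon> where e: "\<epsilon> > 0" "\<forall>y\<in>B. near \<epsilon> (f z) y \<longrightarrow> y \<in> U"
    using U z(2) unfolding openin_subtopology_near[OF B] by blast
  obtain \<delta> where d: "\<delta> > 0" "\<forall>y\<in>Y. near \<delta> z y \<longrightarrow> near \<epsilon> (f z) (f y)"
    using f' z(1) e(1) unfolding cont_on_def by blast
  from d(1) show ?thesis using d(2) e(2) by blast
qed

theorem definable_fibration_Un:
  fixes M :: "('a::linordered_field, 'f, 'r) expansion"
  assumes om: "o_minimal M" and p: "definable_continuous_map M e b E B p"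
    and UV: "B = U \<union> V"
    and oU: "openin (subtopology (power_topology b) B) U"
    and oV: "openin (subtopology (power_topology b) B) V"
    and fU: "definable_fibration M e b {x \<in> E. p x \<in> U} U p"
    and fV: "definable_fibration M e b {x \<in> E. p x \<in> V} V p"
  shows "definable_fibration M e b E B p"
  unfolding definable_fibration_def
proof (intro conjI allI impI p)
  fix m X f g
  assume X: "definable M m X" and f: "definable_continuous_map M (m + 1) b (cylinder X) B f"
    and g: "definable_continuous_map M m e X E g" and pg: "\<forall>x\<in>X. p (g x) = f (x @ [0])"
  have dU: "definable M b U" and dV: "definable M b V"
    using fU fV unfolding definable_fibration_def definable_continuous_map_iff by blast+
  have dB: "definable M b B" and E: "definable M e E"
    using p unfolding definable_continuous_map_iff by blast+
  have len: "length x = m" if "x \<in> X" for x using definable_length[OF X that] .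
  have fB: "f z \<in> B" if "z \<in> cylinder X" for z
    using f that unfolding definable_continuous_map_iff by blast
  \<comment> \<open>No point of the cylinder adheres both to \<open>A\<close> and to
    \<open>C\<close>, because \<open>U\<close> and \<open>V\<close> are open and cover
    \<open>B\<close>.\<close>
  define A where "A = {z \<in> cylinder X. f z \<in> B - U}"
  define C where "C = {z \<in> cylinder X. f z \<in> B - V}"
  have A: "definable M (Suc m) A" and C: "definable M (Suc m) C"
    using definable_preimage[OF f definable_Diff[OF dB dU]] definable_preimage[OF f definable_Diff[OF dB dV]]
    unfolding A_def C_def by simp_all
  have sep: "(\<exists>\<epsilon>>0. \<forall>a\<in>A. \<not> near \<epsilon> z a) \<or> (\<exists>\<epsilon>>0. \<forall>a\<in>C. \<not> near \<epsilon> z a)" if "z \<in> cylinder X" for z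
    using preimage_not_near[OF f oU that] preimage_not_near[OF f oV that] fB[OF that] UV
    unfolding A_def C_def by blast
  have "\<exists>\<gamma>. dsf M (Suc m) \<gamma> \<and> cont_fun (cylinder X) \<gamma> \<and> (\<forall>z. \<gamma> z \<in> {-1..1}) \<and>
      (\<forall>z\<in>cylinder X \<inter> A. \<gamma> z = -1) \<and> (\<forall>z\<in>cylinder X \<inter> C. \<gamma> z = 1)"
    by (rule separating_function[OF om A C sep])
  then obtain \<gamma> where \<gamma>': "dsf M (Suc m) \<gamma>"
    "cont_fun (cylinder X) \<gamma>" "\<forall>z. \<gamma> z \<in> {-1..1}"
    "\<forall>z\<in>cylinder X \<inter> A. \<gamma> z = -1" "\<forall>z\<in>cylinder X \<inter> C. \<gamma> z = 1"
    by (elim exE conjE)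
  have \<gamma>: "dsf M (Suc m) \<gamma>" "cont_fun (cylinder X) \<gamma>" "\<And>z. \<gamma> z \<in> {-1..1}"
    "\<And>z. z \<in> cylinder X \<Longrightarrow> z \<in> A \<Longrightarrow> \<gamma> z = -1" "\<And>z. z \<in> cylinder X \<Longrightarrow> z \<in> C \<Longrightarrow> \<gamma> z = 1"
    using \<gamma>' by blast+
  have \<gamma>U: "f z \<in> U" if "z \<in> cylinder X" "-1 < \<gamma> z" for z
    using \<gamma>(4)[OF that(1)] that fB[OF that(1)] unfolding A_def by auto
  have \<gamma>V: "f z \<in> V" if "z \<in> cylinder X" "-1 < - \<gamma> z" for z
    using \<gamma>(5)[OF that(1)] that fB[OF that(1)] unfolding C_def by auto
  have m\<gamma>: "dsf M (Suc m) (\<lambda>z. - \<gamma> z)" "cont_fun (cylinder X) (\<lambda>z. - \<gamma> z)" "\<And>z. - \<gamma> z \<in> {-1..1}"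
    using \<gamma>(1)[unfolded dsf_def, THEN dsc_minus] \<gamma>(2)[THEN cont_fun_uminus] \<gamma>(3)
    by (auto simp: dsf_def minus_le_iff)
  define D where "D = (\<lambda>x. switch (\<lambda>t. 0 < \<gamma> (x @ [t])))"
  have d\<gamma>: "dfn M (\<lambda>v. 0 < \<gamma> (x @ [v 0]))" if "length x = m" for x
    by (intro dfn_intros dsc_app[OF \<gamma>(1)]) (simp add: that)
  have finD: "finite {t. D x t}" if "length x = m" for x
    unfolding D_def by (rule finite_switch[OF om d\<gamma>[OF that]])
  have "dfn M (\<lambda>v. D (map v [0..<m]) (v m))"
    unfolding D_def switch_def by (intro dfn_intros dsc_app[OF \<gamma>(1)]) simp_all
  from uniformly_finiteD[OF uniform_finiteness[OF om] this finD] obtain N where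
    N: "\<And>x. length x = m \<Longrightarrow> card {t. D x t} \<le> N" by blast
  define good where "good = (\<lambda>s h. dsf M m s \<and> cont_fun X s \<and> (\<forall>x. length x = m \<longrightarrow> s x \<in> {0..1}) \<and>
    definable_continuous_map M (m + 1) e (under X s) E h \<and>
    (\<forall>z\<in>under X s. p (h z) = f z) \<and> (\<forall>x\<in>X. h (x @ [0]) = g x))"
  \<comment> \<open>Used with \<open>\<gamma>\<close> for \<open>U\<close> and with
    \<open>- \<gamma>\<close> for \<open>V\<close>.\<close>
  have step: "\<exists>s' h'. good s' h' \<and> (\<forall>x\<in>X. s x \<le> s' x) \<and>
      (\<forall>x\<in>X. s' x = 1 \<or> s x + 1 / 4 \<le> s' x \<or> (\<exists>r\<in>{s x..s' x}. \<zeta> (x @ [r]) < 0))"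
    if gd: "good s h" and fib: "definable_fibration M e b {x \<in> E. p x \<in> W} W p"
      and \<zeta>: "dsf M (Suc m) \<zeta>" "cont_fun (cylinder X) \<zeta>" "\<And>z. \<zeta> z \<in> {-1..1}"
      "\<And>z. z \<in> cylinder X \<Longrightarrow> -1 < \<zeta> z \<Longrightarrow> f z \<in> W" for s h \<zeta> W
  proof -
    have s: "dsf M m s" "cont_fun X s" "\<And>x. length x = m \<Longrightarrow> s x \<in> {0..1}"
      and h: "definable_continuous_map M (m + 1) e (under X s) E h"
        "\<And>z. z \<in> under X s \<Longrightarrow> p (h z) = f z" "\<And>x. x \<in> X \<Longrightarrow> h (x @ [0]) = g x"
      using gd unfolding good_def by blast+
    obtain s' h' where s': "dsf M m s'" "cont_fun X s'" "\<And>x. length x = m \<Longrightarrow> s' x \<in> {s x..1}"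
      and h': "definable_continuous_map M (m + 1) e (under X s') E h'"
        "\<And>z. z \<in> under X s' \<Longrightarrow> p (h' z) = f z" "\<And>x. x \<in> X \<Longrightarrow> h' (x @ [0]) = h (x @ [0])"
      and pr: "\<forall>x\<in>X. s' x = 1 \<or> s x + 1 / 4 \<le> s' x \<or> (\<exists>r\<in>{s x..s' x}. \<zeta> (x @ [r]) < 0)"
      using lift_extends[OF om X f fib \<zeta>(1,2,3,4) s h(1,2)] by blast
    have "s' x \<in> {0..1}" if "length x = m" for x using s(3)[OF that] s'(3)[OF that] by auto
    then have "good s' h'" unfolding good_def using s' h' h(3) by simp
    moreover have "\<forall>x\<in>X. s x \<le> s' x" using s'(3) len by simp
    ultimately show ?thesis using pr by blast
  qed
  \<comment> \<open>After \<open>n\<close> double steps, quarters of time and switches passed add up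
    to at least \<open>n\<close> wherever time 1 is not reached. The share \<open>l\<close> of time
    depends on \<open>x\<close>, the number of double steps does not.\<close>
  have "\<exists>s h. good s h \<and> (\<forall>x\<in>X. s x = 1 \<or>
      (\<exists>l. of_nat l / 4 \<le> s x \<and> n \<le> l + card {t. D x t \<and> t \<le> s x}))" for n
  proof (induction n)
    case 0
    \<comment> \<open>No time has passed: the domain is a copy of \<open>X\<close> at time 0, where
      \<open>g\<close> is the lift.\<close>
    define s :: "'a list \<Rightarrow> 'a" where "s = (\<lambda>x. 0)"
    define h where "h z = g (butlast z)" for z
    have g': "definable M (m + e) {x @ g x | x. x \<in> X}" "g \<in> X \<rightarrow> E" "cont_on X g"
      using g unfolding definable_continuous_map_iff by blast+
    have ds: "dsf M m s" unfolding dsf_def s_def by (rule dsc_const)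
    have under: "x \<in> X \<and> t = 0" if "x @ [t] \<in> under X s" for x t using that unfolding s_def by auto
    have butl: "butlast z \<in> X" if "z \<in> under X s" for z
      using that under by (metis under_cases butlast_snoc)
    have "definable_continuous_map M (m + 1) e (under X s) E h"
      unfolding definable_continuous_map_iff
    proof (intro conjI)
      show "definable M (m + 1) (under X s)" using definable_under[OF X ds] by simp
      show "definable M e E" by (rule E)
      show "h \<in> under X s \<rightarrow> E" using butl g'(2) unfolding h_def by blast
      have "definable M (Suc m + e) {z @ h z | z. z \<in> under X s}"
      proof (rule definable_graph_snocI[OF definable_under[OF X ds]])
        show "length (h z) = e" if "z \<in> under X s" for z
          using butl[OF that] g'(2) definable_length[OF E] unfolding h_def by blast
        show "y = h (x @ [t]) \<longleftrightarrow> x @ y \<in> {x @ g x | x. x \<in> X}"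
          if "x @ [t] \<in> under X s" "length x = m" for x t y
          unfolding mem_graph_iff[OF X that(2)] h_def using under[OF that(1)] by simp
        show "dfn M (\<lambda>v. map v [0..<m] @ map (\<lambda>i. v (i + Suc m)) [0..<e] \<in> {x @ g x | x. x \<in> X})"
          by (intro dfn_mem[OF g'(1)] dfn_intros)
      qed
      then show "definable M (m + 1 + e) {z @ h z | z. z \<in> under X s}" by simp
      show "cont_on (under X s) h"
        unfolding h_def[abs_def]
        by (rule cont_on_compose[OF cont_on_butlast[OF Nil_notin_under] _ g'(3)]) (use butl in blast)
    qed
    moreover have "\<forall>z\<in>under X s. p (h z) = f z"
    proof
      fix z assume z: "z \<in> under X s"
      then obtain x t where xt: "z = x @ [t]" by (rule under_cases)
      with z under[of x t] pg show "p (h z) = f z" unfolding h_def by simp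
    qed
    ultimately have "good s h"
      unfolding good_def using ds by (auto simp: s_def h_def cont_fun_const)
    then show ?case by (intro exI[of _ s] exI[of _ h]) (auto simp: s_def intro!: exI[of _ 0])
  next
    case (Suc n)
    then obtain s h where sh: "good s h"
      and pr: "\<And>x. x \<in> X \<Longrightarrow> s x = 1 \<or> (\<exists>l. of_nat l / 4 \<le> s x \<and> n \<le> l + card {t. D x t \<and> t \<le> s x})"
      by blast
    obtain s1 h1 where s1: "good s1 h1" "\<And>x. x \<in> X \<Longrightarrow> s x \<le> s1 x"
      "\<And>x. x \<in> X \<Longrightarrow> s1 x = 1 \<or> s x + 1 / 4 \<le> s1 x \<or> (\<exists>r\<in>{s x..s1 x}. \<gamma> (x @ [r]) < 0)"
      using step[OF sh fU \<gamma>(1-3) \<gamma>U] by blast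
    obtain s2 h2 where s2: "good s2 h2" "\<And>x. x \<in> X \<Longrightarrow> s1 x \<le> s2 x"
      "\<And>x. x \<in> X \<Longrightarrow> s2 x = 1 \<or> s1 x + 1 / 4 \<le> s2 x \<or> (\<exists>r\<in>{s1 x..s2 x}. - \<gamma> (x @ [r]) < 0)"
      using step[OF s1(1) fV m\<gamma> \<gamma>V] by blast
    have "s2 x = 1 \<or> (\<exists>l. of_nat l / 4 \<le> s2 x \<and> Suc n \<le> l + card {t. D x t \<and> t \<le> s2 x})"
      if x: "x \<in> X" for x
    proof (cases "s2 x = 1")
      case False
      have "s2 x \<in> {0..1}" "s x \<in> {0..1}" using s2(1) sh len[OF x] unfolding good_def by blast+
      then have lt: "s2 x < 1" "s1 x < 1" "s x < 1" "0 \<le> s x"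
        using False s1(2)[OF x] s2(2)[OF x] by auto
      then obtain l where l: "of_nat l / 4 \<le> s x" "n \<le> l + card {t. D x t \<and> t \<le> s x}" using pr[OF x] by auto
      have fin: "finite {t. D x t \<and> t \<le> c}" for c using finD[OF len[OF x]] by (rule finite_subset[rotated]) auto
      \<comment> \<open>Either the double step gains a quarter of time, or its first half meets a
        negative and its second half a positive value of \<open>\<gamma>\<close>.\<close>
      consider "s x + 1 / 4 \<le> s2 x"
        | r r' where "r \<in> {s x..s1 x}" "r' \<in> {s1 x..s2 x}" "\<gamma> (x @ [r]) < 0" "0 < \<gamma> (x @ [r'])"
        using s1(2,3)[OF x] s2(2,3)[OF x] lt by fastforce
      then have "\<exists>l. of_nat l / 4 \<le> s2 x \<and> Suc n \<le> l + card {t. D x t \<and> t \<le> s2 x}"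
      proof cases
        case 1
        have "of_nat (Suc l) / 4 \<le> s2 x" using 1 l(1) by (simp add: add_divide_distrib)
        moreover have "card {t. D x t \<and> t \<le> s x} \<le> card {t. D x t \<and> t \<le> s2 x}"
          using s1(2)[OF x] s2(2)[OF x] by (intro card_mono fin) auto
        ultimately show ?thesis using l(2) by (intro exI[of _ "Suc l"]) auto
      next
        case 2
        have I: "r \<in> {0..1}" "r' \<in> {0..1}" "r \<le> r'" using 2 lt s1(2)[OF x] s2(2)[OF x] by auto
        have "\<exists>\<delta>>0. \<forall>u\<in>{0..1}. \<bar>u - r\<bar> < \<delta> \<longrightarrow> \<bar>\<gamma> (x @ [r]) - \<gamma> (x @ [u])\<bar> < - \<gamma> (x @ [r])"
          by (rule cont_fun_fibre[OF \<gamma>(2) x I(1)]) (use 2 in simp)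
        from sign_change_switch[OF om d\<gamma>[OF len[OF x]] this I 2(3,4)] obtain d where
          d: "r < d" "d \<le> r'" "D x d" unfolding D_def by blast
        \<comment> \<open>The switch \<open>d\<close> lies strictly after \<open>r\<close>, hence
          after \<open>s x\<close>, and was not counted before.\<close>
        have "Suc (card {t. D x t \<and> t \<le> s x}) = card (insert d {t. D x t \<and> t \<le> s x})"
          using d 2 fin by auto
        also have "\<dots> \<le> card {t. D x t \<and> t \<le> s2 x}"
          using d 2 s1(2)[OF x] s2(2)[OF x] by (intro card_mono fin) auto
        finally show ?thesis using l s1(2)[OF x] s2(2)[OF x] by (intro exI[of _ l]) auto
      qed
      then show ?thesis by blast
    qed blast
    with s2(1) show ?case by blast
  qed
  \<comment> \<open>Before time 1 at most three units come from time and at most \<open>N\<close>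
    from switches, so \<open>N + 4\<close> double steps suffice.\<close>
  from this[of "N + 4"] obtain s h where sh: "good s h"
    and pr: "\<And>x. x \<in> X \<Longrightarrow> s x = 1 \<or> (\<exists>l. of_nat l / 4 \<le> s x \<and> N + 4 \<le> l + card {t. D x t \<and> t \<le> s x})"
    by blast
  have one: "s x = 1" if x: "x \<in> X" for x
  proof (rule ccontr)
    assume "s x \<noteq> 1"
    with pr[OF x] obtain l where l: "of_nat l / 4 \<le> s x" "N + 4 \<le> l + card {t. D x t \<and> t \<le> s x}" by blast
    have "s x < 1" using \<open>s x \<noteq> 1\<close> sh len[OF x] unfolding good_def by (force simp: less_le)
    moreover have "of_nat l \<le> 4 * s x" using l(1) by (simp add: field_simps)
    ultimately have "of_nat l < (4 :: 'a)" by linarith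
    then have "l < 4" using of_nat_less_iff[of l 4, where 'a = 'a] by simp
    moreover have "card {t. D x t \<and> t \<le> s x} \<le> card {t. D x t}"
      using finD[OF len[OF x]] by (intro card_mono) auto
    ultimately show False using l(2) N[OF len[OF x]] by simp
  qed
  then have "under X s = cylinder X" unfolding under_def cylinder_def by fastforce
  with sh show "\<exists>h. definable_continuous_map M (m + 1) e (cylinder X) E h \<and>
      (\<forall>z\<in>cylinder X. p (h z) = f z) \<and> (\<forall>x\<in>X. h (x @ [0]) = g x)"
    unfolding good_def by auto
qed

text \<open>A cylinder mapped into the empty set is empty, and so is its base \<open>X\<close>. This
  starts the induction on the covering.\<close>

lemma definable_fibration_empty: "definable_fibration M e b {} {} p"
proof -
  have dcm: "definable_continuous_map M k n {} {} q" for k n q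
    unfolding definable_continuous_map_iff by (auto simp: definable_empty cont_on_def)
  show ?thesis
    unfolding definable_fibration_def
  proof (intro conjI allI impI dcm)
    fix m X f g
    assume "definable_continuous_map M (m + 1) b (cylinder X) {} f"
    then have c: "cylinder X = {}" unfolding definable_continuous_map_iff by blast
    have "x @ [0] \<in> cylinder X" if "x \<in> X" for x using that by simp
    with c have "X = {}" by blast
    with c show "\<exists>h. definable_continuous_map M (m + 1) e (cylinder X) {} h \<and>
        (\<forall>z\<in>cylinder X. p (h z) = f z) \<and> (\<forall>x\<in>X. h (x @ [0]) = g x)"
      using dcm by simp
  qed
qed

theorem theorem2p12:
  fixes M :: "('a::real_closed_field, 'f, 'r) expansion"
    and e b :: nat
    and E B :: "'a list set"
    and p :: "'a list \<Rightarrow> 'a list"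
    and \<U> :: "'a list set set"
  assumes "o_minimal M"
    and "definable M e E"
    and "definable M b B"
    and "definable_continuous_map M e b E B p"
    and "finite \<U>"
    and "\<And>U. U \<in> \<U> \<Longrightarrow> definable M b U"
    and "\<And>U. U \<in> \<U> \<Longrightarrow> openin (subtopology (power_topology b) B) U"
    and "\<Union>\<U> = B"
    and "\<And>U. U \<in> \<U> \<Longrightarrow> definable_fibration M e b {x \<in> E. p x \<in> U} U p"
  shows "definable_fibration M e b E B p"
proof -
  have B: "B \<subseteq> {y. length y = b}" using definable_length[OF assms(3)] by blast
  \<comment> \<open>Induction on subfamilies: their unions serve as bases, so that the case of two
    open sets applies to the new member and the union of the others.\<close>
  have "definable M b (\<Union>\<V>) \<and> openin (subtopology (power_topology b) B) (\<Union>\<V>) \<and>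
      definable_fibration M e b {x \<in> E. p x \<in> \<Union>\<V>} (\<Union>\<V>) p" if "finite \<V>" "\<V> \<subseteq> \<U>" for \<V>
    using that
  proof (induction \<V> rule: finite_induct)
    case empty
    show ?case by (simp add: definable_empty definable_fibration_empty)
  next
    case (insert U \<V>)
    have U: "definable M b U" "openin (subtopology (power_topology b) B) U"
      "definable_fibration M e b {x \<in> E. p x \<in> U} U p"
      using insert.prems assms(6,7,9) by auto
    define W where "W = \<Union>\<V>"
    have W: "definable M b W" "openin (subtopology (power_topology b) B) W"
      "definable_fibration M e b {x \<in> E. p x \<in> W} W p"
      using insert unfolding W_def by auto
    define E' where "E' = {x \<in> E. p x \<in> U \<union> W}"
    have UW: "definable M b (U \<union> W)" "openin (subtopology (power_topology b) B) (U \<union> W)"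
      using definable_Un[OF U(1) W(1)] openin_Un[OF U(2) W(2)] by blast+
    have sub: "U \<union> W \<subseteq> B"
      using UW(2)[unfolded openin_subtopology_near[OF B]] by (rule conjunct1)
    have sub': "openin (subtopology (power_topology b) (U \<union> W)) S"
      if S: "S \<subseteq> U \<union> W" "openin (subtopology (power_topology b) B) S" for S
    proof -
      have UWb: "U \<union> W \<subseteq> {y. length y = b}" using sub B by blast
      show ?thesis
        unfolding openin_subtopology_near[OF UWb]
      proof (intro conjI ballI S(1))
        fix x assume "x \<in> S"
        then obtain \<epsilon> where "\<epsilon> > 0" "\<forall>y\<in>B. near \<epsilon> x y \<longrightarrow> y \<in> S"
          using S(2)[unfolded openin_subtopology_near[OF B], THEN conjunct2] by blast
        with sub show "\<exists>\<epsilon>>0. \<forall>y\<in>U \<union> W. near \<epsilon> x y \<longrightarrow> y \<in> S" by blast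
      qed
    qed
    have "definable_fibration M e b E' (U \<union> W) p"
    proof (rule definable_fibration_Un[OF assms(1) _ refl])
      show "definable_continuous_map M e b E' (U \<union> W) p"
        using definable_preimage[OF assms(4) UW(1)] UW(1) unfolding E'_def
        by (intro definable_continuous_map_restrict[OF assms(4)]) auto
      show "openin (subtopology (power_topology b) (U \<union> W)) U"
        "openin (subtopology (power_topology b) (U \<union> W)) W"
        using sub' U(2) W(2) by blast+
      have "{x \<in> E'. p x \<in> U} = {x \<in> E. p x \<in> U}" "{x \<in> E'. p x \<in> W} = {x \<in> E. p x \<in> W}"
        unfolding E'_def by auto
      then show "definable_fibration M e b {x \<in> E'. p x \<in> U} U p"
        "definable_fibration M e b {x \<in> E'. p x \<in> W} W p"
        using U(3) W(3) by simp_all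
    qed
    with UW show ?case unfolding E'_def W_def by simp
  qed
  from this[OF assms(5) subset_refl] have "definable_fibration M e b {x \<in> E. p x \<in> B} B p"
    unfolding assms(8) by blast
  moreover have "{x \<in> E. p x \<in> B} = E"
    using assms(4) unfolding definable_continuous_map_iff by blast
  ultimately show ?thesis by simp
qed

end
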